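(* Let $\Gamma=([n],E_\Gamma)$ be a connected simple graph and let $\lambda=\{\lambda_1,\dots,\lambda_n\}$ be generic. Let $\mu$ be the GKM graph of the $T^n$-manifold $M_{\Gamma,\lambda}$, whose vertices are the fixed points $A_\sigma$, $\sigma\in S_n$. Then the GKM graph of the $T^n$-manifold $Q_{\Gamma,\lambda}$ is the graph $\eta$ obtained from $\mu$ by the following construction. (1) For every vertex $A_\sigma$ of $\mu$ one makes $2^n$ vertices of $\eta$, denoted $A_{s,\sigma}$, $s=(s_1,\dots,s_n)\in\mathbb{Z}_2^n$. (2) For every edge of $\mu$ between vertices $A_\sigma$ and $A_{\sigma\cdot(i,j)}$ one makes $2^n$ edges of $\eta$. Each of them connects vertices $A_{s,\sigma}$ and $A_{s',\sigma\cdot(i,j)}$, where $s_k=s'_k$ for all $k\notin\{i,j\}$ and $s_i+s_j=s'_i+s'_j$. (3) The set of edges of $\eta$ is equipped with the axial function $\alpha$ defined by: $\alpha(A_{s,\sigma}A_{s',\sigma\cdot(i,j)})=\epsilon_i+\epsilon_j$ if $s_i=s'_i$ (equivalently $s_j=s'_j$), and $\alpha(A_{s,\sigma}A_{s',\sigma\cdot(i,j)})=\epsilon_i-\epsilon_j$ if $s_i\neq s'_i$ (equivalently $s_j\neq s'_j$).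
   Context: $[n]=\{1,\dots,n\}$; $(i,j)$ denotes the transposition of $i$ and $j$. $\epsilon_1,\dots,\epsilon_n$ is the standard basis of $\mathrm{Hom}(T^n,S^1)\cong\mathbb{Z}^n$, $\epsilon_i(t_1,\dots,t_n)=t_i$. Hermitian matrices: $M_\Gamma$ is the real vector space of Hermitian $n\times n$ matrices $A=(a_{ij})$ with $a_{ij}=0$ whenever $i\neq j$ and $\{i,j\}\notin E_\Gamma$. For real numbers $\lambda_1,\dots,\lambda_n$, $M_{\Gamma,\lambda}\subset M_\Gamma$ is the subset of matrices with eigenvalues $\lambda_1,\dots,\lambda_n$. The torus $T^n=\{\mathrm{diag}(t_1,\dots,t_n): t_k\in\mathbb{C},\ |t_k|=1\}$ acts on it by conjugation. The fixed points are $A_\sigma=\mathrm{diag}(\lambda_{\sigma(1)},\dots,\lambda_{\sigma(n)})$. Skew-symmetric matrices: view a real skew-symmetric $2n\times 2n$ matrix as an $n\times n$ array of $2\times2$ blocks. $Q_\Gamma$ is the vector space of real skew-symmetric $2n\times2n$ matrices whose $(i,j)$ block is zero whenever $i\ne j$ and $\{i,j\}\notin E_\Gamma$. $Q_{\Gamma,\lambda}\subset Q_\Gamma$ is the subset of matrices with eigenvalues $\pm\sqrt{-1}\,\lambda_1,\dots,\pm\sqrt{-1}\,\lambda_n$. The torus $T^n\cong SO(2)^n$, embedded as block-diagonal matrices with $2\times 2$ rotation blocks, acts on it by conjugation. $A_{s,\sigma}$ is the block-diagonal matrix whose $k$-th diagonal block is $\begin{pmatrix}0&(-1)^{s_k}\lambda_{\sigma(k)}\\-(-1)^{s_k}\lambda_{\sigma(k)}&0\end{pmatrix}$;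 these are the fixed points of $Q_{\Gamma,\lambda}$. Generic: $\lambda$ is chosen so that $M_{\Gamma,\lambda}$ and $Q_{\Gamma,\lambda}$ are smooth manifolds. GKM graph: for a $T$-manifold $X$, let $X_0$ be the set of fixed points and $X_1$ the union of orbits of dimension at most $1$; suppose $X_0$ is finite and $X_1$ is a union of $T$-invariant 2-spheres, each connecting two fixed points. The GKM graph has vertex set $X_0$ and edge set $X_1/T$ (one edge per invariant 2-sphere, joining its two fixed points), and is equipped with an axial function assigning to each edge the corresponding weight, in $\mathrm{Hom}(T,S^1)$, of the tangent representation at a fixed point; weights are determined only up to sign.
   Formalization: Axial rule corrected: ε_i−(−1)^(s_i+s_j)ε_j if s_i=s'_i, else ε_i+(−1)^(s_i+s_j)ε_j (as printed it fails when s_i=s_j); each edge of μ gives 2^(n+1) edges, not 2^n; generic also means the |λ_k| are distinct and nonzero. *)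

theory Defs
  imports "HOL-Analysis.Analysis" "HOL-Library.Z2"
begin

section \<open>Smooth submanifolds of a Euclidean space\<close>

primrec Ck_on :: "nat \<Rightarrow> ('a::euclidean_space \<Rightarrow> 'b::real_normed_vector) \<Rightarrow> 'a set \<Rightarrow> bool" where
  "Ck_on 0 f U \<longleftrightarrow> continuous_on U f"
| "Ck_on (Suc k) f U \<longleftrightarrow>
     (\<exists>D. (\<forall>x\<in>U. (f has_derivative D x) (at x)) \<and> (\<forall>v. Ck_on k (\<lambda>x. D x v) U))"

definition Cinf_on :: "('a::euclidean_space \<Rightarrow> 'b::real_normed_vector) \<Rightarrow> 'a set \<Rightarrow> bool" where
  "Cinf_on f U \<longleftrightarrow> (\<forall>k. Ck_on k f U)"

text \<open>Embedded submanifolds without boundary, given locally as the zero set of a smooth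
  submersion onto a subspace \<open>W\<close> of codimension \<open>d\<close>.  Values of \<open>F\<close> are taken in the
  ambient space because the codimension cannot be a type.\<close>

definition smooth_submanifold :: "nat \<Rightarrow> 'a::euclidean_space set \<Rightarrow> bool" where
  "smooth_submanifold d S \<longleftrightarrow>
     (\<forall>p\<in>S. \<exists>U W. \<exists>F :: 'a \<Rightarrow> 'a.
        open U \<and> p \<in> U \<and> subspace W \<and> dim W + d = DIM('a) \<and>
        Cinf_on F U \<and> F ` U \<subseteq> W \<and> S \<inter> U = {x \<in> U. F x = 0} \<and>
        (\<forall>x\<in>U. \<exists>D. (F has_derivative D) (at x) \<and> range D = W))"

text \<open>Velocities at \<open>p\<close> of curves lying in \<open>S\<close>.\<close>

definition tangent_space :: "'a::euclidean_space set \<Rightarrow> 'a \<Rightarrow> 'a set" where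
  "tangent_space S p =
     {v. \<exists>c :: real \<Rightarrow> 'a. c 0 = p \<and> (\<forall>t. c t \<in> S) \<and> (c has_vector_derivative v) (at 0)}"


section \<open>Torus actions\<close>

definition torus :: "(complex^'n) set" where
  "torus = {t. \<forall>k. cmod (t $ k) = 1}"

text \<open>The character of \<open>T\<^sup>n\<close> that corresponds to \<open>w \<in> \<int>\<^sup>n\<close>.\<close>

definition torus_char :: "int^'n \<Rightarrow> complex^'n \<Rightarrow> complex" where
  "torus_char w t = (\<Prod>k\<in>UNIV. (t $ k) powi (w $ k))"

definition eps :: "'n \<Rightarrow> int^'n" where
  "eps i = axis i 1"

text \<open>Multiplication and unit of type \<open>complex^'n\<close> are componentwise, which is the group structure
  of the torus.\<close>

definition linear_torus_action :: "(complex^'n \<Rightarrow> 'a \<Rightarrow> 'a::euclidean_space) \<Rightarrow> bool" where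
  "linear_torus_action act \<longleftrightarrow>
     (\<forall>t\<in>torus. linear (act t)) \<and> act 1 = id \<and>
     (\<forall>s\<in>torus. \<forall>t\<in>torus. act (s * t) = act s \<circ> act t) \<and>
     continuous_on (torus \<times> UNIV) (\<lambda>(t, x). act t x)"

definition torus_invariant :: "(complex^'n \<Rightarrow> 'a \<Rightarrow> 'a) \<Rightarrow> 'a set \<Rightarrow> bool" where
  "torus_invariant act S \<longleftrightarrow> (\<forall>t\<in>torus. act t ` S \<subseteq> S)"

text \<open>A submanifold of a linear representation of the torus that is mapped to itself.\<close>

definition torus_manifold :: "(complex^'n \<Rightarrow> 'a \<Rightarrow> 'a::euclidean_space) \<Rightarrow> 'a set \<Rightarrow> bool" where
  "torus_manifold act X \<longleftrightarrow>
     linear_torus_action act \<and> (\<exists>d. smooth_submanifold d X) \<and> torus_invariant act X"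

definition torus_orbit :: "(complex^'n \<Rightarrow> 'a \<Rightarrow> 'a) \<Rightarrow> 'a \<Rightarrow> 'a set" where
  "torus_orbit act x = (\<lambda>t. act t x) ` torus"

definition fixed_points :: "(complex^'n \<Rightarrow> 'a \<Rightarrow> 'a) \<Rightarrow> 'a set \<Rightarrow> 'a set" where
  "fixed_points act X = {x \<in> X. \<forall>t\<in>torus. act t x = x}"

definition one_skeleton :: "(complex^'n \<Rightarrow> 'a \<Rightarrow> 'a::euclidean_space) \<Rightarrow> 'a set \<Rightarrow> 'a set" where
  "one_skeleton act X = {x \<in> X. \<exists>d\<le>1. smooth_submanifold d (torus_orbit act x)}"

definition invariant_spheres ::
    "(complex^'n \<Rightarrow> 'a \<Rightarrow> 'a::euclidean_space) \<Rightarrow> 'a set \<Rightarrow> 'a set set" where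
  "invariant_spheres act X =
     {S. S \<subseteq> one_skeleton act X \<and> torus_invariant act S \<and>
         smooth_submanifold 2 S \<and> S homeomorphic sphere (0 :: real^3) 1 \<and>
         card (S \<inter> fixed_points act X) = 2}"

text \<open>The real two-dimensional representation \<open>V\<close> has weight \<open>w\<close> if some identification of \<open>V\<close>
  with the complex numbers turns it into the character \<open>w\<close>.  The conjugate identification shows
  that then \<open>- w\<close> is a weight as well.\<close>

definition has_weight ::
    "(complex^'n \<Rightarrow> 'a \<Rightarrow> 'a::euclidean_space) \<Rightarrow> 'a set \<Rightarrow> int^'n \<Rightarrow> bool" where
  "has_weight act V w \<longleftrightarrow>
     subspace V \<and>
     (\<exists>\<phi> :: 'a \<Rightarrow> complex. linear \<phi> \<and> bij_betw \<phi> V UNIV \<and>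
        (\<forall>t\<in>torus. \<forall>v\<in>V. act t v \<in> V \<and> \<phi> (act t v) = torus_char w t * \<phi> v))"


section \<open>GKM graphs\<close>

text \<open>The axial function takes values in subsets of \<open>\<int>\<^sup>n\<close>: a weight determined up to sign is the
  set \<open>{w, - w}\<close>.\<close>

record ('v, 'e, 'w) axial_graph =
  verts :: "'v set"
  edges :: "'e set"
  ends :: "'e \<Rightarrow> 'v set"
  axial :: "'e \<Rightarrow> 'w set"

text \<open>The torus acts linearly on the ambient space, so at a fixed point its tangent representation
  is the restriction of the same action.\<close>

definition gkm_graph ::
    "(complex^'n \<Rightarrow> 'a \<Rightarrow> 'a::euclidean_space) \<Rightarrow> 'a set \<Rightarrow> ('a, 'a set, int^'n) axial_graph" where
  "gkm_graph act X =
     \<lparr> verts = fixed_points act X,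
       edges = invariant_spheres act X,
       ends = (\<lambda>S. S \<inter> fixed_points act X),
       axial = (\<lambda>S. {w. \<forall>p \<in> S \<inter> fixed_points act X. has_weight act (tangent_space S p) w}) \<rparr>"

text \<open>Isolated points of the one-skeleton are allowed; they occur for \<open>n = 1\<close>.\<close>

definition gkm_manifold :: "(complex^'n \<Rightarrow> 'a \<Rightarrow> 'a::euclidean_space) \<Rightarrow> 'a set \<Rightarrow> bool" where
  "gkm_manifold act X \<longleftrightarrow>
     torus_manifold act X \<and> finite (fixed_points act X) \<and>
     one_skeleton act X = fixed_points act X \<union> \<Union> (invariant_spheres act X)"

definition axial_graph_iso ::
    "('v \<Rightarrow> 'v2) \<Rightarrow> ('e \<Rightarrow> 'e2) \<Rightarrow> ('v, 'e, 'w) axial_graph \<Rightarrow> ('v2, 'e2, 'w) axial_graph \<Rightarrow> bool"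
  where
  "axial_graph_iso f g G H \<longleftrightarrow>
     bij_betw f (verts G) (verts H) \<and> bij_betw g (edges G) (edges H) \<and>
     (\<forall>e\<in>edges G. ends H (g e) = f ` ends G e \<and> axial H (g e) = axial G e)"


section \<open>Isospectral matrices supported on a graph\<close>

definition simple_graph :: "'n set set \<Rightarrow> bool" where
  "simple_graph E \<longleftrightarrow> (\<forall>e\<in>E. card e = 2)"

definition connected_graph :: "'n set set \<Rightarrow> bool" where
  "connected_graph E \<longleftrightarrow> (\<forall>i j. (i, j) \<in> {(a, b). {a, b} \<in> E}\<^sup>*)"

text \<open>Eigenvalues are counted with algebraic multiplicity.\<close>

definition has_eigenvalues :: "complex^'m^'m \<Rightarrow> complex multiset \<Rightarrow> bool" where
  "has_eigenvalues A \<Lambda> \<longleftrightarrow> (\<forall>z. det (mat z - A) = (\<Prod>x\<in>#\<Lambda>. z - x))"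

definition diag_matrix :: "('n \<Rightarrow> complex) \<Rightarrow> complex^'n^'n" where
  "diag_matrix d = (\<chi> i j. if i = j then d i else 0)"

definition herm_space :: "'n set set \<Rightarrow> (complex^'n^'n) set" where
  "herm_space E = {A. (\<forall>i j. A $ i $ j = cnj (A $ j $ i)) \<and>
                      (\<forall>i j. i \<noteq> j \<and> {i, j} \<notin> E \<longrightarrow> A $ i $ j = 0)}"

definition herm_isospectral :: "'n set set \<Rightarrow> ('n \<Rightarrow> real) \<Rightarrow> (complex^'n^'n) set" where
  "herm_isospectral E l =
     {A \<in> herm_space E. has_eigenvalues A {# complex_of_real (l k). k \<in># mset_set UNIV #}}"

definition herm_act :: "complex^'n \<Rightarrow> complex^'n^'n \<Rightarrow> complex^'n^'n" where
  "herm_act t A = diag_matrix (($) t) ** A ** matrix_inv (diag_matrix (($) t))"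

definition herm_vertex :: "('n \<Rightarrow> real) \<Rightarrow> ('n \<Rightarrow> 'n) \<Rightarrow> complex^'n^'n" where
  "herm_vertex l \<sigma> = diag_matrix (\<lambda>k. complex_of_real (l (\<sigma> k)))"

text \<open>Rows and columns of a \<open>2n \<times> 2n\<close> matrix are indexed by pairs \<open>(i, a)\<close>, where \<open>i\<close> is the number
  of the block and \<open>a\<close> the position inside the block.\<close>

definition block_diag :: "('n::finite \<Rightarrow> real^2^2) \<Rightarrow> real^('n \<times> 2)^('n \<times> 2)" where
  "block_diag B = (\<chi> p q. if fst p = fst q then B (fst p) $ snd p $ snd q else 0)"

definition skew_space :: "'n::finite set set \<Rightarrow> (real^('n \<times> 2)^('n \<times> 2)) set" where
  "skew_space E = {A. transpose A = - A \<and>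
                      (\<forall>i j a b. i \<noteq> j \<and> {i, j} \<notin> E \<longrightarrow> A $ (i, a) $ (j, b) = 0)}"

definition skew_isospectral :: "'n::finite set set \<Rightarrow> ('n \<Rightarrow> real) \<Rightarrow> (real^('n \<times> 2)^('n \<times> 2)) set" where
  "skew_isospectral E l =
     {A \<in> skew_space E. has_eigenvalues (map_matrix complex_of_real A)
        ({# \<i> * complex_of_real (l k). k \<in># mset_set UNIV #} +
         {# - \<i> * complex_of_real (l k). k \<in># mset_set UNIV #})}"

definition rotation_block :: "complex \<Rightarrow> real^2^2" where
  "rotation_block z = vector [vector [Re z, - Im z], vector [Im z, Re z]]"

definition skew_act ::
    "complex^'n::finite \<Rightarrow> real^('n \<times> 2)^('n \<times> 2) \<Rightarrow> real^('n \<times> 2)^('n \<times> 2)" where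
  "skew_act t A = block_diag (\<lambda>k. rotation_block (t $ k)) ** A **
                  matrix_inv (block_diag (\<lambda>k. rotation_block (t $ k)))"

definition bit_sign :: "bit \<Rightarrow> 'a::ring_1" where
  "bit_sign b = (if b = 0 then 1 else - 1)"

definition skew_vertex ::
    "('n::finite \<Rightarrow> real) \<Rightarrow> ('n \<Rightarrow> bit) \<Rightarrow> ('n \<Rightarrow> 'n) \<Rightarrow> real^('n \<times> 2)^('n \<times> 2)" where
  "skew_vertex l s \<sigma> = block_diag (\<lambda>k. vector [vector [0, bit_sign (s k) * l (\<sigma> k)],
                                               vector [- (bit_sign (s k) * l (\<sigma> k)), 0]])"

text \<open>The last two conditions say that the eigenvalues \<open>\<plusminus> \<i> * l k\<close> are pairwise distinct.  They do
  not follow from smoothness (\<open>M\<close> is a single point if all \<open>l k\<close> coincide) and without them the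
  fixed points would not be in bijection with (signed) permutations.\<close>

definition generic_spectrum :: "'n::finite set set \<Rightarrow> ('n \<Rightarrow> real) \<Rightarrow> bool" where
  "generic_spectrum E l \<longleftrightarrow>
     (\<exists>d. smooth_submanifold d (herm_isospectral E l)) \<and>
     (\<exists>d. smooth_submanifold d (skew_isospectral E l)) \<and>
     inj (\<lambda>k. \<bar>l k\<bar>) \<and> (\<forall>k. l k \<noteq> 0)"


section \<open>The graph obtained from the Hermitian one\<close>

definition compatible_signs :: "'n \<Rightarrow> 'n \<Rightarrow> ('n \<Rightarrow> bit) \<Rightarrow> ('n \<Rightarrow> bit) \<Rightarrow> bool" where
  "compatible_signs i j s s' \<longleftrightarrow> (\<forall>k. k \<notin> {i, j} \<longrightarrow> s k = s' k) \<and> s i + s j = s' i + s' j"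

text \<open>The weight (up to sign) of an edge from \<open>(s, \<sigma>)\<close> to \<open>(s', \<sigma> \<circ> (i j))\<close>.  For \<open>s i \<noteq> s j\<close> it is
  \<open>\<epsilon>\<^sub>i + \<epsilon>\<^sub>j\<close> if \<open>s i = s' i\<close> and \<open>\<epsilon>\<^sub>i - \<epsilon>\<^sub>j\<close> otherwise; for \<open>s i = s j\<close> the two are exchanged.
  The dependence on \<open>s i + s j\<close> is necessary: for \<open>s = s' = 0\<close> the invariant sphere consists of
  matrices whose blocks at \<open>i, j\<close> commute with the complex structure, so it is fixed by the
  elements with \<open>t\<^sub>i = t\<^sub>j\<close>.\<close>

definition skew_weight :: "'n \<Rightarrow> 'n \<Rightarrow> ('n \<Rightarrow> bit) \<Rightarrow> ('n \<Rightarrow> bit) \<Rightarrow> int^'n" where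
  "skew_weight i j s s' =
     (if s i = s' i then eps i - bit_sign (s i + s j) *s eps j
      else eps i + bit_sign (s i + s j) *s eps j)"

text \<open>Vertex \<open>(s, A\<^sub>\<sigma>)\<close> stands for \<open>A\<^sub>s\<^sub>,\<^sub>\<sigma>\<close>.  An edge is the edge \<open>e\<close> of \<open>\<mu>\<close> that it
  comes from, together with its set of end points.\<close>

definition eta_graph ::
    "('n \<Rightarrow> real) \<Rightarrow> (complex^'n^'n, 'e, int^'n) axial_graph \<Rightarrow>
     (('n \<Rightarrow> bit) \<times> (complex^'n^'n), 'e \<times> (('n \<Rightarrow> bit) \<times> (complex^'n^'n)) set, int^'n) axial_graph"
  where
  "eta_graph l \<mu> =
     \<lparr> verts = UNIV \<times> verts \<mu>,
       edges = {(e, {(s, herm_vertex l \<sigma>), (s', herm_vertex l (\<sigma> \<circ> Transposition.transpose i j))})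
                | e s s' \<sigma> i j. e \<in> edges \<mu> \<and> bij \<sigma> \<and> i \<noteq> j \<and>
                  ends \<mu> e = {herm_vertex l \<sigma>, herm_vertex l (\<sigma> \<circ> Transposition.transpose i j)} \<and>
                  compatible_signs i j s s'},
       ends = snd,
       axial = (\<lambda>(e, P). {w. \<exists>s s' \<sigma> i j. bij \<sigma> \<and> i \<noteq> j \<and> compatible_signs i j s s' \<and>
                  P = {(s, herm_vertex l \<sigma>), (s', herm_vertex l (\<sigma> \<circ> Transposition.transpose i j))} \<and>
                  w \<in> {skew_weight i j s s', - skew_weight i j s s'}}) \<rparr>"

end

theory Submission
  imports Defs
begin

text \<open>Both manifolds lie in a linear representation whose coordinates are a diagonal part in
  \<open>\<real>\<^sup>n\<close>, fixed by the torus, and one complex coordinate for each root: for every edge \<open>{i, j}\<close> there is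
  the root \<open>\<epsilon>\<^sub>i - \<epsilon>\<^sub>j\<close> in the Hermitian case, and there are the two roots \<open>\<epsilon>\<^sub>i \<plusminus> \<epsilon>\<^sub>j\<close> in the
  skew-symmetric case, because a real \<open>2 \<times> 2\<close> block splits into a complex linear and an antilinear
  part.  The roots are pairwise independent, so an orbit has dimension at most one if and only if at
  most one root coordinate is nonzero.  For such a matrix the spectral condition is a quadratic
  equation for the two eigenvalues that the root couples; its solutions form round 2-spheres, each
  through a diagonal point \<open>d\<close> and the image of \<open>d\<close> under the reflection in the root.  Hence both GKM
  graphs are given by reflections acting on diagonal points, which are the permutations of the
  spectrum in the Hermitian case and the signed permutations in the skew-symmetric case.  The
  construction of the graph \<open>\<eta>\<close> compares the reflections of types \<open>A\<close> and \<open>D\<close>.\<close>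

section \<open>Submanifolds and tangent spaces\<close>

text \<open>An edge of a GKM graph is any subset that meets the topological definition of an
  invariant sphere, so besides exhibiting spheres one has to rule out all other subsets of the
  one-skeleton; connectedness arguments do this. An orbit with two nonzero root coordinates is
  excluded by two independent velocities, without computing its dimension. Determinants are
  evaluated only at points with at most one root coordinate, and smoothness of the two isospectral
  sets comes from genericity.

  For \<eta>, an edge over the pair \<open>i\<close>, \<open>j\<close> from \<open>s\<close> to
  \<open>s'\<close> belongs to the root \<epsilon>_i - (-1)^b \<epsilon>_j with b = s'_i + s_j,
  because the reflection moves the sign at j, shifted by b, to place i. Thus s_i = s'_i means b =
  s_i + s_j, which is why the weight also depends on s_i + s_j. Every edge has two descriptions, one
  from each end. The bijection of edges is therefore obtained from two labellings by the same tuples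
  that identify the same labels, not from a choice of a starting point.\<close>

lemma rank_nullity:
  fixes f :: "'a::euclidean_space \<Rightarrow> 'b::euclidean_space"
  assumes "linear f"
  shows "dim {x. f x = 0} + dim (range f) = DIM('a)"
proof -
  interpret f: linear f by fact
  let ?K = "{x. f x = 0}"
  \<comment> \<open>The orthogonal complement of the kernel: \<open>f\<close> is injective on it and
    already attains its whole range there.\<close>
  let ?N = "{y. \<forall>x\<in>?K. orthogonal x y}"
  have K: "subspace ?K" using assms by (simp add: subspace_def f.add f.scale f.zero)
  have N: "subspace ?N" by (auto simp: subspace_def orthogonal_def inner_add_right)
  have inj: "inj_on f ?N"
  proof (rule inj_onI)
    fix x y assume "x \<in> ?N" "y \<in> ?N" "f x = f y"
    then have "x - y \<in> ?N" "f (x - y) = 0" using subspace_diff[OF N] by (auto simp: f.diff)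
    then have "orthogonal (x - y) (x - y)" by blast
    then show "x = y" by (simp add: orthogonal_def)
  qed
  have "range f = f ` ?N"
  proof -
    have "\<exists>y\<in>?N. f x = f y" for x
    proof -
      obtain y z where "y \<in> span ?K" and z: "\<And>w. w \<in> span ?K \<Longrightarrow> orthogonal z w" and "x = y + z"
        using orthogonal_subspace_decomp_exists[of ?K x] by metis
      then have "f y = 0" using K by (simp add: span_eq_iff[THEN iffD2])
      then have "f x = f z" using \<open>x = y + z\<close> by (simp add: f.add)
      moreover have "z \<in> ?N" using z[OF span_base] by (simp add: orthogonal_commute)
      ultimately show ?thesis by blast
    qed
    then show ?thesis by (auto simp: image_iff)
  qed
  then have "dim (range f) = dim ?N"
    using dim_image_eq[OF assms, of ?N] inj N by (simp add: span_eq_iff[THEN iffD2])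
  moreover have "dim ?N + dim ?K = DIM('a)"
    using dim_subspace_orthogonal_to_vectors[OF K subspace_UNIV] by simp
  ultimately show ?thesis by simp
qed

text \<open>A curve in \<open>S\<close> stays in the chart near time 0, so the defining map vanishes
  along it and the chain rule annihilates its velocity. Rank-nullity gives the kernel dimension
  \<open>d\<close>, since the derivative maps onto \<open>W\<close>. Continuity of the curve at 0 is
  enough, which matters because the curves are differentiable only there.\<close>

lemma tangent_space_subset_kernel:
  fixes S :: "'a::euclidean_space set"
  assumes "smooth_submanifold d S" "p \<in> S"
  shows "\<exists>D :: 'a \<Rightarrow> 'a. linear D \<and> dim {v. D v = 0} = d \<and> (\<forall>v\<in>tangent_space S p. D v = 0)"
proof -
  obtain U W F where U: "open U" "p \<in> U" "dim W + d = DIM('a)" "S \<inter> U = {x \<in> U. F x = 0}"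
    and F: "\<forall>x\<in>U. \<exists>D. ((F :: 'a \<Rightarrow> 'a) has_derivative D) (at x) \<and> range D = W"
    using assms(1)[unfolded smooth_submanifold_def, rule_format, OF assms(2)]
    by (elim exE conjE) (rule that)
  obtain D where D: "(F has_derivative D) (at p)" "range D = W"
    using F U(2) by blast
  have lin: "linear D" using D(1) by (rule has_derivative_linear)
  have "D v = 0" if v: "v \<in> tangent_space S p" for v
  proof -
    obtain c where c: "c 0 = p" "\<And>t. c t \<in> S" "(c has_vector_derivative v) (at 0)"
      using v unfolding tangent_space_def by blast
    have "((\<lambda>t. F (c t)) has_vector_derivative D v) (at 0)"
      using vector_derivative_diff_chain_within[of c v 0 UNIV F D] c D(1)
      by (simp add: o_def has_derivative_at_withinI)
    moreover have "eventually (\<lambda>t. c t \<in> U) (nhds 0)"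
    proof -
      have "isCont c 0" using c(3) has_vector_derivative_continuous by blast
      then have "(c \<longlongrightarrow> p) (nhds 0)"
        using tendsto_at_iff_tendsto_nhds[of c 0] c(1) by (simp only: isCont_def)
      then show ?thesis using U(1,2) by (rule topological_tendstoD)
    qed
    then have "eventually (\<lambda>t. F (c t) = 0) (nhds 0)"
    proof eventually_elim
      case (elim t)
      then have "c t \<in> S \<inter> U" using c(2) by simp
      then show ?case unfolding U(4) by simp
    qed
    then have "((\<lambda>t. F (c t)) has_vector_derivative 0) (at 0)"
      using has_vector_derivative_cong_ev[of UNIV "\<lambda>t. F (c t)" "\<lambda>_. 0" 0 0]
        eventually_nhds_x_imp_x[of "\<lambda>t. F (c t) = 0" 0] by simp
    ultimately show "D v = 0" by (rule vector_derivative_unique_at)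
  qed
  moreover have "dim {v. D v = 0} = d"
    using rank_nullity[OF lin] D(2) U(3) by simp
  ultimately show ?thesis using lin by blast
qed

text \<open>This is the obstruction used against orbits of dimension at most one: two independent
  velocities suffice, and nothing else about the orbit has to be known.\<close>

lemma two_tangents_imp_dim_ge_2:
  fixes S :: "'a::euclidean_space set"
  assumes "smooth_submanifold d S" "p \<in> S"
    and "v1 \<in> tangent_space S p" "v2 \<in> tangent_space S p" "v1 \<noteq> v2" "independent {v1, v2}"
  shows "2 \<le> d"
proof -
  obtain D :: "'a \<Rightarrow> 'a" where D: "linear D" "dim {v. D v = 0} = d" "\<forall>v\<in>tangent_space S p. D v = 0"
    using tangent_space_subset_kernel[OF assms(1,2)] by (elim exE conjE)
  have "card {v1, v2} \<le> dim {v. D v = 0}"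
    using D(3) assms(3,4) by (intro independent_card_le_dim assms(6)) simp
  then show ?thesis using D(2) assms(5) by simp
qed

section \<open>Spheres as smooth submanifolds and their tangent spaces\<close>

lemma Ck_on_affine:
  fixes A :: "'a::euclidean_space \<Rightarrow> 'b::real_normed_vector"
  assumes "linear A"
  shows "Ck_on k (\<lambda>x. b + A x) U"
  using assms
proof (induction k arbitrary: b A)
  case 0
  then show ?case by (simp add: linear_continuous_on linear_conv_bounded_linear continuous_on_add)
next
  case (Suc k)
  have "((\<lambda>x. b + A x) has_derivative A) (at x)" for x
    using Suc.prems by (auto intro!: derivative_eq_intros bounded_linear_imp_has_derivative
        simp: linear_conv_bounded_linear)
  moreover have "Ck_on k (\<lambda>x. A v) U" for v
    using Suc.IH[of "\<lambda>_. 0" "A v"] by (simp add: linear_zero)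
  ultimately show ?case by (auto intro!: exI[of _ "\<lambda>_. A"])
qed

text \<open>The defining functions below are polynomials of degree at most two. Their derivative is
  affine in the base point, so a single differentiation reduces all higher orders to
  \<open>Ck_on_affine\<close>.\<close>

lemma Cinf_on_derivative_affine:
  fixes F :: "'a::euclidean_space \<Rightarrow> 'b::real_normed_vector"
  assumes "\<And>x. (F has_derivative D x) (at x)"
    and "\<And>v. linear (\<lambda>x. D x v - D 0 v)"
  shows "Cinf_on F U"
  unfolding Cinf_on_def
proof
  fix k show "Ck_on k F U"
  proof (cases k)
    case 0
    then show ?thesis
      using assms(1) by (auto intro!: continuous_at_imp_continuous_on has_derivative_continuous)
  next
    case (Suc m)
    have "Ck_on m (\<lambda>x. D x v) U" for v
      using Ck_on_affine[OF assms(2)[of v], of m "D 0 v" U] by simp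
    with Suc assms(1) show ?thesis by auto
  qed
qed

lemma smooth_submanifold_singleton: "smooth_submanifold 0 {p :: 'a::euclidean_space}"
proof -
  have "Cinf_on (\<lambda>x. x - p) UNIV"
    by (rule Cinf_on_derivative_affine[where D="\<lambda>_ v. v"]) (auto intro!: derivative_eq_intros linear_zero)
  moreover have "((\<lambda>x. x - p) has_derivative (\<lambda>v. v)) (at x)" for x
    by (auto intro!: derivative_eq_intros)
  ultimately show ?thesis unfolding smooth_submanifold_def
    by (intro ballI exI[of _ UNIV] exI[of _ "\<lambda>x. x - p"]) (auto intro!: exI[of _ "\<lambda>v. v"])
qed

text \<open>With a left inverse \<open>P\<close> of \<open>G\<close>, the set is cut out by two
  conditions: \<open>x - a\<close> lies in the range of \<open>G\<close>, and
  \<open>P (x - a)\<close> has norm \<open>r\<close>. The first defect lies in the kernel of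
  \<open>P\<close>; the second is a scalar and is placed along \<open>G e\<close>, outside that
  kernel. So one ambient-valued map \<open>F\<close> carries both, with values in the space
  \<open>W\<close> of vectors that \<open>P\<close> sends to the line through
  \<open>e\<close>.\<close>

lemma smooth_submanifold_sphere_image:
  fixes G :: "'b::euclidean_space \<Rightarrow> 'a::euclidean_space"
  assumes G: "linear G" "inj G" and r: "r > 0"
  shows "smooth_submanifold (DIM('b) - 1) ((\<lambda>v. a + G v) ` sphere 0 r)"
proof -
  obtain P where P: "linear P" and PG: "\<And>v. P (G v) = v"
    using linear_injective_left_inverse[OF G] by (auto simp: o_def fun_eq_iff)
  interpret G: linear G by fact
  interpret P: linear P by fact
  obtain e :: 'b where "e \<in> Basis" using nonempty_Basis by blast
  then have ee: "e \<bullet> e = 1" and e0: "e \<noteq> 0" by (auto simp: inner_Basis)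
  define Q where "Q v = P v - (P v \<bullet> e) *\<^sub>R e" for v
  define W where "W = {v. Q v = 0}"
  have Q: "linear Q" unfolding Q_def
    by (intro linearI) (auto simp: P.add P.scale inner_add_left algebra_simps)
  have "range Q = {u. e \<bullet> u = 0}"
  proof -
    have "e \<bullet> Q v = 0" for v by (simp add: Q_def inner_diff_right ee inner_commute)
    moreover have "Q (G u) = u" if "e \<bullet> u = 0" for u
      using that by (simp add: Q_def PG inner_commute)
    ultimately show ?thesis by (auto simp: image_iff) metis
  qed
  then have "dim (range Q) = DIM('b) - 1" using dim_hyperplane[OF e0] by simp
  then have dimW: "dim W + (DIM('b) - 1) = DIM('a)"
    using rank_nullity[OF Q] by (simp add: W_def)
  have subW: "subspace W"
    unfolding W_def using Q by (simp add: subspace_def linear_add linear_scale linear_0)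
  define F where "F x = ((x - a) - G (P (x - a))) + (P (x - a) \<bullet> P (x - a) - r\<^sup>2) *\<^sub>R G e" for x
  define D where "D x v = (v - G (P v)) + (2 * (P (x - a) \<bullet> P v)) *\<^sub>R G e" for x v
  \<comment> \<open>At \<open>P (x - a) = 0\<close> the quadratic part has zero derivative, so the
    center has to be removed for \<open>F\<close> to be a submersion onto \<open>W\<close>.\<close>
  define U where "U = {x. P (x - a) \<noteq> 0}"
  have [derivative_intros]: "(P has_derivative P) (at x)" "(G has_derivative G) (at y)" for x y
    using P G(1) by (auto simp: linear_conv_bounded_linear intro: bounded_linear_imp_has_derivative)
  have dP: "((\<lambda>x. P (x - a)) has_derivative P) (at x)" for x
    by (rule has_derivative_compose[of "\<lambda>x. x - a" "\<lambda>v. v"]) (auto intro!: derivative_eq_intros)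
  have dG: "((\<lambda>x. G (P (x - a))) has_derivative (\<lambda>v. G (P v))) (at x)" for x
    by (rule has_derivative_compose[OF dP]) (auto intro!: derivative_eq_intros)
  have dF: "(F has_derivative D x) (at x)" for x
    unfolding F_def D_def
    by (rule derivative_eq_intros dP dG refl)+ (auto simp: fun_eq_iff inner_commute)
  have linD: "linear (\<lambda>x. D x v - D 0 v)" for v
  proof -
    have "D x v - D 0 v = (2 * (P x \<bullet> P v)) *\<^sub>R G e" for x v
      by (simp add: D_def P.diff P.neg inner_diff_left algebra_simps flip: scaleR_add_left)
    then show ?thesis
      by (intro linearI) (simp_all add: P.add P.scale inner_add_left distrib_left scaleR_add_left)
  qed
  have smooth: "Cinf_on F U"
    by (rule Cinf_on_derivative_affine[where D=D]) (rule dF, rule linD)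
  have openU: "open U"
  proof -
    have "continuous_on UNIV (\<lambda>x. P (x - a))"
      by (rule has_derivative_continuous_on) (rule dP)
    then have "open ((\<lambda>x. P (x - a)) -` (- {0}))" by (intro open_vimage) auto
    then show ?thesis by (simp add: U_def vimage_def)
  qed
  have QF: "Q (F x) = 0" for x
  proof -
    have "P (F x) = (P (x - a) \<bullet> P (x - a) - r\<^sup>2) *\<^sub>R e"
      by (simp add: F_def P.add P.diff[of _ "G _"] P.scale PG)
    then show ?thesis by (simp add: Q_def ee)
  qed
  have rangeD: "range (D x) = W" if "x \<in> U" for x
  proof
    have "P (D x v) = (2 * (P (x - a) \<bullet> P v)) *\<^sub>R e" for v
      by (simp add: D_def P.add P.diff[of v] P.scale PG)
    then show "range (D x) \<subseteq> W" by (auto simp: W_def Q_def ee)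
    show "W \<subseteq> range (D x)"
    proof
      fix w assume "w \<in> W"
      define k where "k = P w \<bullet> e"
      have Pw: "P w = k *\<^sub>R e" using \<open>w \<in> W\<close> by (simp add: W_def Q_def k_def)
      define u where "u = P (x - a)"
      have u: "u \<bullet> u \<noteq> 0" using that by (simp add: U_def u_def)
      \<comment> \<open>The linear part of \<open>D x\<close> keeps the component
        \<open>w - k *\<^sub>R G e\<close>, on which \<open>P\<close> vanishes; the multiple of
        \<open>G u\<close> is scaled so that the quadratic part contributes exactly \<open>k\<close>
        along \<open>G e\<close>.\<close>
      define v where "v = w - k *\<^sub>R G e + (k / (2 * (u \<bullet> u))) *\<^sub>R G u"
      have "P v = (k / (2 * (u \<bullet> u))) *\<^sub>R u"
        by (simp add: v_def P.add P.diff P.scale PG Pw)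
      then have "D x v = w"
        using u by (simp add: D_def u_def[symmetric] v_def G.scale)
      then show "w \<in> range (D x)" by blast
    qed
  qed
  have zero: "F x = 0 \<longleftrightarrow> x \<in> (\<lambda>v. a + G v) ` sphere 0 r" for x
  proof
    assume F0: "F x = 0"
    define u where "u = P (x - a)"
    have "P (F x) = 0" using F0 by simp
    moreover have "P (F x) = (u \<bullet> u - r\<^sup>2) *\<^sub>R e"
      by (simp add: F_def u_def[symmetric] P.add P.diff[of _ "G _"] P.scale PG)
    ultimately have "u \<bullet> u = r\<^sup>2" using e0 by simp
    then have "norm u = r" using r by (simp add: norm_eq_sqrt_inner)
    moreover have "x = a + G u"
      using F0 \<open>u \<bullet> u = r\<^sup>2\<close> by (simp add: F_def u_def[symmetric]) (simp add: algebra_simps)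
    ultimately show "x \<in> (\<lambda>v. a + G v) ` sphere 0 r" by auto
  next
    assume "x \<in> (\<lambda>v. a + G v) ` sphere 0 r"
    then show "F x = 0" by (auto simp: F_def PG dot_square_norm)
  qed
  have inU: "a + G v \<in> U" if "norm v = r" for v
    using that r by (auto simp: U_def PG)
  show ?thesis
    unfolding smooth_submanifold_def
  proof (rule ballI, rule exI[of _ U], rule exI[of _ W], rule exI[of _ F], intro conjI)
    fix p assume "p \<in> (\<lambda>v. a + G v) ` sphere 0 r"
    then show "p \<in> U" using inU by auto
    show "F ` U \<subseteq> W" using QF by (auto simp: W_def)
    show "(\<lambda>v. a + G v) ` sphere 0 r \<inter> U = {x \<in> U. F x = 0}" using zero by auto
    show "\<forall>x\<in>U. \<exists>D. (F has_derivative D) (at x) \<and> range D = W" using dF rangeD by blast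
  qed (use openU subW dimW smooth in auto)
qed

text \<open>A curve in the image pulls back along a left inverse of \<open>G\<close> to a curve of
  unit vectors, and differentiating its constant square gives orthogonality. Conversely, great
  circles realize every orthogonal vector.\<close>

lemma tangent_space_sphere_image:
  fixes G :: "'b::euclidean_space \<Rightarrow> 'a::euclidean_space"
  assumes G: "linear G" "inj G" and u: "norm u = 1"
  shows "tangent_space ((\<lambda>v. a + G v) ` sphere 0 1) (a + G u) = G ` {v. u \<bullet> v = 0}"
proof
  obtain P where P: "linear P" and PG: "\<And>v. P (G v) = v"
    using linear_injective_left_inverse[OF G] by (auto simp: o_def fun_eq_iff)
  have bP: "bounded_linear P" and bG: "bounded_linear G"
    using P G by (simp_all add: linear_conv_bounded_linear)
  let ?S = "(\<lambda>v. a + G v) ` sphere 0 1"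
  show "tangent_space ?S (a + G u) \<subseteq> G ` {v. u \<bullet> v = 0}"
  proof
    fix w assume "w \<in> tangent_space ?S (a + G u)"
    then obtain c where c: "c 0 = a + G u" "\<And>t. c t \<in> ?S" "(c has_vector_derivative w) (at 0)"
      unfolding tangent_space_def by blast
    define b where "b t = P (c t - a)" for t
    have cb: "c t = a + G (b t)" and nb: "b t \<bullet> b t = 1" for t
      using c(2)[of t] by (auto simp: b_def PG dot_square_norm)
    have b0: "b 0 = u" by (simp add: b_def c(1) PG)
    have "((\<lambda>t. c t - a) has_vector_derivative w) (at 0)"
      using c(3) by (auto intro!: derivative_eq_intros)
    from bounded_linear.has_vector_derivative[OF bP this]
    have db: "(b has_vector_derivative P w) (at 0)" by (simp add: b_def[abs_def])
    have "((\<lambda>t. a + G (b t)) has_vector_derivative G (P w)) (at 0)"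
      using bounded_linear.has_vector_derivative[OF bG db] by (auto intro!: derivative_eq_intros)
    then have "w = G (P w)"
      using c(3) cb by (metis (no_types, lifting) ext vector_derivative_unique_at)
    moreover have "u \<bullet> P w = 0"
    proof -
      have "((\<lambda>t. b t \<bullet> b t) has_vector_derivative (b 0 \<bullet> P w + P w \<bullet> b 0)) (at 0)"
        by (rule bounded_bilinear.has_vector_derivative[OF bounded_bilinear_inner db db])
      then have "((\<lambda>t::real. 1::real) has_vector_derivative (2 * (u \<bullet> P w))) (at 0)"
        by (simp add: nb b0 inner_commute)
      then have "2 * (u \<bullet> P w) = 0"
        using has_vector_derivative_const vector_derivative_unique_at by blast
      then show ?thesis by simp
    qed
    ultimately show "w \<in> G ` {v. u \<bullet> v = 0}" by blast
  qed
  show "G ` {v. u \<bullet> v = 0} \<subseteq> tangent_space ?S (a + G u)"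
  proof
    fix w assume "w \<in> G ` {v. u \<bullet> v = 0}"
    then obtain v where v: "u \<bullet> v = 0" "w = G v" by blast
    \<comment> \<open>The great circle through \<open>u\<close>, traversed with speed
      \<open>norm v\<close>. For \<open>v = 0\<close> the convention \<open>sgn 0 = 0\<close> turns
      it into the constant curve.\<close>
    define b where "b t = cos (norm v * t) *\<^sub>R u + sin (norm v * t) *\<^sub>R sgn v" for t
    have uv: "u \<bullet> sgn v = 0" using v by (simp add: sgn_div_norm)
    have "norm (b t) = 1" for t
    proof (cases "v = 0")
      case False
      then have "b t \<bullet> b t = 1"
      proof -
        have "u \<bullet> u = 1" "sgn v \<bullet> sgn v = 1" using u False by (simp_all add: dot_square_norm norm_sgn)
        then have "b t \<bullet> b t = cos (norm v * t) * cos (norm v * t) + sin (norm v * t) * sin (norm v * t)"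
          using uv by (simp add: b_def inner_add_left inner_add_right inner_commute[of "sgn v" u])
        then show ?thesis by (simp flip: power2_eq_square)
      qed
      then show ?thesis by (simp add: norm_eq_1)
    qed (simp add: b_def u)
    moreover have "(b has_vector_derivative v) (at 0)"
    proof -
      have "(b has_vector_derivative (norm v *\<^sub>R sgn v)) (at 0)"
        unfolding b_def[abs_def] by (auto intro!: derivative_eq_intros simp: has_real_derivative_iff_has_vector_derivative[symmetric])
      then show ?thesis by (cases "v = 0") (simp_all add: sgn_div_norm)
    qed
    then have "((\<lambda>t. a + G (b t)) has_vector_derivative w) (at 0)"
      using bounded_linear.has_vector_derivative[OF bG] v(2) by (auto intro!: derivative_eq_intros)
    moreover have "b 0 = u" by (simp add: b_def)
    ultimately show "w \<in> tangent_space ?S (a + G u)"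
      unfolding tangent_space_def by (intro CollectI exI[of _ "\<lambda>t. a + G (b t)"]) auto
  qed
qed

text \<open>One puncture turns the sphere into a plane by stereographic projection, and a plane
  minus a point is connected because its affine dimension is not 1.\<close>

lemma connected_sphere_minus_two_points:
  fixes S :: "'a::euclidean_space set"
  assumes "S homeomorphic sphere (0 :: real^3) 1" "p \<in> S" "q \<in> S" "p \<noteq> q"
  shows "connected (S - {p, q})"
proof -
  have rem: "(A - {x}) homeomorphic (B - {h x})" if "homeomorphism A B h g" "x \<in> A"
    for A :: "'c::topological_space set" and B :: "'d::topological_space set" and h g x
  proof -
    have "inj_on h A" using that(1) by (metis homeomorphism_def inj_on_inverseI)
    then have "h ` (A - {x}) = B - {h x}"
      using that by (simp add: inj_on_image_set_diff homeomorphism_image1)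
    then have "homeomorphism (A - {x}) (B - {h x}) h g"
      using that by (intro homeomorphism_of_subsets[OF that(1)]) auto
    then show ?thesis unfolding homeomorphic_def by blast
  qed
  obtain h g where h: "homeomorphism S (sphere (0 :: real^3) 1) h g"
    using assms(1) homeomorphic_def by blast
  have "(S - {p}) homeomorphic (sphere 0 1 - {h p})" by (rule rem[OF h assms(2)])
  also have "\<dots> homeomorphic {x :: real^3. axis 1 1 \<bullet> x = 0}"
    using h assms(2) by (intro homeomorphic_punctured_sphere_hyperplane)
      (auto simp: homeomorphism_def axis_eq_0_iff)
  finally obtain h' g' where h': "homeomorphism (S - {p}) {x :: real^3. axis 1 1 \<bullet> x = 0} h' g'"
    using homeomorphic_def by blast
  have "(S - {p} - {q}) homeomorphic ({x :: real^3. axis 1 1 \<bullet> x = 0} - {h' q})"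
    by (rule rem[OF h']) (use assms in auto)
  moreover have "connected ({x :: real^3. axis 1 1 \<bullet> x = 0} - {h' q})"
  proof (rule connected_punctured_convex)
    show "aff_dim {x :: real^3. axis 1 1 \<bullet> x = 0} \<noteq> 1"
      by (simp add: aff_dim_hyperplane axis_eq_0_iff)
  qed (rule convex_hyperplane)
  ultimately have "connected (S - {p} - {q})" using homeomorphic_connectedness by blast
  then show ?thesis by (simp add: Diff_insert2[symmetric] insert_commute)
qed

section \<open>Characters of the torus\<close>

lemma bit_sign_cases: "bit_sign b = (1::'a::ring_1) \<or> bit_sign b = (- 1::'a)"
  by (simp add: bit_sign_def)

lemma bit_sign_square [simp]: "bit_sign b * bit_sign b = (1::'a::ring_1)"
  by (simp add: bit_sign_def)

lemma of_int_bit_sign [simp]: "of_int (bit_sign b) = (bit_sign b :: 'a::ring_1)"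
  by (simp add: bit_sign_def)

lemma bit_eq_0_or_1: "(b::bit) = 0 \<or> b = 1"
  by (cases b) auto

lemma finite_UNIV_bit: "finite (UNIV :: bit set)"
proof -
  have "(UNIV :: bit set) = {0, 1}" using bit_eq_0_or_1 by auto
  then show ?thesis by (metis finite.emptyI finite.insertI)
qed

text \<open>Up to the factor \<i>, the differential of the character \<open>w\<close> at the unit in
  the direction \<theta>; see \<open>torus_char_curve\<close>.\<close>

definition pairing :: "int^'n \<Rightarrow> real^'n \<Rightarrow> real" where
  "pairing w \<theta> = (\<Sum>k\<in>UNIV. of_int (w $ k) * \<theta> $ k)"

definition torus_curve :: "real^'n \<Rightarrow> real \<Rightarrow> complex^'n" where
  "torus_curve \<theta> s = (\<chi> k. cis (s * \<theta> $ k))"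

lemma torus_curve_in_torus [simp]: "torus_curve \<theta> s \<in> torus"
  by (simp add: torus_curve_def torus_def)

lemma torus_curve_0: "torus_curve \<theta> 0 = 1"
  by (simp add: torus_curve_def vec_eq_iff)

lemma torus_char_curve: "torus_char w (torus_curve \<theta> s) = cis (s * pairing w \<theta>)"
proof -
  have "(\<Prod>k\<in>A. cis (f k)) = cis (\<Sum>k\<in>A. f k)" if "finite A" for A and f :: "'n::finite \<Rightarrow> real"
    using that by induction (simp_all add: cis_mult)
  then show ?thesis
    by (simp add: torus_char_def torus_curve_def pairing_def cis_power_int sum_distrib_left ac_simps)
qed

lemma norm_torus_char: "t \<in> torus \<Longrightarrow> cmod (torus_char w t) = 1"
  by (simp add: torus_char_def torus_def norm_power_int flip: prod_norm)

lemma torus_char_uminus: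
  assumes "t \<in> torus"
  shows "torus_char (- w) t = cnj (torus_char w t)"
proof -
  have "(t $ k) powi (- w $ k) = cnj ((t $ k) powi (w $ k))" for k
  proof -
    have "cnj (t $ k) = inverse (t $ k)"
      using assms by (simp add: torus_def inverse_complex_def complex_eq_iff cmod_def)
    then show ?thesis by (simp add: power_int_minus power_int_inverse)
  qed
  then show ?thesis by (simp add: torus_char_def)
qed

text \<open>The squares of the two pairings are equal quadratic forms in \<theta>. Polarization
  equates all products of two entries, and these determine an integer vector up to sign.\<close>

lemma int_vec_eq_up_to_sign:
  assumes "\<And>\<theta>. \<bar>pairing w \<theta>\<bar> = \<bar>pairing w' \<theta>\<bar>"
  shows "w' = w \<or> w' = - w"
proof -
  have sq: "(pairing w \<theta>)\<^sup>2 = (pairing w' \<theta>)\<^sup>2" for \<theta>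
    using assms[of \<theta>] by (simp add: abs_eq_iff power2_eq_iff)
  have ax: "pairing v (axis k 1) = of_int (v $ k)" for v :: "int^'n" and k
    by (simp add: pairing_def axis_def if_distrib cong: if_cong)
  have add: "pairing v (x + y) = pairing v x + pairing v y" for v :: "int^'n" and x y
    by (simp add: pairing_def algebra_simps sum.distrib)
  have prod: "w $ k * w $ m = w' $ k * w' $ m" for k m
  proof -
    have "(of_int (w $ k) + of_int (w $ m) :: real)\<^sup>2 = (of_int (w' $ k) + of_int (w' $ m))\<^sup>2"
      using sq[of "axis k 1 + axis m 1"] by (simp add: add ax)
    moreover have "(of_int (w $ k) :: real)\<^sup>2 = (of_int (w' $ k))\<^sup>2" for k
      using sq[of "axis k 1"] by (simp add: ax)
    ultimately have "(of_int (w $ k * w $ m) :: real) = of_int (w' $ k * w' $ m)"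
      by (simp add: power2_sum)
    then show ?thesis by (simp only: of_int_eq_iff)
  qed
  show ?thesis
  proof (cases "w = 0")
    case True
    then have "w' $ k * w' $ k = 0" for k using prod[of k k] by simp
    then have "w' = 0" by (simp add: vec_eq_iff)
    with True show ?thesis by simp
  next
    case False
    then obtain k where k: "w $ k \<noteq> 0" by (auto simp: vec_eq_iff)
    have "w' $ k = w $ k \<or> w' $ k = - (w $ k)"
      using prod[of k k] by (simp add: square_eq_iff[symmetric])
    then show ?thesis
    proof
      assume e: "w' $ k = w $ k"
      have "w' $ m = w $ m" for m using prod[of k m] k by (simp add: e)
      then show ?thesis by (simp add: vec_eq_iff)
    next
      assume e: "w' $ k = - (w $ k)"
      have "w' $ m = - (w $ m)" for m
      proof -
        have "w $ k * (w $ m + w' $ m) = 0" using prod[of k m] by (simp add: e algebra_simps)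
        then show ?thesis using k by simp
      qed
      then show ?thesis by (simp add: vec_eq_iff)
    qed
  qed
qed

text \<open>An equivalence between two weights preserves the real parts of the characters, which are
  the traces divided by two.\<close>

lemma has_weight_range_iff:
  fixes L :: "complex \<Rightarrow> 'a::euclidean_space"
  assumes L: "linear L" "inj L"
    and act: "\<And>t c. t \<in> torus \<Longrightarrow> act t (L c) = L (torus_char w t * c)"
  shows "has_weight act (range L) w' \<longleftrightarrow> w' = w \<or> w' = - w"
proof
  assume "has_weight act (range L) w'"
  then obtain \<phi> :: "'a \<Rightarrow> complex" where \<phi>: "linear \<phi>" "bij_betw \<phi> (range L) UNIV"
    "\<forall>t\<in>torus. \<forall>v\<in>range L. act t v \<in> range L \<and> \<phi> (act t v) = torus_char w' t * \<phi> v"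
    unfolding has_weight_def by (elim exE conjE)
  define \<psi> where "\<psi> c = \<phi> (L c)" for c
  interpret \<psi>: linear \<psi>
    using linear_compose[OF L(1) \<phi>(1)] by (simp add: \<psi>_def[abs_def] o_def)
  have equi: "\<psi> (torus_char w t * c) = torus_char w' t * \<psi> c" if "t \<in> torus" for t c
    using \<phi>(3)[rule_format, OF that rangeI, of c] act[OF that, of c] by (simp add: \<psi>_def)
  have \<psi>1: "\<psi> 1 \<noteq> 0"
  proof
    assume "\<psi> 1 = 0"
    then have "\<phi> (L 1) = \<phi> (L 0)" using \<psi>.zero by (simp add: \<psi>_def)
    then have "L 1 = L 0" using \<phi>(2) by (auto simp: bij_betw_def dest: inj_onD)
    then show False using L(2) by (auto dest: injD)
  qed
  have "\<bar>pairing w \<theta>\<bar> = \<bar>pairing w' \<theta>\<bar>" for \<theta>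
  proof -
    define a b where "a = pairing w \<theta>" and "b = pairing w' \<theta>"
    have coseq: "cos (s * a) = cos (s * b)" for s
    proof -
      have e: "\<psi> (cis (s * a)) = cis (s * b) * \<psi> 1" for s
        using equi[of "torus_curve \<theta> s" 1] by (simp add: torus_char_curve a_def b_def)
      have two: "cis x + cis (- x) = of_real (2 * cos x)" for x
        by (simp add: complex_eq_iff)
      have "\<psi> (cis (s * a) + cis (- (s * a))) = (cis (s * b) + cis (- (s * b))) * \<psi> 1"
        using e[of s] e[of "- s"] by (simp add: \<psi>.add algebra_simps)
      then have "\<psi> ((2 * cos (s * a)) *\<^sub>R 1) = of_real (2 * cos (s * b)) * \<psi> 1"
        unfolding two by (simp only: scaleR_conv_of_real mult_1_right)
      then have "of_real (2 * cos (s * a)) * \<psi> 1 = of_real (2 * cos (s * b)) * \<psi> 1"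
        unfolding \<psi>.scale by (simp only: scaleR_conv_of_real)
      then have "of_real (2 * cos (s * a)) = (of_real (2 * cos (s * b)) :: complex)"
        using \<psi>1 by (metis mult_right_cancel)
      then show ?thesis by (simp only: of_real_eq_iff)
    qed
    \<comment> \<open>Both \<open>s * \<bar>a\<bar>\<close> and \<open>s * \<bar>b\<bar>\<close>
      become at most 1 and thus lie in the interval up to \<open>pi\<close>, where the cosine is
      injective.\<close>
    define s where "s = 1 / (\<bar>a\<bar> + \<bar>b\<bar> + 1)"
    have s: "s > 0" by (simp add: s_def add_nonneg_pos)
    have "0 < \<bar>a\<bar> + \<bar>b\<bar> + 1" by (simp add: add_nonneg_pos)
    then have "s * \<bar>a\<bar> \<le> 1" "s * \<bar>b\<bar> \<le> 1" by (simp_all add: s_def divide_le_eq)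
    then have bnd: "s * \<bar>a\<bar> \<le> pi" "s * \<bar>b\<bar> \<le> pi" using pi_gt3 by linarith+
    have "cos (s * \<bar>a\<bar>) = cos (s * \<bar>b\<bar>)"
      using coseq[of s] by (simp add: abs_if)
    then have "s * \<bar>a\<bar> = s * \<bar>b\<bar>"
      using cos_inj_pi[of "s * \<bar>a\<bar>" "s * \<bar>b\<bar>"] s bnd by simp
    then show ?thesis using s by (simp add: a_def b_def)
  qed
  then show "w' = w \<or> w' = - w" by (rule int_vec_eq_up_to_sign)
next
  assume w': "w' = w \<or> w' = - w"
  obtain P where P: "linear P" and PL: "\<And>c. P (L c) = c"
    using linear_injective_left_inverse[OF L] by (auto simp: o_def fun_eq_iff)
  have sub: "subspace (range L)" using L(1) linear_subspace_image subspace_UNIV by blast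
  have bij: "bij_betw P (range L) UNIV"
    by (intro bij_betwI[where g=L]) (auto simp: PL)
  show "has_weight act (range L) w'"
    using w'
  proof
    assume "w' = w"
    then show ?thesis unfolding has_weight_def
      using sub P bij by (intro conjI exI[of _ P]) (auto simp: act PL)
  next
    assume w': "w' = - w"
    have lin: "linear (\<lambda>v. cnj (P v))"
      using P by (intro linearI) (auto simp: linear_add linear_scale scaleR_conv_of_real)
    have bij': "bij_betw (\<lambda>v. cnj (P v)) (range L) UNIV"
      by (intro bij_betwI[where g="\<lambda>c. L (cnj c)"]) (auto simp: PL)
    show ?thesis unfolding has_weight_def
      using sub lin bij' by (intro conjI exI[of _ "\<lambda>v. cnj (P v)"])
        (auto simp: act PL w' torus_char_uminus)
  qed
qed

section \<open>Roots and the spectral relation\<close>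

text \<open>The bit selects between the two kinds of roots, \<epsilon>_i - \<epsilon>_j for 0 and
  \<epsilon>_i + \<epsilon>_j for 1, so that types A and D share one index type.\<close>

definition root_weight :: "'n \<times> 'n \<times> bit \<Rightarrow> int^'n" where
  "root_weight = (\<lambda>(i, j, b). eps i - bit_sign b *s eps j)"

definition root_vec :: "'n \<times> 'n \<times> bit \<Rightarrow> real^'n" where
  "root_vec = (\<lambda>(i, j, b). axis i 1 - bit_sign b *\<^sub>R axis j 1)"

definition root_val :: "'n \<times> 'n \<times> bit \<Rightarrow> real^'n \<Rightarrow> real" where
  "root_val = (\<lambda>(i, j, b) d. d $ i - bit_sign b * d $ j)"

text \<open>The usual factor 2 / (\<alpha>, \<alpha>) of a reflection equals 1, because for distinct
  indices these roots have squared length 2.\<close>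

definition reflect :: "'n \<times> 'n \<times> bit \<Rightarrow> real^'n \<Rightarrow> real^'n" where
  "reflect \<alpha> d = d - root_val \<alpha> d *\<^sub>R root_vec \<alpha>"

text \<open>A root coordinate \<open>c\<close> at the root \<open>(i, j, b)\<close> couples \<open>d'\<^sub>i\<close> and \<open>\<tau> d'\<^sub>j\<close>, where \<open>\<tau> = \<plusminus> 1\<close> is the sign
  of \<open>b\<close>, in the Hermitian matrix with rows \<open>(d'\<^sub>i, c)\<close> and \<open>(cnj c, \<tau> d'\<^sub>j)\<close>.  The relation says that the
  eigenvalues of this matrix are \<open>d\<^sub>i\<close> and \<open>\<tau> d\<^sub>j\<close>, expressed by their sum and squared difference.\<close>

definition root_rel :: "'n \<times> 'n \<times> bit \<Rightarrow> real^'n \<Rightarrow> real^'n \<Rightarrow> complex \<Rightarrow> bool" where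
  "root_rel = (\<lambda>(i, j, b) d d' c. (\<forall>k. k \<notin> {i, j} \<longrightarrow> d $ k = d' $ k) \<and>
     d $ i + bit_sign b * d $ j = d' $ i + bit_sign b * d' $ j \<and>
     (root_val (i, j, b) d)\<^sup>2 = (root_val (i, j, b) d')\<^sup>2 + 4 * (cmod c)\<^sup>2)"

lemma pairing_root_weight: "pairing (root_weight (i, j, b)) \<theta> = \<theta> $ i - bit_sign b * \<theta> $ j"
proof -
  have "of_int (root_weight (i, j, b) $ k) * \<theta> $ k
      = (if k = i then \<theta> $ k else 0) - (if k = j then bit_sign b * \<theta> $ k else 0)" for k
    by (simp add: root_weight_def eps_def axis_def left_diff_distrib)
  then show ?thesis by (simp add: pairing_def sum_subtractf)
qed

lemma torus_char_root_surj:
  assumes "i \<noteq> j" "cmod u = 1"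
  obtains t where "t \<in> torus" "torus_char (root_weight (i, j, b)) t = u"
proof
  define t where "t = (\<chi> k. if k = i then u else 1)"
  show "t \<in> torus" using assms by (simp add: t_def torus_def)
  have "(t $ k) powi (root_weight (i, j, b) $ k) = (if k = i then u else 1)" for k
    using assms by (simp add: t_def root_weight_def eps_def axis_def)
  then show "torus_char (root_weight (i, j, b)) t = u"
    by (simp add: torus_char_def)
qed

lemma root_vec_nth: "i \<noteq> j \<Longrightarrow> root_vec (i, j, b) $ k = (if k = i then 1 else if k = j then - bit_sign b else 0)"
  by (simp add: root_vec_def axis_def)

lemma root_val_reflect: "i \<noteq> j \<Longrightarrow> root_val (i, j, b) (reflect (i, j, b) d) = - root_val (i, j, b) d"
  using bit_sign_cases[of b, where 'a=real] by (auto simp: root_val_def reflect_def root_vec_nth)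

lemma reflect_nth: "i \<noteq> j \<Longrightarrow> reflect (i, j, b) d $ k =
    (if k = i then bit_sign b * d $ j else if k = j then bit_sign b * d $ i else d $ k)"
  using bit_sign_cases[of b, where 'a=real] by (auto simp: root_val_def reflect_def root_vec_nth)

lemma root_rel_reflect: "i \<noteq> j \<Longrightarrow> root_rel (i, j, b) (reflect (i, j, b) d) d' c \<longleftrightarrow> root_rel (i, j, b) d d' c"
  using bit_sign_cases[of b, where 'a=real]
  by (auto simp: root_rel_def root_val_reflect reflect_nth)

lemma root_rel_self: "root_rel (i, j, b) d d 0"
  by (simp add: root_rel_def)

text \<open>The sum and the squared difference of the two coupled values are prescribed, so only the
  sign of the difference is free; changing it is the reflection.\<close>

lemma root_rel_unique:
  assumes "i \<noteq> j" "root_rel (i, j, b) d d' c" "root_rel (i, j, b) e d' c"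
  shows "e = d \<or> e = reflect (i, j, b) d"
proof -
  have "root_val (i, j, b) e = root_val (i, j, b) d \<or> root_val (i, j, b) e = - root_val (i, j, b) d"
    using assms by (auto simp: root_rel_def power2_eq_iff[symmetric])
  then show ?thesis
  proof
    have other: "\<forall>k. k \<notin> {i, j} \<longrightarrow> e $ k = d $ k"
      and sum: "e $ i + bit_sign b * e $ j = d $ i + bit_sign b * d $ j"
      using assms by (auto simp: root_rel_def)
    note bs = bit_sign_cases[of b, where 'a=real]
    {
      assume "root_val (i, j, b) e = root_val (i, j, b) d"
      then have "e $ i - bit_sign b * e $ j = d $ i - bit_sign b * d $ j"
        by (simp add: root_val_def)
      with sum have "e $ i = d $ i" "e $ j = d $ j" using bs by auto
      with other have "e $ k = d $ k" for k by (cases "k \<in> {i, j}") auto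
      then show ?thesis by (simp add: vec_eq_iff)
    next
      assume "root_val (i, j, b) e = - root_val (i, j, b) d"
      then have "e $ i - bit_sign b * e $ j = - (d $ i - bit_sign b * d $ j)"
        by (simp add: root_val_def)
      with sum have "e $ i = bit_sign b * d $ j" "e $ j = bit_sign b * d $ i" using bs by auto
      with other have "e $ k = reflect (i, j, b) d $ k" for k
        using assms(1) by (cases "k \<in> {i, j}") (auto simp: reflect_nth)
      then show ?thesis by (simp add: vec_eq_iff)
    }
  qed
qed

text \<open>For \<open>c = 0\<close> the point \<open>d'\<close> is related to itself, so uniqueness
  compares \<open>d\<close> with \<open>d'\<close>; that reflections are involutions turns the
  answer around.\<close>

lemma root_rel_0: "i \<noteq> j \<Longrightarrow> root_rel (i, j, b) d d' 0 \<longleftrightarrow> d' = d \<or> d' = reflect (i, j, b) d"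
proof -
  assume ij: "i \<noteq> j"
  have rr: "reflect (i, j, b) (reflect (i, j, b) x) = x" for x
    using ij bit_sign_cases[of b, where 'a=real] by (auto simp: vec_eq_iff reflect_nth)
  have "root_rel (i, j, b) d (reflect (i, j, b) d) 0"
    using root_rel_reflect[OF ij, of b "reflect (i, j, b) d" "reflect (i, j, b) d" 0] root_rel_self rr by simp
  moreover have "d' = d \<or> d' = reflect (i, j, b) d" if "root_rel (i, j, b) d d' 0"
    using root_rel_unique[OF ij root_rel_self that] rr[of d'] by auto
  ultimately show ?thesis using root_rel_self by auto
qed

lemma root_rel_exists:
  assumes "i \<noteq> j"
  obtains d where "root_rel (i, j, b) d d' c"
proof
  define s where "s = d' $ i + bit_sign b * d' $ j"
  define q where "q = sqrt ((root_val (i, j, b) d')\<^sup>2 + 4 * (cmod c)\<^sup>2)"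
  have q: "q\<^sup>2 = (root_val (i, j, b) d')\<^sup>2 + 4 * (cmod c)\<^sup>2" by (simp add: q_def)
  \<comment> \<open>The two eigenvalues \<open>(s + q) / 2\<close> and \<open>(s - q) / 2\<close>,
    where \<open>q\<close> is the square root of the discriminant. The second is stored with the
    sign of \<open>b\<close>, because the relation couples place \<open>i\<close> with the signed
    place \<open>j\<close>.\<close>
  define d where "d = (\<chi> k. if k = i then (s + q) / 2 else if k = j then bit_sign b * ((s - q) / 2) else d' $ k)"
  have di: "d $ i = (s + q) / 2" by (simp add: d_def)
  have "d $ j = bit_sign b * ((s - q) / 2)" using assms by (simp add: d_def)
  then have dj: "bit_sign b * d $ j = (s - q) / 2"
    using bit_sign_cases[of b, where 'a=real] by auto
  have "d $ i + bit_sign b * d $ j = s" "root_val (i, j, b) d = q"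
    unfolding root_val_def prod.case di dj by (simp_all add: field_simps)
  then show "root_rel (i, j, b) d d' c"
    using assms q by (simp add: root_rel_def s_def) (simp add: d_def)
qed

text \<open>Dividing the quadratic equation by the square of \<open>root_val\<close> at
  \<open>d\<close> makes it the unit sphere: \<open>h\<close> is the normalized difference of the
  diagonal values and \<open>z\<close> the normalized root coordinate. The poles
  \<open>h = 1\<close> and \<open>h = - 1\<close> are \<open>d\<close> and its reflection.\<close>

lemma root_rel_param:
  assumes ij: "i \<noteq> j" and nz: "root_val (i, j, b) d \<noteq> 0"
  shows "root_rel (i, j, b) d d' c \<longleftrightarrow>
    (\<exists>h z. h\<^sup>2 + (cmod z)\<^sup>2 = 1 \<and>
       d' = d - (root_val (i, j, b) d / 2) *\<^sub>R root_vec (i, j, b) + (h * root_val (i, j, b) d / 2) *\<^sub>R root_vec (i, j, b) \<and>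
       c = of_real (root_val (i, j, b) d / 2) * z)" (is "?l \<longleftrightarrow> ?r")
proof
  let ?v = "root_val (i, j, b)"
  note bs = bit_sign_cases[of b, where 'a=real]
  assume l: ?l
  define h where "h = ?v d' / ?v d"
  define z where "z = c / of_real (?v d / 2)"
  have h: "h * ?v d = ?v d'" using nz by (simp add: h_def)
  have z: "c = of_real (?v d / 2) * z" using nz by (simp add: z_def)
  have "h\<^sup>2 + (cmod z)\<^sup>2 = ((?v d')\<^sup>2 + 4 * (cmod c)\<^sup>2) / (?v d)\<^sup>2"
    by (simp add: h_def z_def power_divide norm_divide add_divide_distrib)
  moreover have "(?v d)\<^sup>2 = (?v d')\<^sup>2 + 4 * (cmod c)\<^sup>2" using l by (simp add: root_rel_def)
  ultimately have "h\<^sup>2 + (cmod z)\<^sup>2 = (?v d)\<^sup>2 / (?v d)\<^sup>2" by metis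
  then have "h\<^sup>2 + (cmod z)\<^sup>2 = 1" using nz by simp
  moreover have "d' = d - (?v d / 2) *\<^sub>R root_vec (i, j, b) + (h * ?v d / 2) *\<^sub>R root_vec (i, j, b)"
    unfolding h using l ij bs by (auto simp: vec_eq_iff root_vec_nth root_rel_def root_val_def field_simps)
  ultimately show ?r using z by blast
next
  let ?v = "root_val (i, j, b)"
  note bs = bit_sign_cases[of b, where 'a=real]
  assume ?r
  then obtain h z where hz: "h\<^sup>2 + (cmod z)\<^sup>2 = 1"
    and d': "d' = d - (?v d / 2) *\<^sub>R root_vec (i, j, b) + (h * ?v d / 2) *\<^sub>R root_vec (i, j, b)"
    and c: "c = of_real (?v d / 2) * z" by (elim exE conjE)
  have v: "?v d' = h * ?v d"
    unfolding d' using ij bs by (auto simp: root_vec_nth root_val_def field_simps)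
  have "(cmod c)\<^sup>2 = (?v d)\<^sup>2 / 4 * (cmod z)\<^sup>2"
    by (simp add: c norm_mult power_mult_distrib power_divide norm_divide)
  then have "(?v d')\<^sup>2 + 4 * (cmod c)\<^sup>2 = (?v d)\<^sup>2 * (h\<^sup>2 + (cmod z)\<^sup>2)"
    by (simp add: v power_mult_distrib distrib_left)
  then have "(?v d)\<^sup>2 = (?v d')\<^sup>2 + 4 * (cmod c)\<^sup>2" using hz by simp
  moreover have "d $ i + bit_sign b * d $ j = d' $ i + bit_sign b * d' $ j"
    unfolding d' using ij bs by (auto simp: root_vec_nth field_simps)
  moreover have "\<forall>k. k \<notin> {i, j} \<longrightarrow> d $ k = d' $ k"
    unfolding d' using ij by (auto simp: root_vec_nth)
  ultimately show ?l by (simp add: root_rel_def)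
qed

section \<open>Torus manifolds with root coordinates\<close>

text \<open>A point of \<open>V\<close> has the diagonal part \<open>D\<close>, embedded by \<open>\<Delta>\<close>, and the root coordinates \<open>\<xi> \<alpha>\<close>,
  embedded by \<open>L \<alpha>\<close>, for \<open>\<alpha> \<in> I\<close>; \<open>F\<close> is the set of diagonal points of \<open>X\<close>.  Every edge of the graph
  occurs in \<open>I\<close> with one orientation only, which makes the weights pairwise independent.\<close>

locale root_torus_manifold =
  fixes act :: "complex^'n::finite \<Rightarrow> 'a \<Rightarrow> 'a::euclidean_space" and X V :: "'a set"
    and I :: "('n \<times> 'n \<times> bit) set" and F :: "(real^'n) set"
    and \<Delta> :: "real^'n \<Rightarrow> 'a" and L :: "'n \<times> 'n \<times> bit \<Rightarrow> complex \<Rightarrow> 'a"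
    and D :: "'a \<Rightarrow> real^'n" and \<xi> :: "'n \<times> 'n \<times> bit \<Rightarrow> 'a \<Rightarrow> complex"
  assumes torus_manifold: "torus_manifold act X"
    and subspace_V: "subspace V" and X_subset_V: "X \<subseteq> V"
    and linear_\<Delta>: "linear \<Delta>" and linear_L: "linear (L \<alpha>)"
    and linear_D: "linear D" and linear_\<xi>: "linear (\<xi> \<alpha>)"
    and \<Delta>_in_V: "\<Delta> d \<in> V" and L_in_V: "\<alpha> \<in> I \<Longrightarrow> L \<alpha> c \<in> V"
    and D_\<Delta>: "D (\<Delta> d) = d" and D_L: "\<alpha> \<in> I \<Longrightarrow> D (L \<alpha> c) = 0"
    and \<xi>_\<Delta>: "\<alpha> \<in> I \<Longrightarrow> \<xi> \<alpha> (\<Delta> d) = 0"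
    and \<xi>_L: "\<lbrakk>\<alpha> \<in> I; \<beta> \<in> I\<rbrakk> \<Longrightarrow> \<xi> \<beta> (L \<alpha> c) = (if \<beta> = \<alpha> then c else 0)"
    and coordinates_eq_0: "\<lbrakk>x \<in> V; D x = 0; \<And>\<alpha>. \<alpha> \<in> I \<Longrightarrow> \<xi> \<alpha> x = 0\<rbrakk> \<Longrightarrow> x = 0"
    and act_\<Delta>: "t \<in> torus \<Longrightarrow> act t (\<Delta> d) = \<Delta> d"
    and act_L: "\<lbrakk>t \<in> torus; \<alpha> \<in> I\<rbrakk> \<Longrightarrow> act t (L \<alpha> c) = L \<alpha> (torus_char (root_weight \<alpha>) t * c)"
    and I_neq: "(i, j, b) \<in> I \<Longrightarrow> i \<noteq> j" and I_asym: "(i, j, b) \<in> I \<Longrightarrow> (j, i, b') \<notin> I"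
    and finite_F: "finite F" and \<Delta>_in_X_iff: "\<Delta> d \<in> X \<longleftrightarrow> d \<in> F"
    and in_X_iff: "\<lbrakk>\<alpha> \<in> I; root_rel \<alpha> d0 d c\<rbrakk> \<Longrightarrow> \<Delta> d + L \<alpha> c \<in> X \<longleftrightarrow> d0 \<in> F"
    and root_val_F: "\<lbrakk>\<alpha> \<in> I; d \<in> F\<rbrakk> \<Longrightarrow> root_val \<alpha> d \<noteq> 0"
begin

lemma finite_I: "finite I"
proof -
  have "finite (UNIV :: ('n \<times> 'n \<times> bit) set)" using finite_UNIV_bit by (simp add: finite_prod)
  then show ?thesis by (rule finite_subset[OF subset_UNIV])
qed

lemma linear_act: "t \<in> torus \<Longrightarrow> linear (act t)" and act_1: "act 1 x = x"
  using torus_manifold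
  by (auto simp: torus_manifold_def linear_torus_action_def)

lemma act_add_\<Delta>_L:
  "\<lbrakk>t \<in> torus; \<alpha> \<in> I\<rbrakk> \<Longrightarrow> act t (\<Delta> d + L \<alpha> c) = \<Delta> d + L \<alpha> (torus_char (root_weight \<alpha>) t * c)"
  by (simp add: linear_add[OF linear_act] act_\<Delta> act_L)

lemma D_add: "\<alpha> \<in> I \<Longrightarrow> D (\<Delta> d + L \<alpha> c) = d"
  by (simp add: linear_add[OF linear_D] D_\<Delta> D_L)

lemma \<xi>_add: "\<lbrakk>\<alpha> \<in> I; \<beta> \<in> I\<rbrakk> \<Longrightarrow> \<xi> \<beta> (\<Delta> d + L \<alpha> c) = (if \<beta> = \<alpha> then c else 0)"
  by (simp add: linear_add[OF linear_\<xi>] \<xi>_\<Delta> \<xi>_L)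

text \<open>The coordinates are assumed only to separate the points of \<open>V\<close>. That they
  also reconstruct a point follows because both sides lie in \<open>V\<close> and have equal
  coordinates.\<close>

lemma decomposition:
  assumes "x \<in> V"
  shows "x = \<Delta> (D x) + (\<Sum>\<alpha>\<in>I. L \<alpha> (\<xi> \<alpha> x))"
proof -
  let ?y = "\<Delta> (D x) + (\<Sum>\<alpha>\<in>I. L \<alpha> (\<xi> \<alpha> x))"
  have "?y \<in> V"
    by (intro subspace_add subspace_sum subspace_V \<Delta>_in_V L_in_V)
  then have "x - ?y \<in> V" using assms by (intro subspace_diff subspace_V)
  moreover have "D (x - ?y) = 0"
    by (simp add: linear_diff[OF linear_D] linear_add[OF linear_D] linear_sum[OF linear_D] D_\<Delta> D_L)
  moreover have "\<xi> \<beta> (x - ?y) = 0" if "\<beta> \<in> I" for \<beta>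
  proof -
    have "\<xi> \<beta> (\<Sum>\<alpha>\<in>I. L \<alpha> (\<xi> \<alpha> x)) = (\<Sum>\<alpha>\<in>I. if \<beta> = \<alpha> then \<xi> \<alpha> x else 0)"
      unfolding linear_sum[OF linear_\<xi>] by (intro sum.cong refl \<xi>_L that)
    also have "\<dots> = \<xi> \<beta> x" using finite_I that by simp
    finally show ?thesis
      by (simp add: linear_diff[OF linear_\<xi>] linear_add[OF linear_\<xi>] \<xi>_\<Delta> that)
  qed
  ultimately have "x - ?y = 0" by (rule coordinates_eq_0)
  then show ?thesis by simp
qed

lemma eq_\<Delta>:
  assumes "x \<in> X" "\<And>\<alpha>. \<alpha> \<in> I \<Longrightarrow> \<xi> \<alpha> x = 0"
  shows "x = \<Delta> (D x)" "D x \<in> F"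
proof -
  show "x = \<Delta> (D x)"
    using decomposition[of x] assms X_subset_V by (simp add: linear_0[OF linear_L] subset_iff)
  then show "D x \<in> F" using assms(1) \<Delta>_in_X_iff[of "D x"] by simp
qed

lemma eq_\<Delta>_L:
  assumes "x \<in> X" "\<alpha> \<in> I" "\<And>\<beta>. \<lbrakk>\<beta> \<in> I; \<beta> \<noteq> \<alpha>\<rbrakk> \<Longrightarrow> \<xi> \<beta> x = 0"
  shows "x = \<Delta> (D x) + L \<alpha> (\<xi> \<alpha> x)"
proof -
  have "(\<Sum>\<beta>\<in>I. L \<beta> (\<xi> \<beta> x)) = (\<Sum>\<beta>\<in>I. if \<beta> = \<alpha> then L \<alpha> (\<xi> \<alpha> x) else 0)"
    using assms(3) by (intro sum.cong refl) (auto simp: linear_0[OF linear_L])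
  also have "\<dots> = L \<alpha> (\<xi> \<alpha> x)" using finite_I assms(2) by simp
  finally show ?thesis using decomposition[of x] assms(1) X_subset_V by auto
qed

lemma char_surj:
  assumes "\<alpha> \<in> I" "cmod u = 1"
  obtains t where "t \<in> torus" "torus_char (root_weight \<alpha>) t = u"
  using assms torus_char_root_surj I_neq by (metis prod_cases3)

lemma inj_L: "\<alpha> \<in> I \<Longrightarrow> inj (L \<alpha>)"
  using \<xi>_L[of \<alpha> \<alpha>] by (metis injI)

lemma act_eq_sum:
  assumes "t \<in> torus" "x \<in> X"
  shows "act t x = \<Delta> (D x) + (\<Sum>\<alpha>\<in>I. L \<alpha> (torus_char (root_weight \<alpha>) t * \<xi> \<alpha> x))"
proof -
  have "act t x = act t (\<Delta> (D x) + (\<Sum>\<alpha>\<in>I. L \<alpha> (\<xi> \<alpha> x)))"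
    using decomposition[of x] assms X_subset_V by auto
  also have "\<dots> = \<Delta> (D x) + (\<Sum>\<alpha>\<in>I. act t (L \<alpha> (\<xi> \<alpha> x)))"
    by (simp add: linear_add[OF linear_act] linear_sum[OF linear_act] act_\<Delta> assms(1))
  also have "\<dots> = \<Delta> (D x) + (\<Sum>\<alpha>\<in>I. L \<alpha> (torus_char (root_weight \<alpha>) t * \<xi> \<alpha> x))"
    by (simp add: act_L assms(1))
  finally show ?thesis .
qed

lemma \<xi>_act:
  assumes "t \<in> torus" "x \<in> X" "\<beta> \<in> I"
  shows "\<xi> \<beta> (act t x) = torus_char (root_weight \<beta>) t * \<xi> \<beta> x"
proof -
  have "\<xi> \<beta> (\<Sum>\<alpha>\<in>I. L \<alpha> (f \<alpha>)) = f \<beta>" for f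
  proof -
    have "\<xi> \<beta> (\<Sum>\<alpha>\<in>I. L \<alpha> (f \<alpha>)) = (\<Sum>\<alpha>\<in>I. if \<beta> = \<alpha> then f \<alpha> else 0)"
      unfolding linear_sum[OF linear_\<xi>] by (intro sum.cong refl \<xi>_L assms(3))
    then show ?thesis using finite_I assms(3) by simp
  qed
  then show ?thesis
    by (simp add: act_eq_sum assms(1,2) linear_add[OF linear_\<xi>] \<xi>_\<Delta> assms(3))
qed

section \<open>Fixed points, orbits and the one-skeleton\<close>

lemma fixed_points_eq: "fixed_points act X = \<Delta> ` F"
proof
  show "\<Delta> ` F \<subseteq> fixed_points act X"
    by (auto simp: fixed_points_def \<Delta>_in_X_iff act_\<Delta>)
  show "fixed_points act X \<subseteq> \<Delta> ` F"
  proof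
    fix x assume "x \<in> fixed_points act X"
    then have x: "x \<in> X" and fixed: "\<And>t. t \<in> torus \<Longrightarrow> act t x = x" by (auto simp: fixed_points_def)
    have "\<xi> \<alpha> x = 0" if \<alpha>: "\<alpha> \<in> I" for \<alpha>
    proof -
      \<comment> \<open>An element on which the root has value -1 forces the coordinate of a fixed
        point to equal its own negative.\<close>
      obtain t where t: "t \<in> torus" "torus_char (root_weight \<alpha>) t = - 1"
        using char_surj[OF \<alpha>, of "- 1"] by auto
      have "\<xi> \<alpha> x = - \<xi> \<alpha> x" using \<xi>_act[OF t(1) x \<alpha>] t(2) by (simp add: fixed t)
      then show ?thesis by simp
    qed
    then show "x \<in> \<Delta> ` F" using eq_\<Delta>[OF x] by blast
  qed
qed

lemma inj_\<Delta>: "inj \<Delta>"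
  using D_\<Delta> by (metis injI)

text \<open>Along the one-parameter subgroup in direction \<theta> each root coordinate rotates
  uniformly, with the pairing of its root with \<theta> as angular speed, while the diagonal part
  stands still.\<close>

lemma orbit_velocity:
  assumes x: "x \<in> X"
  obtains v where "v \<in> tangent_space (torus_orbit act x) x"
    "\<And>\<beta>. \<beta> \<in> I \<Longrightarrow> \<xi> \<beta> v = \<i> * of_real (pairing (root_weight \<beta>) \<theta>) * \<xi> \<beta> x"
proof -
  define p where "p \<beta> = pairing (root_weight \<beta>) \<theta>" for \<beta>
  define c where "c s = act (torus_curve \<theta> s) x" for s
  define v where "v = (\<Sum>\<alpha>\<in>I. L \<alpha> (\<i> * of_real (p \<alpha>) * \<xi> \<alpha> x))"
  have c: "c s = \<Delta> (D x) + (\<Sum>\<alpha>\<in>I. L \<alpha> (cis (s * p \<alpha>) * \<xi> \<alpha> x))" for s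
    unfolding c_def p_def using act_eq_sum[OF torus_curve_in_torus x] by (simp add: torus_char_curve)
  have "((\<lambda>s. cis (s * a) * z) has_vector_derivative (\<i> * of_real a * z)) (at 0)" for a z
  proof -
    \<comment> \<open>The rotation is split into real multiples of \<open>z\<close> and
      \<open>\<i> * z\<close>, so that only real cosine and sine have to be differentiated.\<close>
    have "((\<lambda>s. cos (s * a) *\<^sub>R z + sin (s * a) *\<^sub>R (\<i> * z)) has_vector_derivative (a *\<^sub>R (\<i> * z))) (at 0)"
      by (auto intro!: derivative_eq_intros simp flip: has_real_derivative_iff_has_vector_derivative)
    moreover have "cos (s * a) *\<^sub>R z + sin (s * a) *\<^sub>R (\<i> * z) = cis (s * a) * z" for s
      by (simp add: complex_eq_iff)
    ultimately show ?thesis by (simp add: scaleR_conv_of_real mult_ac)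
  qed
  then have "((\<lambda>s. L \<alpha> (cis (s * p \<alpha>) * \<xi> \<alpha> x)) has_vector_derivative L \<alpha> (\<i> * of_real (p \<alpha>) * \<xi> \<alpha> x)) (at 0)"
    for \<alpha>
    using bounded_linear.has_vector_derivative linear_L linear_conv_bounded_linear by blast
  then have "(c has_vector_derivative v) (at 0)"
    unfolding c[abs_def] v_def by (auto intro!: derivative_eq_intros has_vector_derivative_sum)
  then have "v \<in> tangent_space (torus_orbit act x) x"
    unfolding tangent_space_def torus_orbit_def
    by (intro CollectI exI[of _ c]) (auto simp: c_def torus_curve_0 act_1)
  moreover have "\<xi> \<beta> v = \<i> * of_real (p \<beta>) * \<xi> \<beta> x" if "\<beta> \<in> I" for \<beta>
  proof -
    have "\<xi> \<beta> v = (\<Sum>\<alpha>\<in>I. if \<beta> = \<alpha> then \<i> * of_real (p \<alpha>) * \<xi> \<alpha> x else 0)"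
      unfolding v_def linear_sum[OF linear_\<xi>] by (intro sum.cong refl \<xi>_L that)
    then show ?thesis using finite_I that by simp
  qed
  ultimately show ?thesis using that p_def by simp
qed

text \<open>Independence of two weights, in the form of a one-parameter subgroup that only one of them
  detects.\<close>

lemma separating_direction:
  assumes "\<alpha> \<in> I" "\<beta> \<in> I" "\<alpha> \<noteq> \<beta>"
  obtains \<theta> where "pairing (root_weight \<alpha>) \<theta> \<noteq> 0" "pairing (root_weight \<beta>) \<theta> = 0"
proof -
  obtain i j b where \<alpha>: "\<alpha> = (i, j, b)" using prod_cases3 by blast
  obtain i' j' b' where \<beta>: "\<beta> = (i', j', b')" using prod_cases3 by blast
  have ij: "i \<noteq> j" "i' \<noteq> j'" using I_neq assms \<alpha> \<beta> by blast+
  have pa: "pairing (root_weight \<alpha>) \<theta> = \<theta> $ i - bit_sign b * \<theta> $ j"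
    and pb: "pairing (root_weight \<beta>) \<theta> = \<theta> $ i' - bit_sign b' * \<theta> $ j'" for \<theta>
    by (simp_all add: \<alpha> \<beta> pairing_root_weight)
  note bs = bit_sign_cases[of b, where 'a=real] bit_sign_cases[of b', where 'a=real]
  show ?thesis
  proof (cases "i = i' \<and> j = j'")
    case True
    then have "b \<noteq> b'" using assms(3) \<alpha> \<beta> by simp
    then have "bit_sign b' = (- bit_sign b :: real)"
      using bit_eq_0_or_1[of b] bit_eq_0_or_1[of b'] by (auto simp: bit_sign_def)
    \<comment> \<open>For the two roots of one edge the signs are opposite: this direction is
      annihilated by the root with \<open>b'\<close>, while the root with \<open>b\<close> takes the
      value 2 on it.\<close>
    then show ?thesis using True ij bs
      by (intro that[of "axis i 1 + bit_sign b' *\<^sub>R axis j 1"]) (auto simp: pa pb axis_def)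
  next
    case False
    \<comment> \<open>Fixing the orientation excludes the reversed pair, so the two edges differ as
      sets and some end of the first is missing from the second. The axis of that end separates the
      roots.\<close>
    have "\<not> (i = j' \<and> j = i')" using I_asym[of i j b b'] assms \<alpha> \<beta> by blast
    with False have "(i \<noteq> i' \<and> i \<noteq> j') \<or> (j \<noteq> i' \<and> j \<noteq> j')" using ij by auto
    then show ?thesis
    proof
      assume "i \<noteq> i' \<and> i \<noteq> j'"
      then show ?thesis using ij by (intro that[of "axis i 1"]) (auto simp: pa pb axis_def)
    next
      assume "j \<noteq> i' \<and> j \<noteq> j'"
      then show ?thesis using ij bs by (intro that[of "axis j 1"]) (auto simp: pa pb axis_def)
    qed
  qed
qed

text \<open>Each of the two separating directions moves exactly one of the two nonzero coordinates,
  so the resulting velocities are independent and contradict dimension at most one.\<close>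

lemma not_one_skeleton:
  assumes x: "x \<in> X" and ab: "\<alpha> \<in> I" "\<beta> \<in> I" "\<alpha> \<noteq> \<beta>" and nz: "\<xi> \<alpha> x \<noteq> 0" "\<xi> \<beta> x \<noteq> 0"
  shows "x \<notin> one_skeleton act X"
proof
  assume "x \<in> one_skeleton act X"
  then obtain d where d: "d \<le> 1" "smooth_submanifold d (torus_orbit act x)"
    by (auto simp: one_skeleton_def)
  obtain \<theta> where \<theta>: "pairing (root_weight \<alpha>) \<theta> \<noteq> 0" "pairing (root_weight \<beta>) \<theta> = 0"
    using separating_direction[OF ab] .
  obtain \<theta>' where \<theta>': "pairing (root_weight \<beta>) \<theta>' \<noteq> 0" "pairing (root_weight \<alpha>) \<theta>' = 0"
    using separating_direction[OF ab(2,1) ab(3)[symmetric]] .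
  obtain v where v: "v \<in> tangent_space (torus_orbit act x) x"
    "\<And>\<beta>. \<beta> \<in> I \<Longrightarrow> \<xi> \<beta> v = \<i> * of_real (pairing (root_weight \<beta>) \<theta>) * \<xi> \<beta> x"
    using orbit_velocity[OF x, of \<theta>] by metis
  obtain v' where v': "v' \<in> tangent_space (torus_orbit act x) x"
    "\<And>\<beta>. \<beta> \<in> I \<Longrightarrow> \<xi> \<beta> v' = \<i> * of_real (pairing (root_weight \<beta>) \<theta>') * \<xi> \<beta> x"
    using orbit_velocity[OF x, of \<theta>'] by metis
  have val: "\<xi> \<alpha> v \<noteq> 0" "\<xi> \<beta> v = 0" "\<xi> \<alpha> v' = 0" "\<xi> \<beta> v' \<noteq> 0"
    using v(2) v'(2) \<theta> \<theta>' nz ab by simp_all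
  have "v \<noteq> v'" using val by auto
  moreover have "independent {v, v'}"
  proof -
    have "v \<notin> span {v'}"
    proof
      assume "v \<in> span {v'}"
      then obtain r where "v = r *\<^sub>R v'" by (auto simp: span_singleton)
      then show False using val by (simp add: linear_scale[OF linear_\<xi>])
    qed
    moreover have "v' \<noteq> 0" using val(4) linear_0[OF linear_\<xi>, of \<beta>] by auto
    ultimately show ?thesis using \<open>v \<noteq> v'\<close> by (simp add: independent_insert)
  qed
  moreover have "x \<in> torus_orbit act x"
    unfolding torus_orbit_def using act_1[of x]
    by (intro image_eqI[of _ _ 1]) (simp_all add: torus_def)
  ultimately have "2 \<le> d" using two_tangents_imp_dim_ge_2[OF d(2)] v(1) v'(1) by blast
  then show False using d(1) by simp
qed

text \<open>A root maps the torus onto the whole unit circle, so the only root coordinate attains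
  every complex number of its modulus.\<close>

lemma orbit_\<Delta>_L:
  assumes "\<alpha> \<in> I"
  shows "torus_orbit act (\<Delta> d + L \<alpha> c) = (\<lambda>v. \<Delta> d + L \<alpha> v) ` sphere 0 (cmod c)"
proof
  show "torus_orbit act (\<Delta> d + L \<alpha> c) \<subseteq> (\<lambda>v. \<Delta> d + L \<alpha> v) ` sphere 0 (cmod c)"
    using assms by (auto simp: torus_orbit_def act_add_\<Delta>_L norm_mult norm_torus_char)
  show "(\<lambda>v. \<Delta> d + L \<alpha> v) ` sphere 0 (cmod c) \<subseteq> torus_orbit act (\<Delta> d + L \<alpha> c)"
  proof clarify
    fix v :: complex assume "v \<in> sphere 0 (cmod c)"
    then have v: "cmod v = cmod c" by simp
    define u where "u = (if c = 0 then 1 else v / c)"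
    have "cmod u = 1" using v by (simp add: u_def norm_divide)
    then obtain t where t: "t \<in> torus" "torus_char (root_weight \<alpha>) t = u"
      using char_surj[OF assms] by blast
    have "v = u * c" using v by (auto simp: u_def)
    then have "\<Delta> d + L \<alpha> v = act t (\<Delta> d + L \<alpha> c)"
      using act_add_\<Delta>_L[OF t(1) assms] t(2) by simp
    then show "\<Delta> d + L \<alpha> v \<in> torus_orbit act (\<Delta> d + L \<alpha> c)"
      unfolding torus_orbit_def using t(1) by blast
  qed
qed

lemma \<Delta>_L_in_one_skeleton:
  assumes "\<alpha> \<in> I" "\<Delta> d + L \<alpha> c \<in> X"
  shows "\<Delta> d + L \<alpha> c \<in> one_skeleton act X"
proof (cases "c = 0")
  case True
  then have "torus_orbit act (\<Delta> d + L \<alpha> c) = {\<Delta> d + L \<alpha> c}"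
    unfolding orbit_\<Delta>_L[OF assms(1)] by simp
  then have "smooth_submanifold 0 (torus_orbit act (\<Delta> d + L \<alpha> c))"
    using smooth_submanifold_singleton by simp
  then show ?thesis using assms(2) unfolding one_skeleton_def by blast
next
  case False
  then have "smooth_submanifold 1 (torus_orbit act (\<Delta> d + L \<alpha> c))"
    using smooth_submanifold_sphere_image[OF linear_L inj_L[OF assms(1)], of "cmod c" "\<Delta> d"]
    unfolding orbit_\<Delta>_L[OF assms(1)] by simp
  then show ?thesis using assms(2) unfolding one_skeleton_def by blast
qed

lemma \<Delta>_in_one_skeleton:
  assumes "d \<in> F" shows "\<Delta> d \<in> one_skeleton act X"
proof -
  have "torus_orbit act (\<Delta> d) = {\<Delta> d}"
  proof -
    have "(1 :: complex^'n) \<in> torus" by (simp add: torus_def)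
    then show ?thesis using act_\<Delta> by (auto simp: torus_orbit_def)
  qed
  then have "smooth_submanifold 0 (torus_orbit act (\<Delta> d))"
    using smooth_submanifold_singleton by simp
  then show ?thesis using assms \<Delta>_in_X_iff unfolding one_skeleton_def by blast
qed

lemma rel_reflect: "\<alpha> \<in> I \<Longrightarrow> root_rel \<alpha> (reflect \<alpha> d) d' c \<longleftrightarrow> root_rel \<alpha> d d' c"
  using root_rel_reflect I_neq by (metis prod_cases3)

lemma rel_self: "root_rel \<alpha> d d 0"
  by (cases \<alpha>) (simp add: root_rel_self)

lemma rel_unique:
  "\<lbrakk>\<alpha> \<in> I; root_rel \<alpha> d d' c; root_rel \<alpha> e d' c\<rbrakk> \<Longrightarrow> e = d \<or> e = reflect \<alpha> d"
  using root_rel_unique I_neq by (metis prod_cases3)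

lemma rel_0: "\<alpha> \<in> I \<Longrightarrow> root_rel \<alpha> d d' 0 \<longleftrightarrow> d' = d \<or> d' = reflect \<alpha> d"
  using root_rel_0 I_neq by (metis prod_cases3)

lemma rel_exists: "\<alpha> \<in> I \<Longrightarrow> \<exists>d. root_rel \<alpha> d d' c"
  using root_rel_exists I_neq by (metis prod_cases3)

lemma rel_param:
  assumes "\<alpha> \<in> I" "d \<in> F"
  shows "root_rel \<alpha> d d' c \<longleftrightarrow>
    (\<exists>h z. h\<^sup>2 + (cmod z)\<^sup>2 = 1 \<and>
       d' = d - (root_val \<alpha> d / 2) *\<^sub>R root_vec \<alpha> + (h * root_val \<alpha> d / 2) *\<^sub>R root_vec \<alpha> \<and>
       c = of_real (root_val \<alpha> d / 2) * z)"
proof (cases \<alpha>)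
  case (fields i j b)
  show ?thesis unfolding fields
    by (rule root_rel_param) (use assms fields I_neq root_val_F in auto)
qed

end

section \<open>The invariant sphere of a root and a diagonal point\<close>

context root_torus_manifold
begin

definition K :: "'n \<times> 'n \<times> bit \<Rightarrow> real^'n \<Rightarrow> 'a set" where
  "K \<alpha> d = {\<Delta> d' + L \<alpha> c | d' c. root_rel \<alpha> d d' c}"

definition K_center :: "'n \<times> 'n \<times> bit \<Rightarrow> real^'n \<Rightarrow> 'a" where
  "K_center \<alpha> d = \<Delta> (d - (root_val \<alpha> d / 2) *\<^sub>R root_vec \<alpha>)"

text \<open>Linear part of the parametrization of \<open>K\<close> by the unit sphere of
  \<open>real \<times> complex\<close>: \<open>h\<close> is the latitude and \<open>z\<close> the
  root coordinate, both scaled by half of \<open>root_val\<close>. The values \<open>h = 1\<close>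
  and \<open>h = - 1\<close> give the two diagonal points on either side of
  \<open>K_center\<close>.\<close>

definition K_map :: "'n \<times> 'n \<times> bit \<Rightarrow> real^'n \<Rightarrow> real \<times> complex \<Rightarrow> 'a" where
  "K_map \<alpha> d = (\<lambda>(h, z). \<Delta> ((h * root_val \<alpha> d / 2) *\<^sub>R root_vec \<alpha>) + L \<alpha> (of_real (root_val \<alpha> d / 2) * z))"

lemma K_I: "root_rel \<alpha> d d' c \<Longrightarrow> \<Delta> d' + L \<alpha> c \<in> K \<alpha> d"
  by (auto simp: K_def)

lemma K_E:
  assumes "x \<in> K \<alpha> d"
  obtains d' c where "x = \<Delta> d' + L \<alpha> c" "root_rel \<alpha> d d' c"
  using assms by (auto simp: K_def)

lemma root_vec_nonzero: "\<alpha> \<in> I \<Longrightarrow> root_vec \<alpha> \<noteq> 0"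
proof
  assume a: "\<alpha> \<in> I" "root_vec \<alpha> = 0"
  obtain i j b where \<alpha>: "\<alpha> = (i, j, b)" using prod_cases3 by blast
  then have "i \<noteq> j" using I_neq a(1) by blast
  then have "root_vec \<alpha> $ i = 1" unfolding \<alpha> by (simp add: root_vec_nth)
  then show False by (simp add: a(2))
qed

lemma linear_K_map: "linear (K_map \<alpha> d)"
proof (rule linearI)
  fix x y :: "real \<times> complex" and r :: real
  obtain h z h' z' where xy: "x = (h, z)" "y = (h', z')" by (cases x; cases y)
  show "K_map \<alpha> d (x + y) = K_map \<alpha> d x + K_map \<alpha> d y"
    by (simp add: K_map_def xy distrib_left distrib_right add_divide_distrib scaleR_add_left
        linear_add[OF linear_\<Delta>] linear_add[OF linear_L])
  show "K_map \<alpha> d (r *\<^sub>R x) = r *\<^sub>R K_map \<alpha> d x"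
  proof -
    have "(r * h * root_val \<alpha> d / 2) *\<^sub>R root_vec \<alpha> = r *\<^sub>R ((h * root_val \<alpha> d / 2) *\<^sub>R root_vec \<alpha>)"
      "of_real (root_val \<alpha> d / 2) * (r *\<^sub>R z) = r *\<^sub>R (of_real (root_val \<alpha> d / 2) * z)"
      by (simp_all add: mult.assoc)
    then show ?thesis
      unfolding K_map_def xy scaleR_Pair prod.case real_scaleR_def
      by (simp only: linear_scale[OF linear_\<Delta>] linear_scale[OF linear_L] scaleR_add_right)
  qed
qed

lemma inj_K_map:
  assumes "\<alpha> \<in> I" "d \<in> F"
  shows "inj (K_map \<alpha> d)"
proof (rule injI)
  fix x y assume e: "K_map \<alpha> d x = K_map \<alpha> d y"
  obtain h z h' z' where xy: "x = (h, z)" "y = (h', z')" by (cases x; cases y)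
  note nz = root_val_F[OF assms]
  have "D (K_map \<alpha> d x) = D (K_map \<alpha> d y)" using e by simp
  then have "(h * root_val \<alpha> d / 2) *\<^sub>R root_vec \<alpha> = (h' * root_val \<alpha> d / 2) *\<^sub>R root_vec \<alpha>"
    unfolding xy K_map_def prod.case D_add[OF assms(1)] .
  then have h: "h = h'" using nz root_vec_nonzero[OF assms(1)] by simp
  have "\<xi> \<alpha> (K_map \<alpha> d x) = \<xi> \<alpha> (K_map \<alpha> d y)" using e by simp
  then have "of_real (root_val \<alpha> d / 2) * z = of_real (root_val \<alpha> d / 2) * z'"
    unfolding xy K_map_def prod.case \<xi>_add[OF assms(1) assms(1)] by simp
  then have "z = z'" using nz by simp
  with h show "x = y" by (simp add: xy)
qed

lemma sphere_prod: "(h, z) \<in> sphere 0 1 \<longleftrightarrow> h\<^sup>2 + (cmod z)\<^sup>2 = 1"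
  by (simp add: norm_Pair)

lemma K_eq:
  assumes "\<alpha> \<in> I" "d \<in> F"
  shows "K \<alpha> d = (\<lambda>v. K_center \<alpha> d + K_map \<alpha> d v) ` sphere 0 1"
proof -
  have pt: "K_center \<alpha> d + K_map \<alpha> d (h, z) =
     \<Delta> (d - (root_val \<alpha> d / 2) *\<^sub>R root_vec \<alpha> + (h * root_val \<alpha> d / 2) *\<^sub>R root_vec \<alpha>) +
     L \<alpha> (of_real (root_val \<alpha> d / 2) * z)" for h z
    unfolding K_center_def K_map_def prod.case by (simp only: linear_add[OF linear_\<Delta>] add.assoc)
  show ?thesis
  proof
    show "K \<alpha> d \<subseteq> (\<lambda>v. K_center \<alpha> d + K_map \<alpha> d v) ` sphere 0 1"
    proof
      fix x assume "x \<in> K \<alpha> d"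
      then obtain d' c where "x = \<Delta> d' + L \<alpha> c" "root_rel \<alpha> d d' c" by (auto simp: K_def)
      then obtain h z where "h\<^sup>2 + (cmod z)\<^sup>2 = 1" and x: "x = K_center \<alpha> d + K_map \<alpha> d (h, z)"
        unfolding rel_param[OF assms] pt by metis
      then have "(h, z) \<in> sphere 0 1" by (simp only: sphere_prod)
      then show "x \<in> (\<lambda>v. K_center \<alpha> d + K_map \<alpha> d v) ` sphere 0 1"
        unfolding x by (rule imageI)
    qed
    show "(\<lambda>v. K_center \<alpha> d + K_map \<alpha> d v) ` sphere 0 1 \<subseteq> K \<alpha> d"
    proof clarify
      fix h :: real and z :: complex assume "(h, z) \<in> sphere 0 1"
      then have "h\<^sup>2 + (cmod z)\<^sup>2 = 1" unfolding sphere_prod .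
      then have "root_rel \<alpha> d (d - (root_val \<alpha> d / 2) *\<^sub>R root_vec \<alpha> + (h * root_val \<alpha> d / 2) *\<^sub>R root_vec \<alpha>)
          (of_real (root_val \<alpha> d / 2) * z)"
        unfolding rel_param[OF assms] by (intro exI[of _ h] exI[of _ z]) simp
      then show "K_center \<alpha> d + K_map \<alpha> d (h, z) \<in> K \<alpha> d"
        unfolding pt K_def by auto
    qed
  qed
qed

lemma K_reflect: "\<alpha> \<in> I \<Longrightarrow> K \<alpha> (reflect \<alpha> d) = K \<alpha> d"
  by (simp add: K_def rel_reflect)

text \<open>Invariance of \<open>F\<close> under reflections is derived, not assumed: the reflected
  point is related to \<open>d\<close> with \<open>c = 0\<close>, so \<open>in_X_iff\<close>
  transfers membership between the two poles.\<close>

lemma reflect_in_F: "\<lbrakk>\<alpha> \<in> I; d \<in> F\<rbrakk> \<Longrightarrow> reflect \<alpha> d \<in> F"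
proof -
  assume a: "\<alpha> \<in> I" "d \<in> F"
  have "root_rel \<alpha> (reflect \<alpha> d) d 0" by (simp add: rel_reflect a(1) rel_self)
  from in_X_iff[OF a(1) this] show "reflect \<alpha> d \<in> F"
    using a(2) \<Delta>_in_X_iff by (simp add: linear_0[OF linear_L])
qed

lemma reflect_neq: "\<lbrakk>\<alpha> \<in> I; d \<in> F\<rbrakk> \<Longrightarrow> reflect \<alpha> d \<noteq> d"
  using root_val_F[of \<alpha> d] root_vec_nonzero[of \<alpha>] by (simp add: reflect_def)

lemma K_subset_X: "\<lbrakk>\<alpha> \<in> I; d \<in> F\<rbrakk> \<Longrightarrow> K \<alpha> d \<subseteq> X"
proof
  fix x assume a: "\<alpha> \<in> I" "d \<in> F" and "x \<in> K \<alpha> d"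
  from this(3) show "x \<in> X"
    by (rule K_E) (simp add: in_X_iff[OF a(1)] a(2))
qed

lemma K_fixed_points:
  assumes "\<alpha> \<in> I" "d \<in> F"
  shows "K \<alpha> d \<inter> fixed_points act X = {\<Delta> d, \<Delta> (reflect \<alpha> d)}"
proof -
  note rel = rel_0[OF assms(1), of d]
  have pole: "c = 0 \<and> d' = e" if "\<Delta> d' + L \<alpha> c = \<Delta> e" for d' c e
  proof -
    have "D (\<Delta> d' + L \<alpha> c) = D (\<Delta> e)" "\<xi> \<alpha> (\<Delta> d' + L \<alpha> c) = \<xi> \<alpha> (\<Delta> e)" using that by simp_all
    then show ?thesis using assms(1) by (simp add: D_add \<xi>_add D_\<Delta> \<xi>_\<Delta>)
  qed
  have "K \<alpha> d \<inter> \<Delta> ` F \<subseteq> {\<Delta> d, \<Delta> (reflect \<alpha> d)}"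
  proof
    fix x assume "x \<in> K \<alpha> d \<inter> \<Delta> ` F"
    then have "x \<in> K \<alpha> d" by simp
    then obtain d' c where x: "x = \<Delta> d' + L \<alpha> c" "root_rel \<alpha> d d' c" by (rule K_E)
    obtain e where e: "x = \<Delta> e" using \<open>x \<in> K \<alpha> d \<inter> \<Delta> ` F\<close> by auto
    note x = x e
    then have "c = 0" "d' = e" using pole[of d' c e] by simp_all
    then have "e = d \<or> e = reflect \<alpha> d" using x(2) rel by simp
    then show "x \<in> {\<Delta> d, \<Delta> (reflect \<alpha> d)}" using x(3) by auto
  qed
  moreover have "\<Delta> e \<in> K \<alpha> d \<inter> \<Delta> ` F" if "e = d \<or> e = reflect \<alpha> d" for e
  proof -
    have "\<Delta> e = \<Delta> e + L \<alpha> 0" by (simp add: linear_0[OF linear_L])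
    moreover have "root_rel \<alpha> d e 0" using that rel by simp
    ultimately have "\<Delta> e \<in> K \<alpha> d" using K_I by metis
    moreover have "e \<in> F" using that reflect_in_F[OF assms] assms(2) by auto
    ultimately show ?thesis by blast
  qed
  ultimately show ?thesis unfolding fixed_points_eq by blast
qed

text \<open>The relation sees \<open>c\<close> only through its modulus, which characters
  preserve.\<close>

lemma K_invariant: "\<lbrakk>\<alpha> \<in> I; d \<in> F\<rbrakk> \<Longrightarrow> torus_invariant act (K \<alpha> d)"
proof -
  assume a: "\<alpha> \<in> I" "d \<in> F"
  have "root_rel \<alpha> d d' (u * c)" if "root_rel \<alpha> d d' c" "cmod u = 1" for d' c u
    using that by (cases \<alpha>) (simp add: root_rel_def norm_mult)
  then have inv: "act t (\<Delta> d' + L \<alpha> c) \<in> K \<alpha> d" if "t \<in> torus" "root_rel \<alpha> d d' c" for t d' c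
    unfolding act_add_\<Delta>_L[OF that(1) a(1)]
    by (intro K_I) (simp add: that norm_torus_char)
  have "act t x \<in> K \<alpha> d" if "t \<in> torus" "x \<in> K \<alpha> d" for t x
    using that(2) by (rule K_E) (simp add: inv that(1))
  then show ?thesis unfolding torus_invariant_def by (simp add: image_subset_iff)
qed

lemma K_invariant_sphere:
  assumes "\<alpha> \<in> I" "d \<in> F"
  shows "K \<alpha> d \<in> invariant_spheres act X"
proof -
  have "K \<alpha> d \<subseteq> one_skeleton act X"
  proof
    fix x assume x: "x \<in> K \<alpha> d"
    then have "x \<in> X" using K_subset_X[OF assms] by blast
    with x show "x \<in> one_skeleton act X"
      by (elim K_E) (simp add: \<Delta>_L_in_one_skeleton assms(1))
  qed
  moreover have "smooth_submanifold 2 (K \<alpha> d)"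
    using smooth_submanifold_sphere_image[OF linear_K_map inj_K_map[OF assms], of 1 "K_center \<alpha> d"]
    unfolding K_eq[OF assms] by (simp add: numeral_2_eq_2)
  moreover have "K \<alpha> d homeomorphic sphere (0 :: real^3) 1"
  proof -
    have lin: "linear (K_map \<alpha> d)" and inj: "inj (K_map \<alpha> d)"
      using linear_K_map inj_K_map[OF assms] .
    have "sphere (0 :: real \<times> complex) 1 homeomorphic K_map \<alpha> d ` sphere 0 1"
      by (rule linear_homeomorphic_image[OF lin inj])
    also have "\<dots> homeomorphic (+) (K_center \<alpha> d) ` (K_map \<alpha> d ` sphere 0 1)"
      by (rule homeomorphic_translation)
    finally have "sphere (0 :: real \<times> complex) 1 homeomorphic K \<alpha> d"
      unfolding K_eq[OF assms] by (simp add: image_image)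
    \<comment> \<open>The parameter space \<open>real \<times> complex\<close> is another
      three-dimensional Euclidean space, so its unit sphere may stand in for that of
      \<open>real^3\<close>.\<close>
    moreover have "sphere (0 :: real \<times> complex) 1 homeomorphic sphere (0 :: real^3) 1"
      by (rule homeomorphic_spheres_gen) auto
    ultimately show ?thesis using homeomorphic_sym homeomorphic_trans by blast
  qed
  moreover have "card (K \<alpha> d \<inter> fixed_points act X) = 2"
    using reflect_neq[OF assms] inj_\<Delta> unfolding K_fixed_points[OF assms] by (simp add: inj_eq)
  ultimately show ?thesis using K_invariant[OF assms] by (simp add: invariant_spheres_def)
qed

text \<open>At most one root coordinate is nonzero. Since the quadratic equation is always solvable,
  such a point lies on \<open>K\<close> for some \<open>d\<close>, and the spectral condition on the
  point says exactly that this \<open>d\<close> is in \<open>F\<close>.\<close>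

lemma one_skeleton_cases:
  assumes "x \<in> one_skeleton act X"
  shows "x \<in> fixed_points act X \<or> (\<exists>\<alpha> d. \<alpha> \<in> I \<and> d \<in> F \<and> x \<in> K \<alpha> d)"
proof (cases "\<exists>\<alpha>\<in>I. \<xi> \<alpha> x \<noteq> 0")
  case False
  then have "x = \<Delta> (D x)" "D x \<in> F" using eq_\<Delta>[of x] assms by (auto simp: one_skeleton_def)
  then have "x \<in> \<Delta> ` F" by (rule image_eqI)
  then show ?thesis by (simp add: fixed_points_eq)
next
  case True
  have x: "x \<in> X" using assms by (simp add: one_skeleton_def)
  obtain \<alpha> where \<alpha>: "\<alpha> \<in> I" "\<xi> \<alpha> x \<noteq> 0" using True by blast
  then have e: "x = \<Delta> (D x) + L \<alpha> (\<xi> \<alpha> x)"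
    using eq_\<Delta>_L[OF x] not_one_skeleton[OF x] assms by blast
  obtain d where d: "root_rel \<alpha> d (D x) (\<xi> \<alpha> x)"
    using rel_exists[OF \<alpha>(1)] by blast
  have "d \<in> F" using in_X_iff[OF \<alpha>(1) d] e x by simp
  moreover have "x \<in> K \<alpha> d" using K_I[OF d] e by simp
  ultimately show ?thesis using \<alpha>(1) by blast
qed

text \<open>Off the diagonal, a point of \<open>K\<close> reveals its root as the only nonzero root
  coordinate; its diagonal part and coordinate then fix \<open>d\<close> up to reflection.\<close>

lemma K_inter:
  assumes "\<alpha> \<in> I" "\<beta> \<in> I" "x \<in> K \<alpha> d" "x \<in> K \<beta> e" "x \<notin> range \<Delta>"
  shows "\<alpha> = \<beta> \<and> (e = d \<or> e = reflect \<alpha> d)"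
proof -
  obtain d' c where d': "x = \<Delta> d' + L \<alpha> c" "root_rel \<alpha> d d' c" using assms(3) by (rule K_E)
  obtain e' c' where e': "x = \<Delta> e' + L \<beta> c'" "root_rel \<beta> e e' c'" using assms(4) by (rule K_E)
  have "c \<noteq> 0" using assms(5) d'(1) by (auto simp: linear_0[OF linear_L])
  moreover have "\<xi> \<alpha> x = c" "\<xi> \<alpha> x = (if \<alpha> = \<beta> then c' else 0)"
    using \<xi>_add[OF assms(1) assms(1), of d' c] \<xi>_add[OF assms(2) assms(1), of e' c'] d'(1) e'(1)
    by simp_all
  ultimately have ab: "\<alpha> = \<beta>" "c' = c" by (auto split: if_splits)
  have "d' = e'" using D_add assms(1,2) d'(1) e'(1) by metis
  then show ?thesis using rel_unique[OF assms(1) d'(2), of e] e'(2) ab by simp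
qed

lemma K_eq_iff:
  assumes "\<alpha> \<in> I" "\<beta> \<in> I" "d \<in> F" "e \<in> F"
  shows "K \<alpha> d = K \<beta> e \<longleftrightarrow> \<alpha> = \<beta> \<and> (e = d \<or> e = reflect \<alpha> d)"
proof
  assume e: "K \<alpha> d = K \<beta> e"
  \<comment> \<open>A point on the equator: its root coordinate is half of \<open>root_val\<close>,
    hence nonzero, which makes \<open>K_inter\<close> applicable.\<close>
  define x where "x = K_center \<alpha> d + K_map \<alpha> d (0, 1)"
  have "(0, 1) \<in> sphere (0 :: real \<times> complex) 1" by (simp add: sphere_prod)
  then have x: "x \<in> K \<alpha> d" unfolding K_eq[OF assms(1,3)] x_def by blast
  have "\<xi> \<alpha> x \<noteq> 0"
    using root_val_F[OF assms(1,3)] assms(1)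
    by (simp add: x_def K_center_def K_map_def linear_add[OF linear_\<xi>] \<xi>_\<Delta> \<xi>_L)
  then have "x \<notin> range \<Delta>" using \<xi>_\<Delta>[OF assms(1)] by auto
  then show "\<alpha> = \<beta> \<and> (e = d \<or> e = reflect \<alpha> d)"
    using K_inter[OF assms(1,2) x] x e by blast
next
  assume "\<alpha> = \<beta> \<and> (e = d \<or> e = reflect \<alpha> d)"
  then show "K \<alpha> d = K \<beta> e" using K_reflect[OF assms(1)] by auto
qed

section \<open>Classification of the invariant spheres\<close>

lemma closed_K: "\<lbrakk>\<alpha> \<in> I; d \<in> F\<rbrakk> \<Longrightarrow> closed (K \<alpha> d)"
proof -
  assume a: "\<alpha> \<in> I" "d \<in> F"
  have "continuous_on (sphere 0 1) (\<lambda>v. K_center \<alpha> d + K_map \<alpha> d v)"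
    using linear_K_map by (intro continuous_intros linear_continuous_on) (simp add: linear_conv_bounded_linear)
  then have "compact (K \<alpha> d)"
    unfolding K_eq[OF a] by (intro compact_continuous_image) simp_all
  then show ?thesis by (rule compact_imp_closed)
qed

text \<open>Away from the fixed points the spheres \<open>K \<alpha> d\<close> are disjoint, and an invariant sphere minus its
  two fixed points is connected, so it lies in a single \<open>K \<alpha> d\<close>.  It contains both poles of that sphere,
  therefore meets every latitude, and latitudes are orbits.\<close>

lemma invariant_spheres_eq:
  "invariant_spheres act X = {K \<alpha> d | \<alpha> d. \<alpha> \<in> I \<and> d \<in> F}" (is "_ = ?\<K>")
proof
  show "?\<K> \<subseteq> invariant_spheres act X" using K_invariant_sphere by blast
  show "invariant_spheres act X \<subseteq> ?\<K>"
  proof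
    fix S assume "S \<in> invariant_spheres act X"
    then have S: "S \<subseteq> one_skeleton act X" "torus_invariant act S"
      "S homeomorphic sphere (0 :: real^3) 1" "card (S \<inter> fixed_points act X) = 2"
      by (auto simp: invariant_spheres_def)
    then obtain p q where pq: "S \<inter> fixed_points act X = {p, q}" "p \<noteq> q"
      unfolding card_2_iff by blast
    let ?S = "S - {p, q}"
    have con: "connected ?S"
      by (rule connected_sphere_minus_two_points[OF S(3)]) (use pq in auto)
    have "connected (sphere (0 :: real^3) 1)" by (rule connected_sphere) simp
    then have conS: "connected S" using S(3) homeomorphic_connectedness by blast
    have "p \<in> S" "q \<in> S" using pq(1) by auto
    then have "S \<noteq> {x}" for x using pq(2) by auto
    \<comment> \<open>A connected set with more than one point has no isolated points. So the two
      removed points are recovered from the closure of the rest, as soon as the rest lies in a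
      closed sphere.\<close>
    then have perfect: "p islimpt S" "q islimpt S"
      using connected_imp_perfect[OF conS] \<open>p \<in> S\<close> \<open>q \<in> S\<close> by simp_all
    have dense: "p \<in> closure ?S" "q \<in> closure ?S"
    proof -
      have S_eq: "{p, q} \<union> ?S = S" using \<open>p \<in> S\<close> \<open>q \<in> S\<close> by auto
      have "x islimpt S \<longleftrightarrow> x islimpt ?S" for x
        using islimpt_Un_finite[of "{p, q}" x ?S] unfolding S_eq by simp
      then have "p islimpt ?S" "q islimpt ?S" using perfect by simp_all
      then show "p \<in> closure ?S" "q \<in> closure ?S" by (auto simp: closure_def)
    qed
    then have "?S \<noteq> {}" by (metis closure_empty empty_iff)
    then obtain x0 where x0: "x0 \<in> ?S" by blast
    have nofix: "x \<notin> fixed_points act X" if "x \<in> ?S" for x using that pq(1) by blast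
    have cov: "\<exists>\<alpha> d. \<alpha> \<in> I \<and> d \<in> F \<and> x \<in> K \<alpha> d" if "x \<in> ?S" for x
      using one_skeleton_cases[of x] S(1) nofix[OF that] that by auto
    obtain \<alpha> d where \<alpha>d: "\<alpha> \<in> I" "d \<in> F" "x0 \<in> K \<alpha> d" using cov[OF x0] by blast
    \<comment> \<open>All other spheres together. There are finitely many, because \<open>I\<close>
      and \<open>F\<close> are finite, so \<open>B\<close> is closed and the connected set cannot be
      divided between \<open>K \<alpha> d\<close> and \<open>B\<close>.\<close>
    define B where "B = \<Union> (?\<K> - {K \<alpha> d})"
    have "?\<K> = (\<lambda>(\<alpha>, d). K \<alpha> d) ` (I \<times> F)" by auto
    then have "finite ?\<K>" using finite_I finite_F by simp
    then have closedB: "closed B" unfolding B_def by (intro closed_Union) (auto simp: closed_K)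
    have SB: "?S \<subseteq> K \<alpha> d \<union> B" unfolding B_def using cov by blast
    moreover have "K \<alpha> d \<inter> B \<inter> ?S = {}"
    proof -
      have False if x: "x \<in> K \<alpha> d" "x \<in> K \<beta> e" "\<beta> \<in> I" "e \<in> F" "K \<beta> e \<noteq> K \<alpha> d" "x \<in> ?S" for x \<beta> e
      proof -
        have "x \<notin> range \<Delta>"
        proof
          assume "x \<in> range \<Delta>"
          then obtain d' where "x = \<Delta> d'" by blast
          moreover have "x \<in> X" using x(1) K_subset_X \<alpha>d by blast
          ultimately have "x \<in> fixed_points act X" by (auto simp: fixed_points_eq \<Delta>_in_X_iff)
          then show False using nofix[OF x(6)] by blast
        qed
        then show False using K_inter[OF \<alpha>d(1) x(3) x(1,2)] K_eq_iff[OF \<alpha>d(1) x(3) \<alpha>d(2) x(4)] x(5) by simp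
      qed
      then show ?thesis unfolding B_def by blast
    qed
    moreover have "K \<alpha> d \<inter> ?S \<noteq> {}" using x0 \<alpha>d(3) by blast
    ultimately have "B \<inter> ?S = {}"
      using connected_closedD[OF con, of "K \<alpha> d" B] closed_K[OF \<alpha>d(1,2)] closedB by argo
    then have sub: "?S \<subseteq> K \<alpha> d" using SB by blast
    then have "closure ?S \<subseteq> K \<alpha> d" using closed_K[OF \<alpha>d(1,2)] by (rule closure_minimal)
    then have SK: "S \<subseteq> K \<alpha> d" using sub dense by blast
    have "S \<inter> fixed_points act X \<subseteq> K \<alpha> d \<inter> fixed_points act X" using SK by (rule Int_mono) simp
    then have "{p, q} \<subseteq> {\<Delta> d, \<Delta> (reflect \<alpha> d)}"
      unfolding pq(1) K_fixed_points[OF \<alpha>d(1,2)] .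
    then have "(p = \<Delta> d \<or> p = \<Delta> (reflect \<alpha> d)) \<and> (q = \<Delta> d \<or> q = \<Delta> (reflect \<alpha> d))" by simp
    then have poles: "\<Delta> d \<in> S" "\<Delta> (reflect \<alpha> d) \<in> S"
      using pq(2) \<open>p \<in> S\<close> \<open>q \<in> S\<close> by metis+
    have "K \<alpha> d \<subseteq> S"
    proof
      obtain i j b where \<alpha>: "\<alpha> = (i, j, b)" using prod_cases3 by blast
      have ij: "i \<noteq> j" using I_neq \<alpha>d(1) \<alpha> by blast
      \<comment> \<open>The latitude, up to scale. It takes opposite values at the poles, so its
        image of the connected set \<open>S\<close> is an interval containing every latitude of
        \<open>K \<alpha> d\<close>.\<close>
      define H where "H x = root_val \<alpha> (D x)" for x
      have linH: "linear H" using linear_D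
        by (intro linearI) (simp_all add: H_def \<alpha> root_val_def linear_add linear_scale algebra_simps)
      then have "connected (H ` S)"
        using conS by (intro connected_continuous_image linear_continuous_on)
          (simp_all add: linear_conv_bounded_linear)
      then have conv: "is_interval (H ` S)" using is_interval_connected_1 by blast
      have HP: "H (\<Delta> d) = root_val \<alpha> d" "H (\<Delta> (reflect \<alpha> d)) = - root_val \<alpha> d"
        using ij by (simp_all add: H_def D_\<Delta> \<alpha> root_val_reflect)
      fix y assume "y \<in> K \<alpha> d"
      then obtain d1 c1 where y: "y = \<Delta> d1 + L \<alpha> c1" "root_rel \<alpha> d d1 c1" by (rule K_E)
      have Hy: "H y = root_val \<alpha> d1" using D_add[OF \<alpha>d(1)] by (simp add: H_def y(1))
      have "(root_val \<alpha> d1)\<^sup>2 \<le> (root_val \<alpha> d)\<^sup>2"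
        using y(2) by (simp add: \<alpha> root_rel_def)
      then have "\<bar>H y\<bar> \<le> \<bar>root_val \<alpha> d\<bar>" unfolding Hy by (simp add: abs_le_square_iff)
      moreover have ends: "root_val \<alpha> d \<in> H ` S" "- root_val \<alpha> d \<in> H ` S"
        using poles[THEN imageI, of H] unfolding HP .
      \<comment> \<open>Which pole is the upper one depends on the sign of \<open>root_val\<close>,
        hence the two orders of the end points.\<close>
      ultimately have "H y \<in> H ` S"
        using mem_is_interval_1_I[OF conv ends, of "H y"] mem_is_interval_1_I[OF conv ends(2,1), of "H y"]
        by (cases "0 \<le> root_val \<alpha> d") (simp_all add: abs_le_iff)
      then obtain x where x: "x \<in> S" "H x = H y" by auto
      then have "x \<in> K \<alpha> d" using SK by blast
      then obtain d2 c2 where x2: "x = \<Delta> d2 + L \<alpha> c2" "root_rel \<alpha> d d2 c2" by (rule K_E)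
      have Hx: "root_val \<alpha> d2 = root_val \<alpha> d1"
        using x(2) Hy D_add[OF \<alpha>d(1)] by (simp add: H_def x2(1))
      \<comment> \<open>On one sphere the sum is constant, so equal latitude makes the diagonal
        parts equal; then the root coordinates have equal modulus, and \<open>x\<close> and
        \<open>y\<close> lie in one orbit.\<close>
      have "d2 = d1"
      proof -
        have other: "d2 $ k = d1 $ k" if "k \<notin> {i, j}" for k
          using y(2) x2(2) that by (simp add: \<alpha> root_rel_def)
        have "d2 $ i + bit_sign b * d2 $ j = d1 $ i + bit_sign b * d1 $ j"
          using y(2) x2(2) by (simp add: \<alpha> root_rel_def)
        moreover have "d2 $ i - bit_sign b * d2 $ j = d1 $ i - bit_sign b * d1 $ j"
          using Hx by (simp add: \<alpha> root_val_def)
        ultimately have "d2 $ i = d1 $ i" "d2 $ j = d1 $ j"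
          using bit_sign_cases[of b, where 'a=real] by auto
        then have "d2 $ k = d1 $ k" for k using other[of k] by (cases "k \<in> {i, j}") auto
        then show ?thesis by (simp add: vec_eq_iff)
      qed
      moreover have "cmod c1 = cmod c2"
      proof -
        have "(cmod c1)\<^sup>2 = (cmod c2)\<^sup>2"
          using y(2) x2(2) Hx by (simp add: \<alpha> root_rel_def)
        then show ?thesis by simp
      qed
      ultimately have "y \<in> torus_orbit act x"
        unfolding x2(1) orbit_\<Delta>_L[OF \<alpha>d(1)] y(1) by auto
      then show "y \<in> S" using S(2) x(1) by (auto simp: torus_orbit_def torus_invariant_def)
    qed
    with SK have "S = K \<alpha> d" by blast
    then show "S \<in> ?\<K>" using \<alpha>d by blast
  qed
qed

section \<open>The GKM property, tangent planes and weights\<close>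

lemma gkm_manifold: "gkm_manifold act X"
  unfolding gkm_manifold_def
proof (intro conjI torus_manifold)
  show "finite (fixed_points act X)" by (simp add: fixed_points_eq finite_F)
  show "one_skeleton act X = fixed_points act X \<union> \<Union> (invariant_spheres act X)"
  proof
    show "one_skeleton act X \<subseteq> fixed_points act X \<union> \<Union> (invariant_spheres act X)"
      using one_skeleton_cases K_invariant_sphere by fastforce
    show "fixed_points act X \<union> \<Union> (invariant_spheres act X) \<subseteq> one_skeleton act X"
      using \<Delta>_in_one_skeleton by (auto simp: fixed_points_eq invariant_spheres_def)
  qed
qed

text \<open>The point is the pole \<open>(1, 0)\<close> of the parameter sphere, whose orthogonal
  complement consists of the pairs \<open>(0, z)\<close>; \<open>K_map\<close> sends these onto the
  root plane.\<close>

lemma tangent_space_K: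
  assumes "\<alpha> \<in> I" "d \<in> F"
  shows "tangent_space (K \<alpha> d) (\<Delta> d) = range (L \<alpha>)"
proof -
  have nz: "root_val \<alpha> d \<noteq> 0" by (rule root_val_F[OF assms])
  have "K_center \<alpha> d + K_map \<alpha> d (1, 0) = \<Delta> d"
    by (simp add: K_center_def K_map_def linear_0[OF linear_L] flip: linear_add[OF linear_\<Delta>])
  then have "tangent_space (K \<alpha> d) (\<Delta> d) = K_map \<alpha> d ` {v. (1, 0) \<bullet> v = 0}"
    using tangent_space_sphere_image[OF linear_K_map inj_K_map[OF assms], of "(1, 0)" "K_center \<alpha> d"]
    unfolding K_eq[OF assms] by (simp add: norm_Pair)
  also have "\<dots> = (\<lambda>z. L \<alpha> (of_real (root_val \<alpha> d / 2) * z)) ` UNIV"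
    by (force simp: K_map_def linear_0[OF linear_\<Delta>] image_iff)
  also have "\<dots> = range (L \<alpha>)"
  proof -
    have "L \<alpha> c = L \<alpha> (of_real (root_val \<alpha> d / 2) * (c / of_real (root_val \<alpha> d / 2)))" for c
      using nz by simp
    then show ?thesis by blast
  qed
  finally show ?thesis .
qed

lemma axial_K:
  assumes "\<alpha> \<in> I" "d \<in> F"
  shows "axial (gkm_graph act X) (K \<alpha> d) = {root_weight \<alpha>, - root_weight \<alpha>}"
proof -
  \<comment> \<open>Starting from the reflected point gives the same sphere, so the tangent plane at
    the other pole is the same root plane and both ends admit the same weights.\<close>
  have "tangent_space (K \<alpha> d) (\<Delta> (reflect \<alpha> d)) = range (L \<alpha>)"
    using tangent_space_K[OF assms(1) reflect_in_F[OF assms]] K_reflect[OF assms(1)] by simp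
  then have "axial (gkm_graph act X) (K \<alpha> d) = {w. has_weight act (range (L \<alpha>)) w}"
    unfolding gkm_graph_def using tangent_space_K[OF assms] K_fixed_points[OF assms] by simp
  also have "\<dots> = {root_weight \<alpha>, - root_weight \<alpha>}"
    using has_weight_range_iff[OF linear_L inj_L[OF assms(1)], of act "root_weight \<alpha>"]
      act_L[OF _ assms(1)] by auto
  finally show ?thesis .
qed

end

section \<open>Determinants of matrices with few off-diagonal entries\<close>

lemma matrix_inv_eqI:
  fixes A B :: "'a::comm_ring_1^'n^'n"
  assumes "A ** B = mat 1" "B ** A = mat 1"
  shows "matrix_inv A = B"
proof -
  have "A ** matrix_inv A = mat 1 \<and> matrix_inv A ** A = mat 1"
    unfolding matrix_inv_def by (rule someI[of _ B]) (use assms in simp)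
  then have "matrix_inv A = matrix_inv A ** (A ** B)" "matrix_inv A ** A = mat 1"
    using assms by simp_all
  then show ?thesis by (simp add: matrix_mul_assoc)
qed

lemma diag_mult_left: "((\<chi> i j. if i = j then d i else 0) ** (A :: 'a::comm_ring_1^'m^'n)) $ i $ j = d i * A $ i $ j"
proof -
  have "(\<Sum>k\<in>UNIV. (if i = k then d i else 0) * A $ k $ j) = (\<Sum>k\<in>UNIV. if i = k then d i * A $ i $ j else 0)"
    by (intro sum.cong) auto
  then show ?thesis by (simp add: matrix_matrix_mult_def)
qed

lemma diag_mult_right: "((A :: 'a::comm_ring_1^'n^'m) ** (\<chi> i j. if i = j then d i else 0)) $ i $ j = A $ i $ j * d j"
proof -
  have "(\<Sum>k\<in>UNIV. A $ i $ k * (if k = j then d k else 0)) = (\<Sum>k\<in>UNIV. if j = k then A $ i $ j * d j else 0)"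
    by (intro sum.cong) auto
  then show ?thesis by (simp add: matrix_matrix_mult_def)
qed

lemma mat_mult_left: "(mat z ** (A :: 'a::comm_ring_1^'m^'n)) $ i $ j = z * A $ i $ j"
  using diag_mult_left[of "\<lambda>_. z" A i j] by (simp add: mat_def)

lemma mat_mult_right: "((A :: 'a::comm_ring_1^'n^'m) ** mat z) $ i $ j = A $ i $ j * z"
  using diag_mult_right[of A "\<lambda>_. z" i j] by (simp add: mat_def)

text \<open>Scalar matrices are central, so the conjugation can be pulled out of the difference, and
  \<open>det U * det W = 1\<close>.\<close>

lemma det_mat_minus_conjugate:
  fixes A U W :: "complex^'n^'n"
  assumes "U ** W = mat 1"
  shows "det (mat z - U ** A ** W) = det (mat z - A)"
proof -
  have "U ** mat z = mat z ** U" by (simp add: vec_eq_iff mat_mult_left mat_mult_right)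
  then have "U ** mat z ** W = mat z ** mat 1" by (simp add: assms flip: matrix_mul_assoc)
  then have z: "U ** mat z ** W = mat z" by simp
  have "U ** (mat z - A) = U ** mat z - U ** A"
    by (simp add: vec_eq_iff matrix_matrix_mult_def right_diff_distrib sum_subtractf)
  moreover have "(U ** mat z - U ** A) ** W = U ** mat z ** W - U ** A ** W"
    by (simp add: vec_eq_iff matrix_matrix_mult_def left_diff_distrib sum_subtractf)
  ultimately have "mat z - U ** A ** W = U ** (mat z - A) ** W" by (simp add: z)
  then have "det (mat z - U ** A ** W) = det U * det W * det (mat z - A)"
    by (simp add: det_mul)
  also have "det U * det W = 1" using assms by (simp flip: det_mul)
  finally show ?thesis by simp
qed

lemma prod_UNIV_remove2:
  fixes f :: "'m::finite \<Rightarrow> 'b::comm_monoid_mult"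
  assumes "p \<noteq> q"
  shows "prod f UNIV = f p * f q * prod f (UNIV - {p, q})"
proof -
  have "prod f UNIV = f p * prod f (UNIV - {p})" by (rule prod.remove) auto
  also have "prod f (UNIV - {p}) = f q * prod f (UNIV - {p} - {q})"
    using assms by (intro prod.remove) auto
  also have "UNIV - {p} - {q} = UNIV - {p, q}" by auto
  finally show ?thesis by (simp add: mult.assoc)
qed

lemma permutes_pair:
  assumes "\<pi> permutes UNIV" "\<And>r. r \<notin> {p, q} \<Longrightarrow> \<pi> r = r"
  shows "\<pi> = id \<or> \<pi> = Transposition.transpose p q"
proof -
  have inj: "inj \<pi>" using assms(1) permutes_inj by blast
  have mem: "\<pi> r \<in> {p, q}" if "r \<in> {p, q}" for r
  proof (rule ccontr)
    assume "\<pi> r \<notin> {p, q}"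
    then have "\<pi> (\<pi> r) = \<pi> r" by (rule assms(2))
    then have "\<pi> r = r" using inj by (simp add: inj_eq)
    then show False using \<open>\<pi> r \<notin> {p, q}\<close> that by simp
  qed
  show ?thesis
  proof (cases "\<pi> p = p")
    case True
    then have "\<pi> q = q" using mem[of q] inj by (auto simp: inj_eq dest: injD)
    then have "\<pi> r = r" for r using True assms(2)[of r] by (cases "r \<in> {p, q}") auto
    then show ?thesis by (simp add: fun_eq_iff)
  next
    case False
    then have pq: "\<pi> p = q" "p \<noteq> q" using mem[of p] by auto
    have "\<pi> q \<noteq> q" using pq injD[OF inj, of p q] by auto
    then have "\<pi> q = p" using mem[of q] by auto
    then have "\<pi> r = Transposition.transpose p q r" for r
      using pq assms(2)[of r] by (cases "r \<in> {p, q}") auto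
    then show ?thesis by (simp add: fun_eq_iff)
  qed
qed

text \<open>A permutation that moves an index outside \<open>p\<close>, \<open>q\<close> meets a
  zero entry. Only the identity and the transposition survive in the Leibniz expansion.\<close>

lemma det_pair:
  fixes M :: "'a::comm_ring_1^'m^'m"
  assumes pq: "p \<noteq> q"
    and supp: "\<And>r s. \<lbrakk>r \<noteq> s; (r, s) \<noteq> (p, q); (r, s) \<noteq> (q, p)\<rbrakk> \<Longrightarrow> M $ r $ s = 0"
  shows "det M = (M $ p $ p * M $ q $ q - M $ p $ q * M $ q $ p) * (\<Prod>r\<in>UNIV - {p, q}. M $ r $ r)"
proof -
  let ?t = "Transposition.transpose p q"
  let ?f = "\<lambda>\<pi>. of_int (sign \<pi>) * (\<Prod>r\<in>UNIV. M $ r $ \<pi> r)"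
  have sub: "{id, ?t} \<subseteq> {\<pi>. \<pi> permutes UNIV}" by (simp add: permutes_id permutes_swap_id)
  have "?f \<pi> = 0" if \<pi>: "\<pi> \<in> {\<pi>. \<pi> permutes UNIV} - {id, ?t}" for \<pi>
  proof -
    obtain r where r: "r \<notin> {p, q}" "\<pi> r \<noteq> r" using permutes_pair[of \<pi> p q] \<pi> by auto
    then have "M $ r $ \<pi> r = 0" by (intro supp) auto
    then have "(\<Prod>r\<in>UNIV. M $ r $ \<pi> r) = 0" by (intro prod_zero) auto
    then show ?thesis by simp
  qed
  then have "det M = sum ?f {id, ?t}"
    unfolding det_def by (intro sum.mono_neutral_right ballI sub) (simp_all add: finite_permutations)
  also have "\<dots> = ?f id + ?f ?t"
    using pq by (simp add: transpose_eq_id_iff eq_commute[of id])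
  also have "?f id = M $ p $ p * M $ q $ q * (\<Prod>r\<in>UNIV - {p, q}. M $ r $ r)"
    by (simp add: prod_UNIV_remove2[OF pq])
  also have "?f ?t = - (M $ p $ q * M $ q $ p * (\<Prod>r\<in>UNIV - {p, q}. M $ r $ r))"
  proof -
    have "(\<Prod>r\<in>UNIV - {p, q}. M $ r $ ?t r) = (\<Prod>r\<in>UNIV - {p, q}. M $ r $ r)"
      by (intro prod.cong) auto
    then show ?thesis using pq by (simp add: prod_UNIV_remove2[OF pq] sign_swap_id)
  qed
  finally show ?thesis by (simp add: algebra_simps)
qed

text \<open>Since no entry connects \<open>p\<close>, \<open>q\<close> with the remaining indices,
  the matrix is a product of two factors, each equal to the identity where the other carries
  entries; \<open>det_pair\<close> applies to both.\<close>

lemma det_two_pairs: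
  fixes M :: "'a::comm_ring_1^'m^'m"
  assumes dist: "distinct [p, q, p', q']"
    and supp: "\<And>r s. \<lbrakk>r \<noteq> s; (r, s) \<noteq> (p, q); (r, s) \<noteq> (q, p); (r, s) \<noteq> (p', q'); (r, s) \<noteq> (q', p')\<rbrakk>
      \<Longrightarrow> M $ r $ s = 0"
  shows "det M = (M $ p $ p * M $ q $ q - M $ p $ q * M $ q $ p) *
    (M $ p' $ p' * M $ q' $ q' - M $ p' $ q' * M $ q' $ p') * (\<Prod>r\<in>UNIV - {p, q, p', q'}. M $ r $ r)"
proof -
  define S where "S = {p, q}"
  define M1 :: "'a^'m^'m" where "M1 = (\<chi> r s. if r \<in> S \<and> s \<in> S then M $ r $ s else if r = s then 1 else 0)"
  define M2 :: "'a^'m^'m" where "M2 = (\<chi> r s. if r \<in> S \<or> s \<in> S then if r = s then 1 else 0 else M $ r $ s)"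
  have cross: "M $ r $ s = 0" if "(r \<in> S) \<noteq> (s \<in> S)" for r s
    using that dist by (intro supp) (auto simp: S_def)
  have "M = M1 ** M2"
  proof -
    have "(\<Sum>k\<in>UNIV. M1 $ r $ k * M2 $ k $ s) = M $ r $ s" for r s
    proof (cases "r \<in> S")
      case True
      have "(\<Sum>k\<in>UNIV. M1 $ r $ k * M2 $ k $ s) = (\<Sum>k\<in>UNIV. if k = s then M $ r $ s else 0)"
        using True cross[of r s] by (intro sum.cong) (auto simp: M1_def M2_def)
      then show ?thesis by simp
    next
      case False
      have "(\<Sum>k\<in>UNIV. M1 $ r $ k * M2 $ k $ s) = (\<Sum>k\<in>UNIV. if k = r then M $ r $ s else 0)"
        using False cross[of r s] by (intro sum.cong) (auto simp: M1_def M2_def)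
      then show ?thesis by simp
    qed
    then show ?thesis by (simp add: matrix_matrix_mult_def vec_eq_iff)
  qed
  then have "det M = det M1 * det M2" by (simp add: det_mul)
  moreover have "det M1 = M $ p $ p * M $ q $ q - M $ p $ q * M $ q $ p"
  proof -
    have "det M1 = (M1 $ p $ p * M1 $ q $ q - M1 $ p $ q * M1 $ q $ p) * (\<Prod>r\<in>UNIV - {p, q}. M1 $ r $ r)"
      using dist by (intro det_pair) (auto simp: M1_def S_def)
    also have "(\<Prod>r\<in>UNIV - {p, q}. M1 $ r $ r) = 1"
      by (intro prod.neutral) (auto simp: M1_def S_def)
    finally show ?thesis by (simp add: M1_def S_def)
  qed
  moreover have "det M2 = (M $ p' $ p' * M $ q' $ q' - M $ p' $ q' * M $ q' $ p') *
      (\<Prod>r\<in>UNIV - {p, q, p', q'}. M $ r $ r)"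
  proof -
    have M2: "M2 $ r $ s = M $ r $ s" if "r \<in> {p', q'}" "s \<in> {p', q'}" for r s
      using that dist by (auto simp: M2_def S_def)
    have "det M2 = (M2 $ p' $ p' * M2 $ q' $ q' - M2 $ p' $ q' * M2 $ q' $ p') * (\<Prod>r\<in>UNIV - {p', q'}. M2 $ r $ r)"
      using dist supp by (intro det_pair) (auto simp: M2_def S_def)
    also have "(\<Prod>r\<in>UNIV - {p', q'}. M2 $ r $ r) = (\<Prod>r\<in>UNIV - {p, q, p', q'}. M $ r $ r)"
      by (intro prod.mono_neutral_cong_right) (auto simp: M2_def S_def)
    finally show ?thesis by (simp add: M2)
  qed
  ultimately show ?thesis by (simp only: mult.assoc)
qed

text \<open>Every \<open>b m\<close> is a zero of the common polynomial and hence some value of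
  \<open>a\<close>. As the \<open>b m\<close> are distinct, choosing such an index is injective, and
  by finiteness bijective.\<close>

lemma prod_linear_factors_eq_iff:
  fixes a b :: "'n::finite \<Rightarrow> real"
  assumes b: "inj b"
  shows "(\<forall>z::complex. (\<Prod>k\<in>UNIV. z - of_real (a k)) = (\<Prod>k\<in>UNIV. z - of_real (b k))) \<longleftrightarrow>
    (\<exists>\<sigma>. bij \<sigma> \<and> (\<forall>k. a k = b (\<sigma> k)))"
proof
  assume eq: "\<forall>z::complex. (\<Prod>k\<in>UNIV. z - of_real (a k)) = (\<Prod>k\<in>UNIV. z - of_real (b k))"
  have "\<exists>k. a k = b m" for m
  proof -
    have "(\<Prod>k\<in>UNIV. complex_of_real (b m) - of_real (b k)) = 0" by (intro prod_zero) auto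
    then have "(\<Prod>k\<in>UNIV. complex_of_real (b m) - of_real (a k)) = 0" using eq by simp
    then obtain k where "complex_of_real (b m) = of_real (a k)" by (auto simp: prod_zero_iff)
    then show ?thesis by (metis of_real_eq_iff)
  qed
  then obtain g where g: "\<And>m. a (g m) = b m" by metis
  then have "inj g" using b by (metis injI injD)
  then have bij: "bij g" by (simp add: finite_UNIV_inj_surj bij_def)
  have "a k = b (inv g k)" for k using g[of "inv g k"] bij by (simp add: bij_is_surj surj_f_inv_f)
  then show "\<exists>\<sigma>. bij \<sigma> \<and> (\<forall>k. a k = b (\<sigma> k))" using bij bij_imp_bij_inv by blast
next
  assume "\<exists>\<sigma>. bij \<sigma> \<and> (\<forall>k. a k = b (\<sigma> k))"
  then obtain \<sigma> where \<sigma>: "bij \<sigma>" "\<And>k. a k = b (\<sigma> k)" by blast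
  show "\<forall>z::complex. (\<Prod>k\<in>UNIV. z - of_real (a k)) = (\<Prod>k\<in>UNIV. z - of_real (b k))"
  proof
    fix z :: complex
    show "(\<Prod>k\<in>UNIV. z - of_real (a k)) = (\<Prod>k\<in>UNIV. z - of_real (b k))"
      unfolding \<sigma>(2) using prod.reindex_bij_betw[OF \<sigma>(1), of "\<lambda>k. z - of_real (b k)"] .
  qed
qed

text \<open>Selecting the ordered pair as a function of the unordered edge makes it impossible that
  both orientations are selected. This supplies the asymmetric root set of the locale.\<close>

lemma simple_graph_orientation:
  assumes "simple_graph E"
  obtains R where "\<And>i j. (i, j) \<in> R \<Longrightarrow> i \<noteq> j \<and> {i, j} \<in> E \<and> (j, i) \<notin> R"
    "\<And>i j. \<lbrakk>i \<noteq> j; {i, j} \<in> E\<rbrakk> \<Longrightarrow> (i, j) \<in> R \<or> (j, i) \<in> R"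
proof -
  define pick where "pick e = (SOME p. e = {fst p, snd p})" for e :: "'a set"
  have pick: "pick {i, j} = (i, j) \<or> pick {i, j} = (j, i)" for i j
  proof -
    have "{i, j} = {fst (pick {i, j}), snd (pick {i, j})}"
      unfolding pick_def by (rule someI[of "\<lambda>p. {i, j} = {fst p, snd p}" "(i, j)"]) simp
    then show ?thesis by (cases "pick {i, j}") (auto simp: doubleton_eq_iff)
  qed
  define R where "R = {(i, j). {i, j} \<in> E \<and> pick {i, j} = (i, j)}"
  have "i \<noteq> j" if "{i, j} \<in> E" for i j
    using that assms by (auto simp: simple_graph_def)
  then have 1: "i \<noteq> j \<and> {i, j} \<in> E \<and> (j, i) \<notin> R" if "(i, j) \<in> R" for i j
    using that by (auto simp: R_def insert_commute)
  have 2: "(i, j) \<in> R \<or> (j, i) \<in> R" if "{i, j} \<in> E" for i j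
    using that pick[of i j] by (auto simp: R_def insert_commute)
  show ?thesis by (rule that[OF 1 2])
qed

lemma torus_char_root:
  assumes "i \<noteq> j" "t \<in> torus"
  shows "torus_char (root_weight (i, j, b)) t = t $ i * (if b = 0 then cnj (t $ j) else t $ j)"
proof -
  have cnj: "inverse (t $ k) = cnj (t $ k)" for k
    using assms(2) by (simp add: torus_def inverse_complex_def complex_eq_iff cmod_def)
  have other: "(t $ k) powi (root_weight (i, j, b) $ k) = 1" if "k \<in> UNIV - {i, j}" for k
    using that by (simp add: root_weight_def eps_def axis_def)
  have "(t $ j) powi (root_weight (i, j, b) $ j) = (if b = 0 then cnj (t $ j) else t $ j)"
    using assms(1) by (auto simp: root_weight_def eps_def axis_def bit_sign_def power_int_minus cnj)
      (simp add: complex_cnj_inverse[symmetric] cnj[symmetric])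
  moreover have "(t $ i) powi (root_weight (i, j, b) $ i) = t $ i"
    using assms(1) by (simp add: root_weight_def eps_def axis_def)
  ultimately show ?thesis
    unfolding torus_char_def prod_UNIV_remove2[OF assms(1)] using other by simp
qed

text \<open>The difference of the squares of sum and difference is four times the product. This
  turns the relation into the determinant of the coupled matrix, the form in which it enters
  characteristic polynomials.\<close>

lemma root_rel_product:
  assumes "root_rel (i, j, b) d0 d c"
  shows "bit_sign b * (d0 $ i * d0 $ j) = bit_sign b * (d $ i * d $ j) - (cmod c)\<^sup>2"
proof -
  have "(d0 $ i + bit_sign b * d0 $ j)\<^sup>2 = (d $ i + bit_sign b * d $ j)\<^sup>2"
    "(d0 $ i - bit_sign b * d0 $ j)\<^sup>2 = (d $ i - bit_sign b * d $ j)\<^sup>2 + 4 * (cmod c)\<^sup>2"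
    using assms by (simp_all add: root_rel_def root_val_def)
  moreover have id: "(x + bit_sign b * y)\<^sup>2 - (x - bit_sign b * y)\<^sup>2 = 4 * (bit_sign b * (x * y))" for x y :: real
    by (simp add: power2_eq_square algebra_simps)
  ultimately show ?thesis using id[of "d0 $ i" "d0 $ j"] id[of "d $ i" "d $ j"] by linarith
qed

section \<open>Hermitian matrices\<close>

definition herm_diag :: "real^'n \<Rightarrow> complex^'n^'n" where
  "herm_diag d = (\<chi> k m. if k = m then of_real (d $ k) else 0)"

definition herm_root :: "'n \<times> 'n \<times> bit \<Rightarrow> complex \<Rightarrow> complex^'n^'n" where
  "herm_root = (\<lambda>(i, j, b) c. \<chi> k m. if k = i \<and> m = j then c else if k = j \<and> m = i then cnj c else 0)"

definition herm_diag_part :: "complex^'n^'n \<Rightarrow> real^'n" where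
  "herm_diag_part A = (\<chi> k. Re (A $ k $ k))"

definition herm_coeff :: "'n \<times> 'n \<times> bit \<Rightarrow> complex^'n^'n \<Rightarrow> complex" where
  "herm_coeff = (\<lambda>(i, j, b) A. A $ i $ j)"

definition perm_spectra :: "('n::finite \<Rightarrow> real) \<Rightarrow> (real^'n) set" where
  "perm_spectra l = {\<chi> k. l (\<sigma> k) | \<sigma>. bij \<sigma>}"

lemma torus_inverse_cnj: "t \<in> torus \<Longrightarrow> t $ k * cnj (t $ k) = 1"
  by (simp add: torus_def complex_norm_square[symmetric])

lemma herm_act_nth:
  assumes "t \<in> torus"
  shows "herm_act t A $ k $ m = t $ k * A $ k $ m * cnj (t $ m)"
proof -
  have inv: "matrix_inv (diag_matrix (($) t)) = diag_matrix (\<lambda>k. cnj (t $ k))"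
    by (rule matrix_inv_eqI)
      (simp_all add: vec_eq_iff diag_matrix_def diag_mult_left mat_def torus_inverse_cnj[OF assms] mult.commute)
  show ?thesis
    unfolding herm_act_def inv by (simp add: diag_matrix_def diag_mult_left diag_mult_right)
qed

lemma det_herm_act:
  assumes "t \<in> torus"
  shows "det (mat z - herm_act t A) = det (mat z - A)"
proof -
  have "diag_matrix (($) t) ** diag_matrix (\<lambda>k. cnj (t $ k)) = mat 1"
    "diag_matrix (\<lambda>k. cnj (t $ k)) ** diag_matrix (($) t) = mat 1"
    by (simp_all add: vec_eq_iff diag_matrix_def diag_mult_left mat_def torus_inverse_cnj[OF assms] mult.commute)
  then show ?thesis unfolding herm_act_def by (simp add: matrix_inv_eqI det_mat_minus_conjugate)
qed

lemma linear_torus_action_herm: "linear_torus_action (herm_act :: complex^'n \<Rightarrow> complex^'n^'n \<Rightarrow> _)"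
  unfolding linear_torus_action_def
proof (intro conjI ballI)
  fix s t :: "complex^'n" assume st: "s \<in> torus" "t \<in> torus"
  show "linear (herm_act t)"
    by (rule linearI) (simp_all add: vec_eq_iff herm_act_nth[OF st(2)] algebra_simps)
  have "s * t \<in> torus" using st by (simp add: torus_def norm_mult)
  then show "herm_act (s * t) = herm_act s \<circ> herm_act t"
    by (simp add: fun_eq_iff vec_eq_iff herm_act_nth st mult_ac)
next
  have "(1 :: complex^'n) \<in> torus" by (simp add: torus_def)
  then show "herm_act (1 :: complex^'n) = id" by (simp add: fun_eq_iff vec_eq_iff herm_act_nth)
next
  \<comment> \<open>On the torus the inverse is the complex conjugate, so the action is given by an
    expression without inverses that is visibly continuous.\<close>
  have "continuous_on (torus \<times> UNIV)
      (\<lambda>p :: (complex^'n) \<times> (complex^'n^'n). \<chi> k m. fst p $ k * snd p $ k $ m * cnj (fst p $ m))"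
    by (intro continuous_intros)
  then show "continuous_on (torus \<times> UNIV) (\<lambda>(t :: complex^'n, A). herm_act t A)"
    by (rule continuous_on_eq) (auto simp: vec_eq_iff herm_act_nth)
qed

lemma herm_isospectral_iff:
  "A \<in> herm_isospectral E l \<longleftrightarrow>
    A \<in> herm_space E \<and> (\<forall>z. det (mat z - A) = (\<Prod>k\<in>UNIV. z - of_real (l k)))"
  by (simp add: herm_isospectral_def has_eigenvalues_def image_mset.compositionality o_def
      prod_unfold_prod_mset)

lemma herm_act_herm_space: "t \<in> torus \<Longrightarrow> A \<in> herm_space E \<Longrightarrow> herm_act t A \<in> herm_space E"
proof -
  assume t: "t \<in> torus" and A: "A \<in> herm_space E"
  have "herm_act t A $ i $ j = cnj (herm_act t A $ j $ i)" for i j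
  proof -
    have sym: "A $ i $ j = cnj (A $ j $ i)" using A unfolding herm_space_def by blast
    show ?thesis unfolding herm_act_nth[OF t] sym by (simp add: mult_ac)
  qed
  moreover have "herm_act t A $ i $ j = 0" if "i \<noteq> j" "{i, j} \<notin> E" for i j
  proof -
    have "A $ i $ j = 0" using A that unfolding herm_space_def by blast
    then show ?thesis by (simp add: herm_act_nth[OF t])
  qed
  ultimately show "herm_act t A \<in> herm_space E" unfolding herm_space_def by blast
qed

lemma torus_invariant_herm: "torus_invariant herm_act (herm_isospectral E l)"
proof -
  have "herm_act t A \<in> herm_isospectral E l" if "t \<in> torus" "A \<in> herm_isospectral E l" for t A
    using that(2) unfolding herm_isospectral_iff det_herm_act[OF that(1)]
    using herm_act_herm_space[OF that(1)] by blast
  then show ?thesis unfolding torus_invariant_def by blast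
qed

lemma herm_entry_simps:
  "herm_diag d $ k $ m = (if k = m then of_real (d $ k) else 0)"
  "herm_root (i, j, b) c $ k $ m = (if k = i \<and> m = j then c else if k = j \<and> m = i then cnj c else 0)"
  "herm_coeff (i, j, b) A = A $ i $ j"
  by (simp_all add: herm_diag_def herm_root_def herm_coeff_def)

text \<open>One off-diagonal pair splits a quadratic factor off the determinant. Its zeros are
  \<open>d0 $ i\<close> and \<open>d0 $ j\<close>, because the relation fixes their sum and, by
  \<open>root_rel_product\<close>, their product.\<close>

lemma det_herm_root:
  assumes ij: "i \<noteq> j" and rel: "root_rel (i, j, 0) d0 d c"
  shows "det (mat z - (herm_diag d + herm_root (i, j, 0) c)) = (\<Prod>k\<in>UNIV. z - of_real (d0 $ k))"
proof -
  let ?M = "mat z - (herm_diag d + herm_root (i, j, 0) c)"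
  have diag: "?M $ k $ k = z - of_real (d $ k)" for k
    using ij by (auto simp: mat_def herm_entry_simps)
  have off: "?M $ i $ j = - c" "?M $ j $ i = - cnj c"
    using ij by (auto simp: mat_def herm_entry_simps)
  have "det ?M = (?M $ i $ i * ?M $ j $ j - ?M $ i $ j * ?M $ j $ i) * (\<Prod>r\<in>UNIV - {i, j}. ?M $ r $ r)"
    using ij by (intro det_pair) (auto simp: mat_def herm_entry_simps)
  also have "\<dots> = ((z - of_real (d $ i)) * (z - of_real (d $ j)) - c * cnj c) *
      (\<Prod>r\<in>UNIV - {i, j}. z - of_real (d $ r))"
    unfolding off diag by simp
  also have "(z - of_real (d $ i)) * (z - of_real (d $ j)) - c * cnj c
      = (z - of_real (d0 $ i)) * (z - of_real (d0 $ j))"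
  proof -
    have "d0 $ i + d0 $ j = d $ i + d $ j" "d0 $ i * d0 $ j = d $ i * d $ j - (cmod c)\<^sup>2"
      using rel root_rel_product[OF rel] by (simp_all add: root_rel_def bit_sign_def)
    then have "complex_of_real (d0 $ i) + of_real (d0 $ j) = of_real (d $ i) + of_real (d $ j)"
      "complex_of_real (d0 $ i) * of_real (d0 $ j) = of_real (d $ i) * of_real (d $ j) - c * cnj c"
      by (simp_all add: complex_norm_square[symmetric] flip: of_real_add of_real_mult of_real_diff of_real_power)
    then show ?thesis by algebra
  qed
  also have "(\<Prod>r\<in>UNIV - {i, j}. z - of_real (d $ r)) = (\<Prod>r\<in>UNIV - {i, j}. z - complex_of_real (d0 $ r))"
    using rel by (intro prod.cong) (auto simp: root_rel_def)
  finally show ?thesis by (simp add: prod_UNIV_remove2[OF ij])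
qed

lemma det_herm_diag: "det (mat z - herm_diag d) = (\<Prod>k\<in>UNIV. z - of_real (d $ k))"
  by (subst det_diagonal) (auto simp: mat_def herm_entry_simps)

lemma perm_spectra_iff:
  assumes "inj l"
  shows "(\<forall>z::complex. (\<Prod>k\<in>UNIV. z - of_real (d $ k)) = (\<Prod>k\<in>UNIV. z - of_real (l k))) \<longleftrightarrow> d \<in> perm_spectra l"
  using prod_linear_factors_eq_iff[OF assms, of "($) d"] by (auto simp: perm_spectra_def vec_eq_iff)

lemma herm_diag_in_space: "herm_diag d \<in> herm_space E"
  by (auto simp: herm_space_def herm_entry_simps)

lemma herm_root_in_space:
  assumes "i \<noteq> j" "{i, j} \<in> E"
  shows "herm_root (i, j, b) c \<in> herm_space E"
proof -
  have "herm_root (i, j, b) c $ k $ m = cnj (herm_root (i, j, b) c $ m $ k)" for k m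
    unfolding herm_entry_simps using assms(1) by simp
  moreover have "herm_root (i, j, b) c $ k $ m = 0" if "{k, m} \<notin> E" for k m
  proof -
    have "\<not> (k = i \<and> m = j)" "\<not> (k = j \<and> m = i)" using that assms(2) by (auto simp: insert_commute)
    then show ?thesis unfolding herm_entry_simps by auto
  qed
  ultimately show ?thesis unfolding herm_space_def by blast
qed

lemma subspace_herm_space: "subspace (herm_space E)"
proof (rule subspaceI)
  show "0 \<in> herm_space E" by (simp add: herm_space_def)
next
  fix A B assume "A \<in> herm_space E" "B \<in> herm_space E"
  then have AB: "A $ i $ j = cnj (A $ j $ i)" "B $ i $ j = cnj (B $ j $ i)"
    "i \<noteq> j \<and> {i, j} \<notin> E \<longrightarrow> A $ i $ j = 0 \<and> B $ i $ j = 0" for i j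
    unfolding herm_space_def by blast+
  have "(A + B) $ i $ j = cnj ((A + B) $ j $ i)" for i j
    unfolding vector_add_component complex_cnj_add by (intro arg_cong2[of _ _ _ _ plus] AB)
  moreover have "i \<noteq> j \<and> {i, j} \<notin> E \<longrightarrow> (A + B) $ i $ j = 0" for i j
    using AB(3)[of i j] by simp
  ultimately show "A + B \<in> herm_space E" unfolding herm_space_def by blast
next
  fix r :: real and A assume "A \<in> herm_space E"
  then have A: "A $ i $ j = cnj (A $ j $ i)" "i \<noteq> j \<and> {i, j} \<notin> E \<longrightarrow> A $ i $ j = 0" for i j
    unfolding herm_space_def by blast+
  have "(r *\<^sub>R A) $ i $ j = cnj ((r *\<^sub>R A) $ j $ i)" for i j
    unfolding vector_scaleR_component complex_cnj_scaleR by (intro arg_cong2[of _ _ _ _ scaleR] refl A)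
  moreover have "i \<noteq> j \<and> {i, j} \<notin> E \<longrightarrow> (r *\<^sub>R A) $ i $ j = 0" for i j
    using A(2)[of i j] by simp
  ultimately show "r *\<^sub>R A \<in> herm_space E" unfolding herm_space_def by blast
qed

lemma finite_perm_spectra: "finite (perm_spectra l)"
proof -
  have "perm_spectra l = (\<lambda>\<sigma>. \<chi> k. l (\<sigma> k)) ` {\<sigma>. bij \<sigma>}" by (auto simp: perm_spectra_def)
  then show ?thesis by simp
qed

lemma linear_herm_root: "linear (herm_root \<alpha>)"
proof (cases \<alpha>)
  case (fields i j b)
  \<comment> \<open>The conditions are abstracted because \<open>i = j \<and> j = i\<close> would make the simplifier loop.\<close>
  have "(if P then x + y else if Q then cnj (x + y) else 0) =
      (if P then x else if Q then cnj x else 0) + (if P then y else if Q then cnj y else 0)"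
    "(if P then r *\<^sub>R x else if Q then cnj (r *\<^sub>R x) else 0) = r *\<^sub>R (if P then x else if Q then cnj x else 0)"
    for P Q and x y :: complex and r :: real
    by simp_all
  note cases = this
  have "herm_root (i, j, b) (x + y) $ k $ m = (herm_root (i, j, b) x + herm_root (i, j, b) y) $ k $ m"
    for x y k m
    unfolding vector_add_component herm_entry_simps by (rule cases)
  moreover have "herm_root (i, j, b) (r *\<^sub>R x) $ k $ m = (r *\<^sub>R herm_root (i, j, b) x) $ k $ m" for x r k m
    unfolding vector_scaleR_component herm_entry_simps by (rule cases)
  ultimately
  show ?thesis unfolding fields by (intro linearI vec_eq_iff[THEN iffD2] allI)
qed

lemma root_torus_manifold_herm:
  fixes E :: "'n::finite set set"
  assumes R: "\<And>i j. (i, j) \<in> R \<Longrightarrow> i \<noteq> j \<and> {i, j} \<in> E \<and> (j, i) \<notin> R"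
    "\<And>i j. \<lbrakk>i \<noteq> j; {i, j} \<in> E\<rbrakk> \<Longrightarrow> (i, j) \<in> R \<or> (j, i) \<in> R"
    and gen: "generic_spectrum E l"
  shows "root_torus_manifold herm_act (herm_isospectral E l) (herm_space E)
    {(i, j, 0) | i j. (i, j) \<in> R} (perm_spectra l) herm_diag herm_root herm_diag_part herm_coeff"
proof -
  have injl: "inj l" using gen by (auto simp: generic_spectrum_def inj_def)
  let ?I = "{(i, j, 0) | i j. (i, j) \<in> R} :: ('n \<times> 'n \<times> bit) set"
  have I: "\<exists>i j. \<alpha> = (i, j, 0) \<and> (i, j) \<in> R \<and> i \<noteq> j \<and> {i, j} \<in> E \<and> (j, i) \<notin> R" if as: "\<alpha> \<in> ?I" for \<alpha>
    using as R(1) by blast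
  show ?thesis
  proof (rule root_torus_manifold.intro)
    show "torus_manifold herm_act (herm_isospectral E l)"
      using gen by (simp add: torus_manifold_def linear_torus_action_herm torus_invariant_herm generic_spectrum_def)
    show "subspace (herm_space E)" by (rule subspace_herm_space)
    show "herm_isospectral E l \<subseteq> herm_space E" by (auto simp: herm_isospectral_def)
    show "linear (herm_diag :: real^'n \<Rightarrow> _)"
      by (rule linearI) (auto simp: vec_eq_iff herm_entry_simps complex_eq_iff)
    show "linear (herm_root \<alpha>)" for \<alpha> :: "'n \<times> 'n \<times> bit"
      by (rule linear_herm_root)
    show "linear (herm_diag_part :: complex^'n^'n \<Rightarrow> _)"
      by (rule linearI) (auto simp: vec_eq_iff herm_diag_part_def)
    show "linear (herm_coeff \<alpha>)" for \<alpha> :: "'n \<times> 'n \<times> bit"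
      by (cases \<alpha>, rule linearI) (auto simp: herm_entry_simps)
    show "herm_diag d \<in> herm_space E" for d by (rule herm_diag_in_space)
    show "herm_root \<alpha> c \<in> herm_space E" if as: "\<alpha> \<in> ?I" for \<alpha> c
      using I[OF as] herm_root_in_space by blast
    show "herm_diag_part (herm_diag d) = d" for d :: "real^'n"
      by (simp add: vec_eq_iff herm_diag_part_def herm_entry_simps)
    show "herm_diag_part (herm_root \<alpha> c) = 0" if as: "\<alpha> \<in> ?I" for \<alpha> c
      using I[OF as] by (auto simp: vec_eq_iff herm_diag_part_def herm_entry_simps)
    show "herm_coeff \<alpha> (herm_diag d) = 0" if as: "\<alpha> \<in> ?I" for \<alpha> d
      using I[OF as] by (auto simp: herm_entry_simps)
    show "herm_coeff \<beta> (herm_root \<alpha> c) = (if \<beta> = \<alpha> then c else 0)" if as: "\<alpha> \<in> ?I" "\<beta> \<in> ?I" for \<alpha> \<beta> c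
    proof -
      obtain i j where \<alpha>: "\<alpha> = (i, j, 0)" "(j, i) \<notin> R" using I[OF as(1)] by blast
      obtain i' j' where \<beta>: "\<beta> = (i', j', 0)" "(i', j') \<in> R" using I[OF as(2)] by blast
      \<comment> \<open>Without this the coefficient could read the conjugate entry that
        \<open>herm_root\<close> writes at the transposed place.\<close>
      have "\<not> (i' = j \<and> j' = i)" using \<alpha>(2) \<beta>(2) by auto
      then show ?thesis unfolding \<alpha>(1) \<beta>(1) herm_entry_simps by auto
    qed
    show "x = 0" if x: "x \<in> herm_space E" "herm_diag_part x = 0" "\<And>\<alpha>. \<alpha> \<in> ?I \<Longrightarrow> herm_coeff \<alpha> x = 0" for x
    proof -
      have sym: "x $ k $ m = cnj (x $ m $ k)" for k m using x(1) unfolding herm_space_def by blast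
      have R0: "x $ k $ m = 0" if as: "(k, m) \<in> R" for k m
        using x(3)[of "(k, m, 0)"] as by (simp add: herm_entry_simps)
      have "x $ k $ m = 0" for k m
      proof (cases "k = m")
        case True
        have "Re (x $ k $ k) = 0" using x(2) by (simp add: vec_eq_iff herm_diag_part_def)
        moreover have "Im (x $ k $ k) = 0" using arg_cong[OF sym[of k k], of Im] by simp
        ultimately show ?thesis using True by (simp add: complex_eq_iff)
      next
        case km: False
        show ?thesis
        proof (cases "{k, m} \<in> E")
          case True
          \<comment> \<open>Only one orientation of the edge is a coordinate; symmetry carries the
            vanishing to the other entry.\<close>
          then have "x $ k $ m = 0 \<or> x $ m $ k = 0" using R(2)[OF km True] R0 by auto
          then show ?thesis
          proof
            assume "x $ m $ k = 0"
            then show ?thesis by (subst sym) simp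
          qed
        next
          case False
          then show ?thesis using x(1) km unfolding herm_space_def by blast
        qed
      qed
      then show ?thesis by (simp add: vec_eq_iff)
    qed
    show "herm_act t (herm_diag d) = herm_diag d" if as: "t \<in> torus" for t and d :: "real^'n"
    proof -
      have "t $ k * x * cnj (t $ k) = t $ k * cnj (t $ k) * x" for k x by (simp only: mult_ac)
      then have "t $ k * x * cnj (t $ k) = x" for k x by (simp only: torus_inverse_cnj[OF as] mult_1_left)
      then show ?thesis
        by (simp add: vec_eq_iff herm_act_nth[OF as] herm_entry_simps torus_inverse_cnj[OF as])
    qed
    show "herm_act t (herm_root \<alpha> c) = herm_root \<alpha> (torus_char (root_weight \<alpha>) t * c)"
      if as: "t \<in> torus" "\<alpha> \<in> ?I" for t \<alpha> c
    proof -
      obtain i j where \<alpha>: "\<alpha> = (i, j, 0)" "i \<noteq> j" using I[OF as(2)] by blast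
      show ?thesis
        unfolding \<alpha>(1) torus_char_root[OF \<alpha>(2) as(1)]
        by (simp add: vec_eq_iff herm_act_nth[OF as(1)] herm_entry_simps)
    qed
    show "i \<noteq> j" if as: "(i, j, b) \<in> ?I" for i j b using I[OF as] by blast
    show "(j, i, b') \<notin> ?I" if as: "(i, j, b) \<in> ?I" for i j b b' using I[OF as] by blast
    show "finite (perm_spectra l)" by (rule finite_perm_spectra)
    show "herm_diag d \<in> herm_isospectral E l \<longleftrightarrow> d \<in> perm_spectra l" for d
      by (simp only: herm_isospectral_iff herm_diag_in_space det_herm_diag perm_spectra_iff[OF injl] simp_thms)
    show "herm_diag d + herm_root \<alpha> c \<in> herm_isospectral E l \<longleftrightarrow> d0 \<in> perm_spectra l"
      if as: "\<alpha> \<in> ?I" "root_rel \<alpha> d0 d c" for \<alpha> d0 d c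
    proof -
      obtain i j where \<alpha>: "\<alpha> = (i, j, 0)" "i \<noteq> j" "{i, j} \<in> E" using I[OF as(1)] by blast
      have "herm_diag d + herm_root \<alpha> c \<in> herm_space E"
        unfolding \<alpha>(1) by (intro subspace_add subspace_herm_space herm_diag_in_space herm_root_in_space \<alpha>(2,3))
      then show ?thesis
        using as(2) unfolding \<alpha>(1)
        by (simp only: herm_isospectral_iff det_herm_root[OF \<alpha>(2)] perm_spectra_iff[OF injl] simp_thms)
    qed
    show "root_val \<alpha> d \<noteq> 0" if as: "\<alpha> \<in> ?I" "d \<in> perm_spectra l" for \<alpha> d
    proof -
      obtain i j where \<alpha>: "\<alpha> = (i, j, 0)" "i \<noteq> j" using I[OF as(1)] by blast
      obtain \<sigma> where \<sigma>: "bij \<sigma>" "d = (\<chi> k. l (\<sigma> k))" using as(2) by (auto simp: perm_spectra_def)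
      have "\<sigma> i \<noteq> \<sigma> j" using \<sigma>(1) \<alpha>(2) by (simp add: bij_is_inj inj_eq)
      then have "l (\<sigma> i) \<noteq> l (\<sigma> j)" using injl by (simp add: inj_eq)
      then show ?thesis by (simp add: \<alpha>(1) \<sigma>(2) root_val_def bit_sign_def)
    qed
  qed
qed

section \<open>Skew-symmetric matrices\<close>

subsection \<open>Matrices of \<open>2 \<times> 2\<close> blocks\<close>

text \<open>The same construction as \<open>block_diag\<close>, over any commutative ring, because
  the change to the eigenbasis uses complex block-diagonal matrices.\<close>

definition bdiag :: "('n::finite \<Rightarrow> 'a::comm_ring_1^2^2) \<Rightarrow> 'a^('n \<times> 2)^('n \<times> 2)" where
  "bdiag B = (\<chi> p q. if fst p = fst q then B (fst p) $ snd p $ snd q else 0)"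

definition block :: "'a^('n \<times> 2)^('n \<times> 2) \<Rightarrow> 'n::finite \<Rightarrow> 'n \<Rightarrow> 'a^2^2" where
  "block A k m = (\<chi> a b. A $ (k, a) $ (m, b))"

lemma block_diag_eq_bdiag: "block_diag = bdiag"
  by (simp add: fun_eq_iff block_diag_def bdiag_def)

lemma block_nth: "block A k m $ a $ b = A $ (k, a) $ (m, b)"
  by (simp add: block_def)

lemma block_eqI: "(\<And>k m. block A k m = block B k m) \<Longrightarrow> A = B"
proof -
  assume e: "\<And>k m. block A k m = block B k m"
  have "A $ p $ q = B $ p $ q" for p q
    using arg_cong[OF e[of "fst p" "fst q"], of "\<lambda>M. M $ snd p $ snd q"] by (simp add: block_nth)
  then show "A = B" by (simp add: vec_eq_iff)
qed

lemma sum_UNIV_prod: "(\<Sum>r\<in>UNIV. f r) = (\<Sum>x\<in>UNIV. \<Sum>y\<in>UNIV. f (x, y))"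
  for f :: "'a::finite \<times> 'b::finite \<Rightarrow> 'c::comm_monoid_add"
  by (simp add: sum.cartesian_product)

lemma block_bdiag: "block (bdiag B) k m = (if k = m then B k else 0)"
  by (simp add: vec_eq_iff block_nth bdiag_def)

lemma block_bdiag_mult: "block (bdiag B ** A) k m = B k ** block A k m"
proof -
  have "(\<Sum>x\<in>UNIV. \<Sum>y\<in>UNIV. bdiag B $ (k, a) $ (x, y) * A $ (x, y) $ (m, b)) =
      (\<Sum>x\<in>UNIV. if k = x then \<Sum>y\<in>UNIV. B k $ a $ y * A $ (k, y) $ (m, b) else 0)" for a b
    by (intro sum.cong refl) (simp add: bdiag_def)
  then show ?thesis
    by (simp add: vec_eq_iff block_nth matrix_matrix_mult_def sum_UNIV_prod)
qed

lemma block_mult_bdiag: "block (A ** bdiag B) k m = block A k m ** B m"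
proof -
  have "(\<Sum>x\<in>UNIV. \<Sum>y\<in>UNIV. A $ (k, a) $ (x, y) * bdiag B $ (x, y) $ (m, b)) =
      (\<Sum>x\<in>UNIV. if m = x then \<Sum>y\<in>UNIV. A $ (k, a) $ (m, y) * B m $ y $ b else 0)" for a b
    by (intro sum.cong refl) (auto simp: bdiag_def)
  then show ?thesis
    by (simp add: vec_eq_iff block_nth matrix_matrix_mult_def sum_UNIV_prod)
qed

lemma matrix_mult_0: "A ** (0 :: 'a::comm_ring_1^'m^'n) = 0" "(0 :: 'a::comm_ring_1^'n^'m) ** B = 0"
  by (simp_all add: vec_eq_iff matrix_matrix_mult_def)

lemma bdiag_mult: "bdiag B ** bdiag C = bdiag (\<lambda>k. B k ** C k)"
  by (rule block_eqI) (simp add: block_bdiag_mult block_bdiag matrix_mult_0)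

lemma bdiag_mat: "bdiag (\<lambda>_. mat z) = mat z"
  by (auto simp: vec_eq_iff bdiag_def mat_def)

lemma block_add: "block (A + B) k m = block A k m + block B k m"
  by (simp add: vec_eq_iff block_nth)

lemma block_scaleR: "block (r *\<^sub>R A) k m = r *\<^sub>R block A k m"
  by (simp add: vec_eq_iff block_nth)

lemmas mat2_simps = vec_eq_iff forall_2 matrix_matrix_mult_def sum_2

lemma rotation_block_mult: "rotation_block u ** rotation_block v = rotation_block (u * v)"
  by (simp add: mat2_simps rotation_block_def algebra_simps)

lemma rotation_block_1: "rotation_block 1 = mat 1"
  by (simp add: mat2_simps rotation_block_def mat_def)

lemma bdiag_rotation_inverse:
  assumes "t \<in> torus"
  shows "bdiag (\<lambda>k. rotation_block (t $ k)) ** bdiag (\<lambda>k. rotation_block (cnj (t $ k))) = mat 1"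
    "bdiag (\<lambda>k. rotation_block (cnj (t $ k))) ** bdiag (\<lambda>k. rotation_block (t $ k)) = mat 1"
  using torus_inverse_cnj[OF assms]
  by (simp_all add: bdiag_mult rotation_block_mult rotation_block_1 bdiag_mat mult.commute)

lemma skew_act_eq:
  assumes "t \<in> torus"
  shows "skew_act t A = bdiag (\<lambda>k. rotation_block (t $ k)) ** A ** bdiag (\<lambda>k. rotation_block (cnj (t $ k)))"
  unfolding skew_act_def block_diag_eq_bdiag matrix_inv_eqI[OF bdiag_rotation_inverse[OF assms]] ..

lemma block_skew_act:
  "t \<in> torus \<Longrightarrow> block (skew_act t A) k m = rotation_block (t $ k) ** block A k m ** rotation_block (cnj (t $ m))"
  by (simp add: skew_act_eq block_bdiag_mult block_mult_bdiag)

lemma continuous_on_rotation_block: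
  assumes "continuous_on S f"
  shows "continuous_on S (\<lambda>x. rotation_block (f x) $ a $ c)"
  using exhaust_2[of a] exhaust_2[of c] assms
  by (elim disjE) (simp_all add: rotation_block_def continuous_intros)

lemma linear_torus_action_skew: "linear_torus_action (skew_act :: complex^'n::finite \<Rightarrow> _)"
  unfolding linear_torus_action_def
proof (intro conjI ballI)
  fix s t :: "complex^'n" assume st: "s \<in> torus" "t \<in> torus"
  show "linear (skew_act t)"
  proof (rule linearI; rule block_eqI)
    show "block (skew_act t (A + B)) k m = block (skew_act t A + skew_act t B) k m" for A B k m
      unfolding block_add block_skew_act[OF st(2)] by (simp add: mat2_simps algebra_simps)
    show "block (skew_act t (r *\<^sub>R A)) k m = block (r *\<^sub>R skew_act t A) k m" for r A k m
      unfolding block_scaleR block_skew_act[OF st(2)] by (simp add: mat2_simps algebra_simps)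
  qed
  have mult: "s * t \<in> torus" using st by (simp add: torus_def norm_mult)
  have "block (skew_act (s * t) A) k m = block (skew_act s (skew_act t A)) k m" for A k m
  proof -
    have "rotation_block (cnj (t $ m)) ** rotation_block (cnj (s $ m)) = rotation_block (cnj ((s * t) $ m))"
      by (simp add: rotation_block_mult mult.commute)
    moreover have "rotation_block (s $ k) ** rotation_block (t $ k) = rotation_block ((s * t) $ k)"
      by (simp add: rotation_block_mult)
    ultimately show ?thesis
      unfolding block_skew_act[OF mult] block_skew_act[OF st(1)] block_skew_act[OF st(2)]
      by (metis matrix_mul_assoc)
  qed
  then have "skew_act (s * t) A = skew_act s (skew_act t A)" for A by (rule block_eqI)
  then show "skew_act (s * t) = skew_act s \<circ> skew_act t" by (simp add: fun_eq_iff)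
next
  have 1: "(1 :: complex^'n) \<in> torus" by (simp add: torus_def)
  have "block (skew_act 1 A) k m = block A k m" for A :: "real^('n \<times> 2)^('n \<times> 2)" and k m
    unfolding block_skew_act[OF 1] by (simp add: rotation_block_1)
  then have "skew_act 1 A = A" for A :: "real^('n \<times> 2)^('n \<times> 2)" by (rule block_eqI)
  then show "skew_act (1 :: complex^'n) = id" by (simp add: fun_eq_iff)
next
  \<comment> \<open>The triple product written out by entries. The conditionals test only indices,
    so they do not disturb continuity.\<close>
  let ?f = "\<lambda>p :: (complex^'n) \<times> (real^('n \<times> 2)^('n \<times> 2)). \<chi> r s. \<Sum>v\<in>UNIV. (\<Sum>u\<in>UNIV.
      (if fst r = fst u then rotation_block (fst p $ fst r) $ snd r $ snd u else 0) * snd p $ u $ v) *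
      (if fst v = fst s then rotation_block (cnj (fst p $ fst v)) $ snd v $ snd s else 0)"
  have if_cont: "continuous_on S (\<lambda>x. if P then f x else 0)" if "continuous_on S f"
    for S :: "((complex^'n) \<times> (real^('n \<times> 2)^('n \<times> 2))) set" and f :: "_ \<Rightarrow> real" and P
    using that by (cases P) simp_all
  have "continuous_on (torus \<times> UNIV) ?f"
    by (intro continuous_on_vec_lambda continuous_on_sum continuous_on_mult if_cont
        continuous_on_rotation_block continuous_intros)
  then show "continuous_on (torus \<times> UNIV) (\<lambda>(t :: complex^'n, A). skew_act t A)"
    by (rule continuous_on_eq) (auto simp: vec_eq_iff skew_act_eq matrix_matrix_mult_def bdiag_def cong: if_cong)
qed

lemma map_matrix_of_real_mult:
  "map_matrix complex_of_real (A ** B) = map_matrix of_real A ** map_matrix of_real B"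
  by (simp add: vec_eq_iff matrix_matrix_mult_def)

lemma map_matrix_of_real_mat_1: "map_matrix complex_of_real (mat 1) = mat 1"
  by (simp add: vec_eq_iff mat_def)

lemma det_skew_act:
  assumes "t \<in> torus"
  shows "det (mat z - map_matrix complex_of_real (skew_act t A)) = det (mat z - map_matrix of_real A)"
  unfolding skew_act_eq[OF assms] map_matrix_of_real_mult
  by (rule det_mat_minus_conjugate)
    (simp only: map_matrix_of_real_mult[symmetric] bdiag_rotation_inverse[OF assms] map_matrix_of_real_mat_1)

lemma skew_space_iff:
  "A \<in> skew_space E \<longleftrightarrow> (\<forall>k m. block A m k = - transpose (block A k m)) \<and>
    (\<forall>k m. k \<noteq> m \<and> {k, m} \<notin> E \<longrightarrow> block A k m = 0)"
proof -
  have "transpose A = - A \<longleftrightarrow> (\<forall>p q. A $ q $ p = - A $ p $ q)"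
    by (simp add: vec_eq_iff transpose_def)
  also have "\<dots> \<longleftrightarrow> (\<forall>k m. block A m k = - transpose (block A k m))"
    by (simp add: vec_eq_iff transpose_def block_nth split_paired_all) (metis surj_pair)
  finally show ?thesis
    unfolding skew_space_def by (simp add: vec_eq_iff block_nth)
qed

lemma transpose_rotation_block: "transpose (rotation_block u) = rotation_block (cnj u)"
  by (simp add: vec_eq_iff forall_2 transpose_def rotation_block_def)

lemma skew_act_skew_space:
  assumes "t \<in> torus" "A \<in> skew_space E"
  shows "skew_act t A \<in> skew_space E"
  unfolding skew_space_iff block_skew_act[OF assms(1)]
proof (intro conjI allI impI)
  fix k m
  have "block A m k = - transpose (block A k m)" using assms(2) unfolding skew_space_iff by blast
  moreover have "transpose (rotation_block (t $ k) ** block A k m ** rotation_block (cnj (t $ m)))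
      = rotation_block (t $ m) ** transpose (block A k m) ** rotation_block (cnj (t $ k))"
    by (simp add: matrix_transpose_mul transpose_rotation_block matrix_mul_assoc)
  moreover have "U ** (- B) ** W = - (U ** B ** W)" for U B W :: "real^2^2"
    by (simp add: mat2_simps algebra_simps)
  ultimately show "rotation_block (t $ m) ** block A m k ** rotation_block (cnj (t $ k)) =
      - transpose (rotation_block (t $ k) ** block A k m ** rotation_block (cnj (t $ m)))" by simp
next
  fix k m assume "k \<noteq> m \<and> {k, m} \<notin> E"
  then have "block A k m = 0" using assms(2) unfolding skew_space_iff by blast
  then show "rotation_block (t $ k) ** block A k m ** rotation_block (cnj (t $ m)) = 0"
    by (simp add: matrix_mult_0)
qed

text \<open>The linear factors of opposite eigenvalues multiply to a polynomial in
  \<open>z\<^sup>2\<close> that contains \<open>l k\<close> only through its square; this is where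
  the sign of each eigenvalue is lost.\<close>

lemma skew_isospectral_iff:
  "A \<in> skew_isospectral E l \<longleftrightarrow> A \<in> skew_space E \<and>
    (\<forall>z. det (mat z - map_matrix complex_of_real A) = (\<Prod>k\<in>UNIV. z\<^sup>2 + (of_real (l k))\<^sup>2))"
proof -
  have "(\<Prod>k\<in>UNIV. z - \<i> * of_real (l k)) * (\<Prod>k\<in>UNIV. z - - \<i> * of_real (l k)) =
      (\<Prod>k\<in>UNIV. z\<^sup>2 + (complex_of_real (l k))\<^sup>2)" for z
    unfolding prod.distrib[symmetric]
    by (intro prod.cong refl) (simp add: power2_eq_square algebra_simps)
  then show ?thesis
    by (simp add: skew_isospectral_def has_eigenvalues_def image_mset.compositionality o_def
        prod_unfold_prod_mset)
qed

lemma torus_invariant_skew: "torus_invariant skew_act (skew_isospectral E l)"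
proof -
  have "skew_act t A \<in> skew_isospectral E l" if "t \<in> torus" "A \<in> skew_isospectral E l" for t A
    using that(2) unfolding skew_isospectral_iff det_skew_act[OF that(1)]
    using skew_act_skew_space[OF that(1)] by blast
  then show ?thesis unfolding torus_invariant_def by blast
qed

lemma transpose_add: "transpose (A + B) = transpose A + transpose (B :: 'a::plus^'m^'n)"
  by (simp add: vec_eq_iff transpose_def)

lemma transpose_0: "transpose (0 :: 'a::zero^'m^'n) = 0"
  by (simp add: vec_eq_iff transpose_def)

lemma subspace_skew_space: "subspace (skew_space E)"
  by (auto simp: subspace_def skew_space_def transpose_scalar transpose_add transpose_0)

section \<open>Root coordinates of skew-symmetric matrices\<close>

definition rot_gen :: "real \<Rightarrow> real^2^2" where
  "rot_gen x = vector [vector [0, x], vector [- x, 0]]"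

text \<open>Multiplication by \<open>c\<close> on \<open>\<real>\<^sup>2 = \<complex>\<close> for \<open>b = 0\<close>, and complex conjugation followed by it for
  \<open>b = 1\<close>: the isotypic components of the off-diagonal blocks.\<close>

definition root_block :: "bit \<Rightarrow> complex \<Rightarrow> real^2^2" where
  "root_block b c = vector [vector [Re c, - bit_sign b * Im c], vector [Im c, bit_sign b * Re c]]"

definition skew_diag :: "real^'n::finite \<Rightarrow> real^('n \<times> 2)^('n \<times> 2)" where
  "skew_diag d = bdiag (\<lambda>k. rot_gen (d $ k))"

definition skew_root :: "'n \<times> 'n \<times> bit \<Rightarrow> complex \<Rightarrow> real^('n::finite \<times> 2)^('n \<times> 2)" where
  "skew_root = (\<lambda>(i, j, b) c. \<chi> p q.
     (if fst p = i \<and> fst q = j then root_block b c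
      else if fst p = j \<and> fst q = i then - transpose (root_block b c) else 0) $ snd p $ snd q)"

definition skew_diag_part :: "real^('n::finite \<times> 2)^('n \<times> 2) \<Rightarrow> real^'n" where
  "skew_diag_part A = (\<chi> k. block A k k $ 1 $ 2)"

text \<open>The projection of a block to its complex linear part for bit 0, or its antilinear part
  for bit 1, read as a complex number.\<close>

definition block_coeff :: "bit \<Rightarrow> real^2^2 \<Rightarrow> complex" where
  "block_coeff b B = Complex ((B $ 1 $ 1 + bit_sign b * B $ 2 $ 2) / 2) ((B $ 2 $ 1 - bit_sign b * B $ 1 $ 2) / 2)"

definition skew_coeff :: "'n \<times> 'n \<times> bit \<Rightarrow> real^('n::finite \<times> 2)^('n \<times> 2) \<Rightarrow> complex" where
  "skew_coeff = (\<lambda>(i, j, b) A. block_coeff b (block A i j))"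

definition signed_spectra :: "('n::finite \<Rightarrow> real) \<Rightarrow> (real^'n) set" where
  "signed_spectra l = {\<chi> k. bit_sign (s k) * l (\<sigma> k) | s \<sigma>. bij \<sigma>}"

lemma skew_vertex_eq: "skew_vertex l s \<sigma> = skew_diag (\<chi> k. bit_sign (s k) * l (\<sigma> k))"
  by (simp add: skew_vertex_def skew_diag_def block_diag_eq_bdiag rot_gen_def)

lemma root_block_add: "root_block b (x + y) = root_block b x + root_block b y"
  by (simp add: vec_eq_iff forall_2 root_block_def algebra_simps)

lemma root_block_scaleR: "root_block b (r *\<^sub>R x) = r *\<^sub>R root_block b x"
  by (simp add: vec_eq_iff forall_2 root_block_def)

text \<open>Diagonal blocks are complex linear, being multiplications by imaginary numbers. Hence
  they commute with rotations, which makes the diagonal points fixed.\<close>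

lemma rot_gen_eq_root_block: "rot_gen x = root_block 0 (- \<i> * of_real x)"
  by (simp add: vec_eq_iff forall_2 root_block_def rot_gen_def bit_sign_def)

text \<open>Moving the right-hand rotation across a complex linear map leaves its angle as it is,
  while moving it across a conjugation inverts it. This is the origin of the two weights
  \<epsilon>_i - \<epsilon>_j and \<epsilon>_i + \<epsilon>_j.\<close>

lemma rotate_root_block:
  "rotation_block u ** root_block b c ** rotation_block (cnj v)
    = root_block b (u * (if b = 0 then cnj v else v) * c)"
  using bit_eq_0_or_1[of b]
  by (elim disjE) (simp_all add: mat2_simps rotation_block_def root_block_def bit_sign_def algebra_simps)

lemma uminus_mult: "(- A) ** (B :: real^2^2) = - (A ** B)" "A ** (- B) = - (A ** B)"
  by (simp_all add: mat2_simps)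

lemma rotate_transpose_root_block:
  "rotation_block v ** (- transpose (root_block b c)) ** rotation_block (cnj u)
    = - transpose (root_block b (u * (if b = 0 then cnj v else v) * c))"
  unfolding rotate_root_block[symmetric]
  by (simp add: matrix_transpose_mul transpose_rotation_block matrix_mul_assoc uminus_mult)

lemma rotate_rot_gen: "cmod u = 1 \<Longrightarrow> rotation_block u ** rot_gen x ** rotation_block (cnj u) = rot_gen x"
  unfolding rot_gen_eq_root_block rotate_root_block by (simp add: complex_norm_square[symmetric])

lemma block_coeff_root_block: "block_coeff b' (root_block b c) = (if b' = b then c else 0)"
  using bit_eq_0_or_1[of b] bit_eq_0_or_1[of b']
  by (elim disjE) (simp_all add: block_coeff_def root_block_def bit_sign_def complex_eq_iff)

lemma block_eq_0I:
  assumes "block_coeff 0 B = 0" "block_coeff 1 B = 0"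
  shows "B = 0"
  using assms by (simp add: block_coeff_def bit_sign_def vec_eq_iff forall_2 complex_eq_iff)

lemma block_skew_root:
  "block (skew_root (i, j, b) c) k m =
    (if k = i \<and> m = j then root_block b c else if k = j \<and> m = i then - transpose (root_block b c) else 0)"
  by (simp only: vec_eq_iff block_nth skew_root_def prod.case vec_lambda_beta fst_conv snd_conv) simp

lemma block_skew_root_simps:
  "block (skew_root (i, j, b) c) i j = root_block b c"
  "i \<noteq> j \<Longrightarrow> block (skew_root (i, j, b) c) j i = - transpose (root_block b c)"
  "i \<noteq> j \<Longrightarrow> block (skew_root (i, j, b) c) k k = 0"
  "\<lbrakk>\<not> (k = i \<and> m = j); \<not> (k = j \<and> m = i)\<rbrakk> \<Longrightarrow> block (skew_root (i, j, b) c) k m = 0"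
  unfolding block_skew_root by auto

lemma block_skew_diag: "block (skew_diag d) k m = (if k = m then rot_gen (d $ k) else 0)"
  by (simp add: skew_diag_def block_bdiag)

lemma linear_skew_diag: "linear skew_diag"
  by (intro linearI block_eqI)
    (simp_all add: block_add block_scaleR block_skew_diag, simp_all add: vec_eq_iff forall_2 rot_gen_def)

lemma linear_skew_root: "linear (skew_root \<alpha>)"
proof (cases \<alpha>)
  case (fields i j b)
  have cases: "(if P then root_block b (x + y) else if Q then - transpose (root_block b (x + y)) else 0) =
      (if P then root_block b x else if Q then - transpose (root_block b x) else 0) +
      (if P then root_block b y else if Q then - transpose (root_block b y) else 0)"
    "(if P then root_block b (r *\<^sub>R x) else if Q then - transpose (root_block b (r *\<^sub>R x)) else 0) =
      r *\<^sub>R (if P then root_block b x else if Q then - transpose (root_block b x) else 0)"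
    for P Q x y and r :: real
    by (simp_all add: root_block_add root_block_scaleR transpose_add transpose_scalar)
  have "skew_root (i, j, b) (x + y) = skew_root (i, j, b) x + skew_root (i, j, b) y" for x y
    by (rule block_eqI) (unfold block_add block_skew_root, rule cases)
  moreover have "skew_root (i, j, b) (r *\<^sub>R x) = r *\<^sub>R skew_root (i, j, b) x" for r x
    by (rule block_eqI) (unfold block_scaleR block_skew_root, rule cases)
  ultimately show ?thesis unfolding fields by (rule linearI)
qed

lemma linear_skew_diag_part: "linear skew_diag_part"
  by (intro linearI) (simp_all add: vec_eq_iff skew_diag_part_def block_add block_scaleR)

lemma linear_skew_coeff: "linear (skew_coeff \<alpha>)"
  by (cases \<alpha>, intro linearI)
    (simp_all add: skew_coeff_def block_coeff_def block_add block_scaleR complex_eq_iff field_simps)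

lemma skew_diag_in_space: "skew_diag d \<in> skew_space E"
  unfolding skew_space_iff block_skew_diag
  by (simp add: vec_eq_iff forall_2 transpose_def rot_gen_def)

lemma skew_root_in_space:
  assumes "i \<noteq> j" "{i, j} \<in> E"
  shows "skew_root (i, j, b) c \<in> skew_space E"
  unfolding skew_space_iff
proof (intro conjI allI impI)
  fix k m
  show "block (skew_root (i, j, b) c) m k = - transpose (block (skew_root (i, j, b) c) k m)"
  proof (cases "k = i \<and> m = j \<or> k = j \<and> m = i")
    case True
    have neg: "- transpose (- transpose B) = B" for B :: "real^2^2"
      by (simp add: vec_eq_iff transpose_def)
    from True show ?thesis
      by (elim disjE conjE) (simp_all only: block_skew_root_simps(1) block_skew_root_simps(2)[OF assms(1)] neg)
  next
    case False
    then have "block (skew_root (i, j, b) c) m k = 0" "block (skew_root (i, j, b) c) k m = 0"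
      by (auto intro!: block_skew_root_simps(4))
    then show ?thesis by (simp add: transpose_0)
  qed
next
  fix k m assume "k \<noteq> m \<and> {k, m} \<notin> E"
  then show "block (skew_root (i, j, b) c) k m = 0"
    using assms(2) by (intro block_skew_root_simps(4)) (auto simp: insert_commute)
qed

subsection \<open>The characteristic polynomial\<close>

text \<open>In the eigenbasis of \<open>rot_gen\<close> the matrix \<open>skew_diag d + skew_root (i, j, b) c\<close> becomes diagonal up
  to two off-diagonal pairs.\<close>

definition eigvecs :: "complex^2^2" where
  "eigvecs = vector [vector [1, 1], vector [\<i>, - \<i>]]"

definition eigvecs_inv :: "complex^2^2" where
  "eigvecs_inv = vector [vector [1/2, - \<i>/2], vector [1/2, \<i>/2]]"

definition eig_block :: "real^2^2 \<Rightarrow> complex^2^2" where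
  "eig_block B = eigvecs_inv ** map_matrix of_real B ** eigvecs"

lemma eigvecs_inv_mult: "eigvecs_inv ** eigvecs = mat 1"
  by (simp add: mat2_simps eigvecs_def eigvecs_inv_def mat_def)

lemma eig_block_0: "eig_block 0 = 0"
proof -
  have "map_matrix of_real (0 :: real^2^2) = (0 :: complex^2^2)" by (simp add: vec_eq_iff)
  then show ?thesis by (simp add: eig_block_def matrix_mult_0)
qed

lemma eig_block_rot_gen:
  "eig_block (rot_gen x) = vector [vector [\<i> * of_real x, 0], vector [0, - \<i> * of_real x]]"
  by (simp add: mat2_simps eig_block_def eigvecs_def eigvecs_inv_def rot_gen_def)

text \<open>A complex linear block preserves the two eigenlines of \<open>rot_gen\<close> and an
  antilinear one exchanges them, so the bit decides which eigenlines are coupled.\<close>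

lemma eig_block_root_block:
  "eig_block (root_block 0 c) = vector [vector [cnj c, 0], vector [0, c]]"
  "eig_block (root_block 1 c) = vector [vector [0, cnj c], vector [c, 0]]"
  by (simp_all add: mat2_simps eig_block_def eigvecs_def eigvecs_inv_def root_block_def bit_sign_def
      complex_eq_iff field_simps)

lemma eig_block_transpose_root_block:
  "eig_block (- transpose (root_block 0 c)) = vector [vector [- c, 0], vector [0, - cnj c]]"
  "eig_block (- transpose (root_block 1 c)) = vector [vector [0, - cnj c], vector [- c, 0]]"
  by (simp_all add: mat2_simps eig_block_def eigvecs_def eigvecs_inv_def root_block_def bit_sign_def
      transpose_def complex_eq_iff field_simps)

definition eig_form :: "real^('n::finite \<times> 2)^('n \<times> 2) \<Rightarrow> complex^('n \<times> 2)^('n \<times> 2)" where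
  "eig_form A = bdiag (\<lambda>_. eigvecs_inv) ** map_matrix of_real A ** bdiag (\<lambda>_. eigvecs)"

lemma det_eig_form: "det (mat z - eig_form A) = det (mat z - map_matrix complex_of_real A)"
  unfolding eig_form_def
  by (rule det_mat_minus_conjugate) (simp add: bdiag_mult eigvecs_inv_mult bdiag_mat)

lemma eig_form_nth: "eig_form A $ (k, a) $ (m, e) = eig_block (block A k m) $ a $ e"
proof -
  have "block (map_matrix complex_of_real A) k m = map_matrix of_real (block A k m)"
    by (simp add: vec_eq_iff block_nth)
  then have "block (eig_form A) k m = eig_block (block A k m)"
    by (simp add: eig_form_def eig_block_def block_bdiag_mult block_mult_bdiag)
  then show ?thesis by (simp flip: block_nth)
qed

lemma prod_UNIV_blocks: "(\<Prod>r\<in>S \<times> (UNIV :: 2 set). f r) = (\<Prod>k\<in>S. f (k, 1) * f (k, 2))"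
proof -
  have "(\<Prod>r\<in>S \<times> (UNIV :: 2 set). f r) = (\<Prod>k\<in>S. \<Prod>a\<in>UNIV. f (k, a))"
    by (simp add: prod.cartesian_product)
  then show ?thesis by (simp add: UNIV_2)
qed

lemma det_skew_diag:
  "det (mat z - map_matrix complex_of_real (skew_diag d)) = (\<Prod>k\<in>UNIV. z\<^sup>2 + (of_real (d $ k))\<^sup>2)"
proof -
  let ?M = "mat z - eig_form (skew_diag d)"
  have M: "?M $ (k, a) $ (m, e) =
      (if k = m \<and> a = e then z else 0) - eig_block (if k = m then rot_gen (d $ k) else 0) $ a $ e" for k a m e
    by (simp add: mat_def eig_form_nth block_skew_diag)
  have "?M $ p $ q = 0" if "p \<noteq> q" for p q
  proof -
    obtain k a m e where pq: "p = (k, a)" "q = (m, e)" by (cases p; cases q)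
    show ?thesis
      using that exhaust_2[of a] exhaust_2[of e] unfolding pq M by (auto simp: eig_block_rot_gen eig_block_0)
  qed
  then have "det ?M = (\<Prod>r\<in>UNIV. ?M $ r $ r)" by (intro det_diagonal) auto
  also have "\<dots> = (\<Prod>k\<in>UNIV. ?M $ (k, 1) $ (k, 1) * ?M $ (k, 2) $ (k, 2))"
    using prod_UNIV_blocks[of "\<lambda>r. ?M $ r $ r" UNIV] by (simp only: UNIV_Times_UNIV)
  also have "\<dots> = (\<Prod>k\<in>UNIV. z\<^sup>2 + (of_real (d $ k))\<^sup>2)"
    unfolding M by (intro prod.cong refl) (simp add: eig_block_rot_gen power2_eq_square algebra_simps)
  finally show ?thesis by (simp add: det_eig_form)
qed

text \<open>The hypotheses say that the two quadratic factors on the left have zeros \<i>X, \<i>Y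
  and -\<i>X, -\<i>Y; pairing opposite zeros gives the right-hand side.\<close>

lemma quartic_factorization:
  fixes z :: complex
  assumes "X + Y = x + y" "X * Y = x * y - w"
  shows "((z - \<i> * x) * (z - \<i> * y) + w) * ((z + \<i> * x) * (z + \<i> * y) + w) = (z\<^sup>2 + X\<^sup>2) * (z\<^sup>2 + Y\<^sup>2)"
proof -
  have "(z - \<i> * x) * (z - \<i> * y) + w = z * z - \<i> * z * (x + y) - (x * y - w)"
    by (simp add: algebra_simps)
  also have "\<dots> = (z - \<i> * X) * (z - \<i> * Y)"
    unfolding assms[symmetric] by (simp add: algebra_simps)
  finally have 1: "(z - \<i> * x) * (z - \<i> * y) + w = (z - \<i> * X) * (z - \<i> * Y)" .
  have "(z + \<i> * x) * (z + \<i> * y) + w = z * z + \<i> * z * (x + y) - (x * y - w)"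
    by (simp add: algebra_simps)
  also have "\<dots> = (z + \<i> * X) * (z + \<i> * Y)"
    unfolding assms[symmetric] by (simp add: algebra_simps)
  finally have 2: "(z + \<i> * x) * (z + \<i> * y) + w = (z + \<i> * X) * (z + \<i> * Y)" .
  have sq: "(z - \<i> * X) * (z + \<i> * X) = z\<^sup>2 + X\<^sup>2" for X
    by (simp add: power2_eq_square algebra_simps)
  have "(z - \<i> * X) * (z - \<i> * Y) * ((z + \<i> * X) * (z + \<i> * Y)) =
      ((z - \<i> * X) * (z + \<i> * X)) * ((z - \<i> * Y) * (z + \<i> * Y))" by (simp only: mult_ac)
  then show ?thesis unfolding 1 2 sq .
qed

text \<open>In the eigenbasis only two disjoint pairs of indices are coupled, so
  \<open>det_two_pairs\<close> leaves two quadratic factors. They differ by the sign of \<i> in the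
  diagonal terms, as \<open>quartic_factorization\<close> requires.\<close>

lemma det_skew_root:
  assumes ij: "i \<noteq> j" and rel: "root_rel (i, j, b) d0 d c"
  shows "det (mat z - map_matrix complex_of_real (skew_diag d + skew_root (i, j, b) c))
    = (\<Prod>k\<in>UNIV. z\<^sup>2 + (of_real (d0 $ k))\<^sup>2)"
proof -
  let ?A = "skew_diag d + skew_root (i, j, b) c"
  let ?M = "mat z - eig_form ?A"
  define \<tau> :: complex where "\<tau> = bit_sign b"
  \<comment> \<open>\<open>e\<close> is the eigenline of block \<open>j\<close> that is coupled with
    the first eigenline of block \<open>i\<close>, and \<open>e'\<close> the one coupled with the
    second: equal positions for bit 0, exchanged for bit 1.\<close>
  define e :: 2 where "e = (if b = 0 then 1 else 2)"
  define e' :: 2 where "e' = (if b = 0 then 2 else 1)"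
  have M: "?M $ (k, a) $ (m, a') = (if k = m \<and> a = a' then z else 0) - eig_block (block ?A k m) $ a $ a'" for k a m a'
    by (simp add: mat_def eig_form_nth)
  have B: "block ?A k k = rot_gen (d $ k)" "block ?A i j = root_block b c"
    "block ?A j i = - transpose (root_block b c)" for k
    using ij by (simp_all add: block_add block_skew_diag block_skew_root_simps)
  have B0: "block ?A k m = 0" if "k \<noteq> m" "\<not> (k = i \<and> m = j)" "\<not> (k = j \<and> m = i)" for k m
    using that by (simp add: block_add block_skew_diag block_skew_root_simps(4))
  have diag: "?M $ (k, 1) $ (k, 1) = z - \<i> * of_real (d $ k)" "?M $ (k, 2) $ (k, 2) = z + \<i> * of_real (d $ k)" for k
    unfolding M B by (simp_all add: eig_block_rot_gen)
  have supp: "?M $ r $ s = 0" if "r \<noteq> s" "(r, s) \<noteq> ((i, 1), (j, e))" "(r, s) \<noteq> ((j, e), (i, 1))"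
    "(r, s) \<noteq> ((i, 2), (j, e'))" "(r, s) \<noteq> ((j, e'), (i, 2))" for r s
  proof -
    obtain k a m a' where rs: "r = (k, a)" "s = (m, a')" by (cases r; cases s)
    consider "k = m" | "k = i" "m = j" | "k = j" "m = i" | "k \<noteq> m" "\<not> (k = i \<and> m = j)" "\<not> (k = j \<and> m = i)"
      by blast
    then show ?thesis
    proof cases
      case 1
      then show ?thesis
        using that(1) exhaust_2[of a] exhaust_2[of a'] unfolding rs M 1 B by (auto simp: eig_block_rot_gen)
    next
      case 2
      then show ?thesis
        using ij that(2,4) exhaust_2[of a] exhaust_2[of a'] bit_eq_0_or_1[of b] unfolding rs M 2 B
        by (auto simp: e_def e'_def eig_block_root_block)
    next
      case 3
      then show ?thesis
        using ij that(3,5) exhaust_2[of a] exhaust_2[of a'] bit_eq_0_or_1[of b] unfolding rs M 3 B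
        by (auto simp: e_def e'_def eig_block_transpose_root_block)
    next
      case 4
      then show ?thesis unfolding rs M B0[OF 4] by (simp add: eig_block_0)
    qed
  qed
  have ee': "e = 1 \<and> e' = 2 \<or> e = 2 \<and> e' = 1" by (simp add: e_def e'_def)
  have off: "?M $ (i, 1) $ (j, e) = - cnj c" "?M $ (j, e) $ (i, 1) = c"
    "?M $ (i, 2) $ (j, e') = - c" "?M $ (j, e') $ (i, 2) = cnj c"
    using ij bit_eq_0_or_1[of b] unfolding M B
    by (auto simp: e_def e'_def eig_block_root_block eig_block_transpose_root_block)
  have dj: "?M $ (j, e) $ (j, e) = z - \<i> * (\<tau> * of_real (d $ j))"
    "?M $ (j, e') $ (j, e') = z + \<i> * (\<tau> * of_real (d $ j))"
    using bit_eq_0_or_1[of b] unfolding M B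
    by (auto simp: e_def e'_def eig_block_rot_gen \<tau>_def bit_sign_def)
  have dist: "distinct [(i, 1), (j, e), (i, 2), (j, e')]" using ij ee' by auto
  have rest: "UNIV - {(i, 1), (j, e), (i, 2), (j, e')} = (UNIV - {i, j}) \<times> UNIV"
  proof -
    have "(k, a) \<in> {(i, 1), (j, e), (i, 2), (j, e')} \<longleftrightarrow> k = i \<or> k = j" for k a
      using exhaust_2[of a] ee' by auto
    then have "(k, a) \<in> UNIV - {(i, 1), (j, e), (i, 2), (j, e')} \<longleftrightarrow> (k, a) \<in> (UNIV - {i, j}) \<times> UNIV" for k a
      unfolding Diff_iff mem_Sigma_iff by simp
    then show ?thesis by (intro set_eqI) (metis surj_pair)
  qed
  have "det ?M = (?M $ (i, 1) $ (i, 1) * ?M $ (j, e) $ (j, e) - ?M $ (i, 1) $ (j, e) * ?M $ (j, e) $ (i, 1)) *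
    (?M $ (i, 2) $ (i, 2) * ?M $ (j, e') $ (j, e') - ?M $ (i, 2) $ (j, e') * ?M $ (j, e') $ (i, 2)) *
    (\<Prod>r\<in>UNIV - {(i, 1), (j, e), (i, 2), (j, e')}. ?M $ r $ r)"
    by (rule det_two_pairs[OF dist supp])
  also have "(\<Prod>r\<in>UNIV - {(i, 1), (j, e), (i, 2), (j, e')}. ?M $ r $ r)
      = (\<Prod>k\<in>UNIV - {i, j}. z\<^sup>2 + (of_real (d0 $ k))\<^sup>2)"
    unfolding rest prod_UNIV_blocks diag
  proof (rule prod.cong[OF HOL.refl])
    fix k assume "k \<in> UNIV - {i, j}"
    then have "d0 $ k = d $ k" using rel by (simp add: root_rel_def)
    then show "(z - \<i> * of_real (d $ k)) * (z + \<i> * of_real (d $ k)) = z\<^sup>2 + (of_real (d0 $ k))\<^sup>2"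
      by (simp add: power2_eq_square algebra_simps)
  qed
  also have "(?M $ (i, 1) $ (i, 1) * ?M $ (j, e) $ (j, e) - ?M $ (i, 1) $ (j, e) * ?M $ (j, e) $ (i, 1)) *
    (?M $ (i, 2) $ (i, 2) * ?M $ (j, e') $ (j, e') - ?M $ (i, 2) $ (j, e') * ?M $ (j, e') $ (i, 2))
    = (z\<^sup>2 + (of_real (d0 $ i))\<^sup>2) * (z\<^sup>2 + (of_real (d0 $ j))\<^sup>2)"
  proof -
    \<comment> \<open>The sign \<tau> is absorbed into \<open>y\<close> and \<open>Y\<close>, which
      brings both bits to one computation; it disappears again in the square of
      \<open>Y\<close>.\<close>
    define x y X Y :: complex where "x = of_real (d $ i)" and "y = \<tau> * of_real (d $ j)"
      and "X = of_real (d0 $ i)" and "Y = \<tau> * of_real (d0 $ j)"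
    have \<tau>: "\<tau> = of_real (bit_sign b)" by (simp add: \<tau>_def bit_sign_def)
    have "d0 $ i + bit_sign b * d0 $ j = d $ i + bit_sign b * d $ j" using rel by (simp add: root_rel_def)
    then have sum: "X + Y = x + y"
      unfolding X_def Y_def x_def y_def \<tau> by (simp only: of_real_add[symmetric] of_real_mult[symmetric])
    have "d0 $ i * (bit_sign b * d0 $ j) = d $ i * (bit_sign b * d $ j) - (cmod c)\<^sup>2"
      using root_rel_product[OF rel] by (simp add: mult.left_commute)
    then have prod: "X * Y = x * y - c * cnj c"
      unfolding X_def Y_def x_def y_def \<tau>
      by (simp only: of_real_diff[symmetric] of_real_mult[symmetric] complex_norm_square[symmetric] of_real_power[symmetric])
    have Y2: "Y\<^sup>2 = (of_real (d0 $ j))\<^sup>2"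
      using bit_eq_0_or_1[of b] by (auto simp: Y_def \<tau>_def bit_sign_def)
    have "(z - \<i> * x) * (z - \<i> * y) - - cnj c * c = (z - \<i> * x) * (z - \<i> * y) + c * cnj c"
      "(z + \<i> * x) * (z + \<i> * y) - - c * cnj c = (z + \<i> * x) * (z + \<i> * y) + c * cnj c"
      by simp_all
    then show ?thesis
      unfolding off dj diag x_def[symmetric] y_def[symmetric] X_def[symmetric] Y2[symmetric]
      by (simp only: quartic_factorization[OF sum prod])
  qed
  finally show ?thesis by (simp add: det_eig_form prod_UNIV_remove2[OF ij])
qed

text \<open>Only squares occur, so with \<open>u = - z\<^sup>2\<close> the question becomes one
  about polynomials with real zeros; every complex \<open>u\<close> has this form. Distinct absolute
  values make the squares of \<open>l\<close> distinct, and the choice of a square root becomes a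
  sign bit.\<close>

lemma det_skew_diag_eq_iff:
  assumes gen: "inj (\<lambda>k. \<bar>l k\<bar>)"
  shows "(\<forall>z::complex. (\<Prod>k\<in>UNIV. z\<^sup>2 + (of_real (d $ k))\<^sup>2) = (\<Prod>k\<in>UNIV. z\<^sup>2 + (of_real (l k))\<^sup>2))
    \<longleftrightarrow> d \<in> signed_spectra l"
proof -
  have inj: "inj (\<lambda>k. (l k)\<^sup>2)"
    using gen by (simp add: inj_def) (metis abs_eq_iff power2_eq_iff)
  \<comment> \<open>Extracting the sign from every factor produces linear factors in
    \<open>- z\<^sup>2\<close>.\<close>
  have sub: "(\<Prod>k\<in>UNIV. z\<^sup>2 + (of_real (a k))\<^sup>2) = (-1) ^ CARD('a) * (\<Prod>k\<in>UNIV. - z\<^sup>2 - of_real ((a k)\<^sup>2))"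
    for a :: "'a \<Rightarrow> real" and z :: complex
    unfolding prod_uminus[symmetric] by (intro prod.cong refl) simp
  have "(\<forall>z::complex. (\<Prod>k\<in>UNIV. z\<^sup>2 + (of_real (d $ k))\<^sup>2) = (\<Prod>k\<in>UNIV. z\<^sup>2 + (of_real (l k))\<^sup>2))
    \<longleftrightarrow> (\<forall>z::complex. (\<Prod>k\<in>UNIV. - z\<^sup>2 - of_real ((d $ k)\<^sup>2)) = (\<Prod>k\<in>UNIV. - z\<^sup>2 - of_real ((l k)\<^sup>2)))"
    unfolding sub by simp
  also have "\<dots> \<longleftrightarrow> (\<forall>u::complex. (\<Prod>k\<in>UNIV. u - of_real ((d $ k)\<^sup>2)) = (\<Prod>k\<in>UNIV. u - of_real ((l k)\<^sup>2)))"
  proof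
    assume e: "\<forall>z::complex. (\<Prod>k\<in>UNIV. - z\<^sup>2 - of_real ((d $ k)\<^sup>2)) = (\<Prod>k\<in>UNIV. - z\<^sup>2 - of_real ((l k)\<^sup>2))"
    show "\<forall>u::complex. (\<Prod>k\<in>UNIV. u - of_real ((d $ k)\<^sup>2)) = (\<Prod>k\<in>UNIV. u - of_real ((l k)\<^sup>2))"
    proof
      fix u :: complex
      have "- (csqrt (- u))\<^sup>2 = u" by simp
      then show "(\<Prod>k\<in>UNIV. u - of_real ((d $ k)\<^sup>2)) = (\<Prod>k\<in>UNIV. u - of_real ((l k)\<^sup>2))"
        using e[rule_format, of "csqrt (- u)"] by (simp only:)
    qed
  qed blast
  also have "\<dots> \<longleftrightarrow> (\<exists>\<sigma>. bij \<sigma> \<and> (\<forall>k. (d $ k)\<^sup>2 = (l (\<sigma> k))\<^sup>2))"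
    by (rule prod_linear_factors_eq_iff[OF inj])
  also have "\<dots> \<longleftrightarrow> d \<in> signed_spectra l"
  proof
    assume "\<exists>\<sigma>. bij \<sigma> \<and> (\<forall>k. (d $ k)\<^sup>2 = (l (\<sigma> k))\<^sup>2)"
    then obtain \<sigma> where \<sigma>: "bij \<sigma>" "\<And>k. (d $ k)\<^sup>2 = (l (\<sigma> k))\<^sup>2" by blast
    define s :: "'a \<Rightarrow> bit" where "s k = (if d $ k = l (\<sigma> k) then 0 else 1)" for k
    have "d $ k = bit_sign (s k) * l (\<sigma> k)" for k
      using \<sigma>(2)[of k] by (auto simp: s_def bit_sign_def power2_eq_iff)
    then have "d = (\<chi> k. bit_sign (s k) * l (\<sigma> k))" by (simp add: vec_eq_iff)
    then show "d \<in> signed_spectra l" unfolding signed_spectra_def using \<sigma>(1) by blast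
  next
    assume "d \<in> signed_spectra l"
    then obtain s \<sigma> where "bij \<sigma>" "d = (\<chi> k. bit_sign (s k) * l (\<sigma> k))"
      by (auto simp: signed_spectra_def)
    then show "\<exists>\<sigma>. bij \<sigma> \<and> (\<forall>k. (d $ k)\<^sup>2 = (l (\<sigma> k))\<^sup>2)"
      by (intro exI[of _ \<sigma>]) (simp add: power_mult_distrib power2_eq_square)
  qed
  finally show ?thesis .
qed

lemma finite_signed_spectra: "finite (signed_spectra l)"
proof -
  have eq: "signed_spectra l = (\<lambda>(s, \<sigma>). \<chi> k. bit_sign (s k) * l (\<sigma> k)) ` (UNIV \<times> {\<sigma>. bij \<sigma>})"
    by (auto simp: signed_spectra_def)
  have "finite (PiE UNIV (\<lambda>_. UNIV) :: ('a \<Rightarrow> bit) set)"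
    using finite_UNIV_bit by (intro finite_PiE) auto
  then have "finite (UNIV :: ('a \<Rightarrow> bit) set)" by (simp add: PiE_def)
  then show ?thesis unfolding eq by (intro finite_imageI finite_cartesian_product) auto
qed

lemma root_torus_manifold_skew:
  fixes E :: "'n::finite set set"
  assumes R: "\<And>i j. (i, j) \<in> R \<Longrightarrow> i \<noteq> j \<and> {i, j} \<in> E \<and> (j, i) \<notin> R"
    "\<And>i j. \<lbrakk>i \<noteq> j; {i, j} \<in> E\<rbrakk> \<Longrightarrow> (i, j) \<in> R \<or> (j, i) \<in> R"
    and gen: "generic_spectrum E l"
  shows "root_torus_manifold skew_act (skew_isospectral E l) (skew_space E)
    {(i, j, b) | i j b. (i, j) \<in> R} (signed_spectra l) skew_diag skew_root skew_diag_part skew_coeff"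
proof -
  have injl: "inj (\<lambda>k. \<bar>l k\<bar>)" using gen by (simp add: generic_spectrum_def)
  let ?I = "{(i, j, b) | i j b. (i, j) \<in> R} :: ('n \<times> 'n \<times> bit) set"
  have I: "\<exists>i j b. \<alpha> = (i, j, b) \<and> (i, j) \<in> R \<and> i \<noteq> j \<and> {i, j} \<in> E \<and> (j, i) \<notin> R" if as: "\<alpha> \<in> ?I" for \<alpha>
    using as R(1) by blast
  show ?thesis
  proof (rule root_torus_manifold.intro)
    show "torus_manifold skew_act (skew_isospectral E l)"
      using gen by (simp add: torus_manifold_def linear_torus_action_skew torus_invariant_skew generic_spectrum_def)
    show "subspace (skew_space E)" by (rule subspace_skew_space)
    show "skew_isospectral E l \<subseteq> skew_space E" by (auto simp: skew_isospectral_def)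
    show "linear (skew_diag :: real^'n \<Rightarrow> _)" by (rule linear_skew_diag)
    show "linear (skew_root \<alpha>)" for \<alpha> :: "'n \<times> 'n \<times> bit" by (rule linear_skew_root)
    show "linear (skew_diag_part :: real^('n \<times> 2)^('n \<times> 2) \<Rightarrow> _)" by (rule linear_skew_diag_part)
    show "linear (skew_coeff \<alpha>)" for \<alpha> :: "'n \<times> 'n \<times> bit" by (rule linear_skew_coeff)
    show "skew_diag d \<in> skew_space E" for d by (rule skew_diag_in_space)
    show "skew_root \<alpha> c \<in> skew_space E" if as: "\<alpha> \<in> ?I" for \<alpha> c
      using I[OF as] skew_root_in_space by blast
    show "skew_diag_part (skew_diag d) = d" for d :: "real^'n"
      by (simp add: vec_eq_iff skew_diag_part_def block_skew_diag rot_gen_def)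
    show "skew_diag_part (skew_root \<alpha> c) = 0" if as: "\<alpha> \<in> ?I" for \<alpha> c
    proof -
      obtain i j b where \<alpha>: "\<alpha> = (i, j, b)" "i \<noteq> j" using I[OF as] by blast
      show ?thesis unfolding \<alpha>(1) skew_diag_part_def block_skew_root_simps(3)[OF \<alpha>(2)]
        by (simp add: vec_eq_iff)
    qed
    show "skew_coeff \<alpha> (skew_diag d) = 0" if as: "\<alpha> \<in> ?I" for \<alpha> d
    proof -
      obtain i j b where \<alpha>: "\<alpha> = (i, j, b)" "i \<noteq> j" using I[OF as] by blast
      then show ?thesis by (simp add: skew_coeff_def block_skew_diag block_coeff_def complex_eq_iff)
    qed
    show "skew_coeff \<beta> (skew_root \<alpha> c) = (if \<beta> = \<alpha> then c else 0)" if as: "\<alpha> \<in> ?I" "\<beta> \<in> ?I" for \<alpha> \<beta> c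
    proof -
      obtain i j b where \<alpha>: "\<alpha> = (i, j, b)" "(j, i) \<notin> R" using I[OF as(1)] by blast
      obtain i' j' b' where \<beta>: "\<beta> = (i', j', b')" "(i', j') \<in> R" using I[OF as(2)] by blast
      have no: "\<not> (i' = j \<and> j' = i)" using \<alpha>(2) \<beta>(2) by auto
      show ?thesis
      proof (cases "i' = i \<and> j' = j")
        case True
        then show ?thesis
          by (simp add: \<alpha>(1) \<beta>(1) skew_coeff_def block_skew_root_simps(1) block_coeff_root_block)
      next
        case False
        then show ?thesis using block_skew_root_simps(4)[OF False no, of b c]
          by (auto simp: \<alpha>(1) \<beta>(1) skew_coeff_def block_coeff_def complex_eq_iff)
      qed
    qed
    show "x = 0" if x: "x \<in> skew_space E" "skew_diag_part x = 0" "\<And>\<alpha>. \<alpha> \<in> ?I \<Longrightarrow> skew_coeff \<alpha> x = 0" for x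
    proof -
      have sym: "block x m k = - transpose (block x k m)" for k m
        using x(1) unfolding skew_space_iff by blast
      \<comment> \<open>Both bits of one oriented edge are needed here: a block vanishes only when
        its linear and antilinear parts do.\<close>
      have R0: "block x k m = 0" if as: "(k, m) \<in> R" for k m
        using x(3)[of "(k, m, 0)"] x(3)[of "(k, m, 1)"] as
        by (intro block_eq_0I) (simp_all add: skew_coeff_def)
      have "block x k m = 0" for k m
      proof (cases "k = m")
        case True
        have "block x k k $ a $ c = - block x k k $ c $ a" for a c
          using arg_cong[OF sym[of k k], of "\<lambda>M. M $ a $ c"] by (simp add: transpose_def)
        from this[of 1 1] this[of 2 2] this[of 2 1] have "block x k k $ 1 $ 1 = 0" "block x k k $ 2 $ 2 = 0"
          "block x k k $ 2 $ 1 = - block x k k $ 1 $ 2" by linarith+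
        moreover have "block x k k $ 1 $ 2 = 0" using x(2) by (simp add: vec_eq_iff skew_diag_part_def)
        ultimately have "block x k k = 0" by (simp add: vec_eq_iff forall_2)
        then show ?thesis using True by simp
      next
        case km: False
        show ?thesis
        proof (cases "{k, m} \<in> E")
          case True
          then have "block x k m = 0 \<or> block x m k = 0" using R(2)[OF km True] R0 by auto
          then show ?thesis
          proof
            assume "block x m k = 0"
            then have "block x k m = - transpose 0" using sym[of k m] by (metis)
            then show ?thesis by (simp add: transpose_0)
          qed
        next
          case False
          then show ?thesis using x(1) km unfolding skew_space_iff by blast
        qed
      qed
      then show ?thesis by (intro block_eqI) (simp add: vec_eq_iff block_nth)
    qed
    show "skew_act t (skew_diag d) = skew_diag d" if as: "t \<in> torus" for t and d :: "real^'n"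
    proof (rule block_eqI)
      have "cmod (t $ k) = 1" for k using as by (simp add: torus_def)
      then show "block (skew_act t (skew_diag d)) k m = block (skew_diag d) k m" for k m
        unfolding block_skew_act[OF as] block_skew_diag by (simp add: rotate_rot_gen matrix_mult_0)
    qed
    show "skew_act t (skew_root \<alpha> c) = skew_root \<alpha> (torus_char (root_weight \<alpha>) t * c)"
      if as: "t \<in> torus" "\<alpha> \<in> ?I" for t \<alpha> c
    proof -
      obtain i j b where \<alpha>: "\<alpha> = (i, j, b)" "i \<noteq> j" using I[OF as(2)] by blast
      show ?thesis unfolding \<alpha>(1)
      proof (rule block_eqI)
        fix k m
        consider "k = i" "m = j" | "k = j" "m = i" | "\<not> (k = i \<and> m = j)" "\<not> (k = j \<and> m = i)" by blast
        then show "block (skew_act t (skew_root (i, j, b) c)) k m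
          = block (skew_root (i, j, b) (torus_char (root_weight (i, j, b)) t * c)) k m"
        proof cases
          case 1
          show ?thesis unfolding 1 block_skew_act[OF as(1)] block_skew_root_simps(1) rotate_root_block
            torus_char_root[OF \<alpha>(2) as(1)] ..
        next
          case 2
          show ?thesis unfolding 2 block_skew_act[OF as(1)] block_skew_root_simps(2)[OF \<alpha>(2)]
            rotate_transpose_root_block torus_char_root[OF \<alpha>(2) as(1)] ..
        next
          case 3
          show ?thesis unfolding block_skew_act[OF as(1)] block_skew_root_simps(4)[OF 3] matrix_mult_0 ..
        qed
      qed
    qed
    show "i \<noteq> j" if as: "(i, j, b) \<in> ?I" for i j b using I[OF as] by blast
    show "(j, i, b') \<notin> ?I" if as: "(i, j, b) \<in> ?I" for i j b b' using I[OF as] by blast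
    show "finite (signed_spectra l)" by (rule finite_signed_spectra)
    show "skew_diag d \<in> skew_isospectral E l \<longleftrightarrow> d \<in> signed_spectra l" for d
      by (simp only: skew_isospectral_iff skew_diag_in_space det_skew_diag det_skew_diag_eq_iff[OF injl] simp_thms)
    show "skew_diag d + skew_root \<alpha> c \<in> skew_isospectral E l \<longleftrightarrow> d0 \<in> signed_spectra l"
      if as: "\<alpha> \<in> ?I" "root_rel \<alpha> d0 d c" for \<alpha> d0 d c
    proof -
      obtain i j b where \<alpha>: "\<alpha> = (i, j, b)" "i \<noteq> j" "{i, j} \<in> E" using I[OF as(1)] by blast
      have "skew_diag d + skew_root \<alpha> c \<in> skew_space E"
        unfolding \<alpha>(1) by (intro subspace_add subspace_skew_space skew_diag_in_space skew_root_in_space \<alpha>(2,3))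
      then show ?thesis
        using as(2) unfolding \<alpha>(1)
        by (simp only: skew_isospectral_iff det_skew_root[OF \<alpha>(2)] det_skew_diag_eq_iff[OF injl] simp_thms)
    qed
    show "root_val \<alpha> d \<noteq> 0" if as: "\<alpha> \<in> ?I" "d \<in> signed_spectra l" for \<alpha> d
    proof -
      obtain i j b where \<alpha>: "\<alpha> = (i, j, b)" "i \<noteq> j" using I[OF as(1)] by blast
      obtain s \<sigma> where \<sigma>: "bij \<sigma>" "d = (\<chi> k. bit_sign (s k) * l (\<sigma> k))" using as(2) by (auto simp: signed_spectra_def)
      have "\<sigma> i \<noteq> \<sigma> j" using \<sigma>(1) \<alpha>(2) by (simp add: bij_is_inj inj_eq)
      \<comment> \<open>Distinct absolute values exclude both \<open>d $ i = d $ j\<close> and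
        \<open>d $ i = - d $ j\<close>, and hence both roots of the edge.\<close>
      then have ne: "\<bar>l (\<sigma> i)\<bar> \<noteq> \<bar>l (\<sigma> j)\<bar>" using injD[OF injl, of "\<sigma> i" "\<sigma> j"] by auto
      have "\<bar>bit_sign c * x\<bar> = \<bar>x\<bar>" for c and x :: real by (simp add: bit_sign_def)
      then have "\<bar>d $ i\<bar> = \<bar>l (\<sigma> i)\<bar>" "\<bar>bit_sign b * d $ j\<bar> = \<bar>l (\<sigma> j)\<bar>" by (simp_all add: \<sigma>(2))
      then show ?thesis using ne by (auto simp: \<alpha>(1) root_val_def)
    qed
  qed
qed

section \<open>Edges of the two graphs\<close>

lemma herm_vertex_eq: "herm_vertex l \<sigma> = herm_diag (\<chi> k. l (\<sigma> k))"
  by (simp add: vec_eq_iff herm_vertex_def diag_matrix_def herm_diag_def)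

text \<open>The reflection in \<open>\<epsilon>\<^sub>i \<mp> \<epsilon>\<^sub>j\<close> exchanges the coordinates \<open>i\<close> and \<open>j\<close> and changes both signs if
  \<open>b = 1\<close>.\<close>

definition swap_signs :: "'n \<Rightarrow> 'n \<Rightarrow> bit \<Rightarrow> ('n \<Rightarrow> bit) \<Rightarrow> 'n \<Rightarrow> bit" where
  "swap_signs i j b s = (\<lambda>k. if k = i then s j + b else if k = j then s i + b else s k)"

lemma bit_add_self: "(x :: bit) + y + y = x"
  using bit_eq_0_or_1[of x] bit_eq_0_or_1[of y] by auto

lemma reflect_hermitian_spectrum:
  assumes "i \<noteq> j"
  shows "reflect (i, j, 0) (\<chi> k. l (\<sigma> k)) = (\<chi> k. l ((\<sigma> \<circ> Transposition.transpose i j) k))"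
  using assms by (auto simp: vec_eq_iff reflect_nth bit_sign_def Transposition.transpose_def)

lemma reflect_signed_spectrum:
  assumes "i \<noteq> j"
  shows "reflect (i, j, b) (\<chi> k. bit_sign (s k) * l (\<sigma> k)) =
    (\<chi> k. bit_sign (swap_signs i j b s k) * l ((\<sigma> \<circ> Transposition.transpose i j) k))"
  using assms bit_eq_0_or_1[of b] bit_eq_0_or_1[of "s i"] bit_eq_0_or_1[of "s j"]
  by (auto simp: vec_eq_iff reflect_nth swap_signs_def bit_sign_def Transposition.transpose_def)

lemma swap_signs_involutive: "i \<noteq> j \<Longrightarrow> swap_signs i j b (swap_signs i j b s) = s"
  by (auto simp: fun_eq_iff swap_signs_def bit_add_self)

lemma swap_signs_inj:
  assumes "swap_signs i j b s = swap_signs i j b' s"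
  shows "b = b'"
proof -
  have "s j + b = s j + b'" using fun_cong[OF assms, of i] by (simp only: swap_signs_def simp_thms if_True)
  then show ?thesis
    using bit_eq_0_or_1[of b] bit_eq_0_or_1[of b'] bit_eq_0_or_1[of "s j"] by auto
qed

lemma compatible_swap_signs: "i \<noteq> j \<Longrightarrow> compatible_signs i j s (swap_signs i j b s)"
  using bit_eq_0_or_1[of b] bit_eq_0_or_1[of "s i"] bit_eq_0_or_1[of "s j"]
  by (auto simp: compatible_signs_def swap_signs_def)

text \<open>The sign at \<open>i\<close> forces \<open>b\<close>, since subtraction equals addition
  for bits; the preserved sum then gives the sign at \<open>j\<close>. Thus the two compatible
  choices of \<open>s'\<close> are the two roots of the edge.\<close>

lemma compatible_signs_imp_swap:
  assumes "i \<noteq> j" "compatible_signs i j s s'"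
  shows "s' = swap_signs i j (s' i + s j) s"
proof
  fix k
  have "s' k = s k" if "k \<notin> {i, j}" using that assms(2) by (simp add: compatible_signs_def)
  moreover have "s i + s j = s' i + s' j" using assms(2) by (simp add: compatible_signs_def)
  ultimately show "s' k = swap_signs i j (s' i + s j) s k"
    using assms(1) bit_eq_0_or_1[of "s i"] bit_eq_0_or_1[of "s j"] bit_eq_0_or_1[of "s' i"] bit_eq_0_or_1[of "s' j"]
    by (cases "k \<in> {i, j}") (auto simp: swap_signs_def)
qed

text \<open>Here \<open>s' i = s j + b\<close>, so the test \<open>s i = s' i\<close> asks whether
  \<open>b = s i + s j\<close>. In either case the sign in front of \<epsilon>_j is the one
  determined by \<open>b\<close>.\<close>

lemma skew_weight_swap_signs:
  assumes "i \<noteq> j"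
  shows "skew_weight i j s (swap_signs i j b s) = root_weight (i, j, b)"
  using assms bit_eq_0_or_1[of b] bit_eq_0_or_1[of "s i"] bit_eq_0_or_1[of "s j"]
  by (auto simp: skew_weight_def swap_signs_def root_weight_def bit_sign_def vec_eq_iff)

lemma swap_signs_commute: "swap_signs i j b = swap_signs j i b"
  by (auto simp: fun_eq_iff swap_signs_def)

text \<open>Reversing the orientation negates a difference and fixes a sum, so a weight up to sign
  does not see the orientation.\<close>

lemma root_weight_commute:
  "{root_weight (j, i, b), - root_weight (j, i, b)} = {root_weight (i, j, b), - root_weight (i, j, b)}"
proof -
  have "root_weight (j, i, b) = root_weight (i, j, b) \<or> root_weight (j, i, b) = - root_weight (i, j, b)"
    using bit_eq_0_or_1[of b] by (auto simp: root_weight_def bit_sign_def vec_eq_iff)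
  then show ?thesis by auto
qed

lemma transpose_eq_transposeD:
  assumes "Transposition.transpose i j = Transposition.transpose i' j'" "i \<noteq> j"
  shows "i = i' \<and> j = j' \<or> i = j' \<and> j = i'"
  using fun_cong[OF assms(1), of i] fun_cong[OF assms(1), of j] assms(2)
  by (auto simp: Transposition.transpose_def split: if_splits)

lemma comp_bij_cancel: "bij \<sigma> \<Longrightarrow> \<sigma> \<circ> f = \<sigma> \<circ> g \<longleftrightarrow> f = g"
  by (metis bij_is_inj fun.inj_map_strong injD inj_compose comp_apply ext)

text \<open>Two labellings of two sets by the same labels, with the same fibres, match the sets
  without choosing a preferred label for each element.\<close>

lemma bij_betw_images:
  assumes "\<And>x y. \<lbrakk>x \<in> T; y \<in> T\<rbrakk> \<Longrightarrow> p x = p y \<longleftrightarrow> q x = q y"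
  obtains g where "bij_betw g (p ` T) (q ` T)" "\<And>x. x \<in> T \<Longrightarrow> g (p x) = q x"
proof
  define g where "g e = q (SOME x. x \<in> T \<and> p x = e)" for e
  show gp: "g (p x) = q x" if "x \<in> T" for x
  proof -
    have "(SOME y. y \<in> T \<and> p y = p x) \<in> T \<and> p (SOME y. y \<in> T \<and> p y = p x) = p x"
      by (rule someI[of _ x]) (simp add: that)
    then show ?thesis using assms that unfolding g_def by blast
  qed
  have "inj_on g (p ` T)"
  proof (rule inj_onI)
    fix u v assume "u \<in> p ` T" "v \<in> p ` T" "g u = g v"
    then obtain x y where xy: "x \<in> T" "y \<in> T" "u = p x" "v = p y" by blast
    then have "q x = q y" using \<open>g u = g v\<close> gp by simp
    then show "u = v" using assms xy by simp
  qed
  moreover have "g ` (p ` T) = q ` T" using gp by (simp add: image_image)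
  ultimately show "bij_betw g (p ` T) (q ` T)" by (simp add: bij_betw_def)
qed

lemma herm_vertex_inj:
  assumes "inj l"
  shows "herm_vertex l \<sigma> = herm_vertex l \<sigma>' \<longleftrightarrow> \<sigma> = \<sigma>'"
proof
  assume "herm_vertex l \<sigma> = herm_vertex l \<sigma>'"
  then have "herm_vertex l \<sigma> $ k $ k = herm_vertex l \<sigma>' $ k $ k" for k by simp
  then have "l (\<sigma> k) = l (\<sigma>' k)" for k by (simp add: herm_vertex_def diag_matrix_def)
  then show "\<sigma> = \<sigma>'" using assms by (simp add: fun_eq_iff inj_eq)
qed simp

text \<open>Absolute values recover the permutation; after that, nonzero entries recover the
  signs.\<close>

lemma signed_spectrum_inj:
  fixes l :: "'n::finite \<Rightarrow> real"
  assumes "inj (\<lambda>k. \<bar>l k\<bar>)" "\<forall>k. l k \<noteq> 0"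
  shows "(\<chi> k. bit_sign (s k) * l (\<sigma> k)) = (\<chi> k. bit_sign (s' k) * l (\<sigma>' k)) \<longleftrightarrow> s = s' \<and> \<sigma> = \<sigma>'"
proof
  assume "(\<chi> k. bit_sign (s k) * l (\<sigma> k)) = (\<chi> k. bit_sign (s' k) * l (\<sigma>' k))"
  then have e: "bit_sign (s k) * l (\<sigma> k) = bit_sign (s' k) * l (\<sigma>' k)" for k by (simp add: vec_eq_iff)
  have "\<bar>bit_sign c * x\<bar> = \<bar>x\<bar>" for c and x :: real by (simp add: bit_sign_def)
  then have "\<bar>l (\<sigma> k)\<bar> = \<bar>l (\<sigma>' k)\<bar>" for k using e[of k] by metis
  then have \<sigma>: "\<sigma> k = \<sigma>' k" for k using injD[OF assms(1)] by simp
  have "s k = s' k" for k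
  proof -
    have "bit_sign (s k) = (bit_sign (s' k) :: real)" using e[of k] assms(2) by (simp add: \<sigma>)
    then show ?thesis
      using bit_eq_0_or_1[of "s k"] bit_eq_0_or_1[of "s' k"] by (auto simp: bit_sign_def)
  qed
  with \<sigma> show "s = s' \<and> \<sigma> = \<sigma>'" by (simp add: fun_eq_iff)
qed simp

theorem theorem1:
  fixes E :: "'n::finite set set" and l :: "'n \<Rightarrow> real"
    and \<mu> :: "(complex^'n^'n, (complex^'n^'n) set, int^'n) axial_graph"
  assumes "simple_graph E" and "connected_graph E"
    and "generic_spectrum E l"
    and "\<mu> = gkm_graph herm_act (herm_isospectral E l)"
  shows "gkm_manifold herm_act (herm_isospectral E l)
    \<and> verts \<mu> = {herm_vertex l \<sigma> | \<sigma>. bij \<sigma>}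
    \<and> gkm_manifold skew_act (skew_isospectral E l)
    \<and> (\<exists>f g. axial_graph_iso f g (eta_graph l \<mu>) (gkm_graph skew_act (skew_isospectral E l))
           \<and> (\<forall>s \<sigma>. bij \<sigma> \<longrightarrow> f (s, herm_vertex l \<sigma>) = skew_vertex l s \<sigma>))"
proof -
  obtain R where R: "\<And>i j. (i, j) \<in> R \<Longrightarrow> i \<noteq> j \<and> {i, j} \<in> E \<and> (j, i) \<notin> R"
    "\<And>i j. \<lbrakk>i \<noteq> j; {i, j} \<in> E\<rbrakk> \<Longrightarrow> (i, j) \<in> R \<or> (j, i) \<in> R"
    using simple_graph_orientation[OF assms(1)] by (metis (no_types, lifting))
  interpret H: root_torus_manifold herm_act "herm_isospectral E l" "herm_space E"
    "{(i, j, 0) | i j. (i, j) \<in> R}" "perm_spectra l" herm_diag herm_root herm_diag_part herm_coeff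
    by (rule root_torus_manifold_herm[OF R assms(3)])
  interpret S: root_torus_manifold skew_act "skew_isospectral E l" "skew_space E"
    "{(i, j, b) | i j b. (i, j) \<in> R}" "signed_spectra l" skew_diag skew_root skew_diag_part skew_coeff
    by (rule root_torus_manifold_skew[OF R assms(3)])
  have inj: "inj l" and inj_abs: "inj (\<lambda>k. \<bar>l k\<bar>)" and nz: "\<forall>k. l k \<noteq> 0"
    using assms(3) by (auto simp: generic_spectrum_def inj_def)
  let ?t = "Transposition.transpose :: 'n \<Rightarrow> 'n \<Rightarrow> 'n \<Rightarrow> 'n"
  define hv where "hv \<sigma> = (\<chi> k. l (\<sigma> k))" for \<sigma> :: "'n \<Rightarrow> 'n"
  define sv where "sv s \<sigma> = (\<chi> k. bit_sign (s k) * l (\<sigma> k))" for s :: "'n \<Rightarrow> bit" and \<sigma> :: "'n \<Rightarrow> 'n"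
  have hv: "herm_vertex l \<sigma> = herm_diag (hv \<sigma>)" for \<sigma> by (simp add: herm_vertex_eq hv_def)
  have sv: "skew_vertex l s \<sigma> = skew_diag (sv s \<sigma>)" for s \<sigma> by (simp add: skew_vertex_eq sv_def)
  have hv_inj: "herm_vertex l \<sigma> = herm_vertex l \<sigma>' \<longleftrightarrow> \<sigma> = \<sigma>'" for \<sigma> \<sigma>' by (rule herm_vertex_inj[OF inj])
  have sv_inj: "sv s \<sigma> = sv s' \<sigma>' \<longleftrightarrow> s = s' \<and> \<sigma> = \<sigma>'" for s s' \<sigma> \<sigma>'
    unfolding sv_def by (rule signed_spectrum_inj[OF inj_abs nz])
  have hv_spec: "perm_spectra l = {hv \<sigma> | \<sigma>. bij \<sigma>}" by (simp add: perm_spectra_def hv_def)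
  have sv_spec: "signed_spectra l = {sv s \<sigma> | s \<sigma>. bij \<sigma>}" by (simp add: signed_spectra_def sv_def)
  have hv_reflect: "reflect (i, j, 0) (hv \<sigma>) = hv (\<sigma> \<circ> ?t i j)" if "i \<noteq> j" for i j \<sigma>
    unfolding hv_def by (rule reflect_hermitian_spectrum[OF that])
  have sv_reflect: "reflect (i, j, b) (sv s \<sigma>) = sv (swap_signs i j b s) (\<sigma> \<circ> ?t i j)" if "i \<noteq> j" for i j b s \<sigma>
    unfolding sv_def by (rule reflect_signed_spectrum[OF that])
  have t_ne: "\<sigma> \<circ> ?t i j \<noteq> \<sigma>" if "i \<noteq> j" "bij \<sigma>" for i j \<sigma>
    using comp_bij_cancel[OF that(2), of "?t i j" id] that(1) by (simp add: transpose_eq_id_iff)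
  have tt: "\<sigma> \<circ> ?t i j \<circ> ?t i j = \<sigma>" for \<sigma> i j by (simp add: comp_assoc)
  have bij_t: "bij (\<sigma> \<circ> ?t i j)" if "bij \<sigma>" for \<sigma> i j using that by (simp add: bij_comp)

  define KH where "KH i j \<sigma> = H.K (i, j, 0) (hv \<sigma>)" for i j \<sigma>
  \<comment> \<open>The common labels of the edges of both graphs: an oriented edge, a bit and a
    starting vertex. Each edge has exactly two labels, one for each of its ends.\<close>
  define T where "T = {(i, j, b :: bit, s :: 'n \<Rightarrow> bit, \<sigma> :: 'n \<Rightarrow> 'n). (i, j) \<in> R \<and> bij \<sigma>}"
  define P where "P = (\<lambda>(i, j, b, s, \<sigma>). {(s, herm_vertex l \<sigma>), (swap_signs i j b s, herm_vertex l (\<sigma> \<circ> ?t i j))})"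
  define eE where "eE = (\<lambda>(i, j, b, s, \<sigma>). (KH i j \<sigma>, P (i, j, b, s, \<sigma>)))"
  define eS where "eS = (\<lambda>(i, j, b, s, \<sigma>). S.K (i, j, b) (sv s \<sigma>))"

  have edges_\<mu>: "edges \<mu> = {KH i j \<sigma> | i j \<sigma>. (i, j) \<in> R \<and> bij \<sigma>}"
    unfolding assms(4) gkm_graph_def KH_def by (simp add: H.invariant_spheres_eq hv_spec) blast
  have hI: "(i, j, 0) \<in> {(i, j, 0) | i j. (i, j) \<in> R}" "hv \<sigma> \<in> perm_spectra l" "i \<noteq> j"
    if "(i, j) \<in> R" "bij \<sigma>" for i j \<sigma>
    using that R(1) hv_spec by auto
  have sI: "(i, j, b) \<in> {(i, j, b) | i j b. (i, j) \<in> R}" "sv s \<sigma> \<in> signed_spectra l"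
    if "(i, j) \<in> R" "bij \<sigma>" for i j b s \<sigma>
    using that sv_spec by auto
  have ends_\<mu>: "ends \<mu> (KH i j \<sigma>) = {herm_vertex l \<sigma>, herm_vertex l (\<sigma> \<circ> ?t i j)}"
    if "(i, j) \<in> R" "bij \<sigma>" for i j \<sigma>
    using H.K_fixed_points[OF hI(1,2)[OF that]] hv_reflect[OF hI(3)[OF that]]
    unfolding assms(4) gkm_graph_def KH_def by (simp add: hv)
  have KH_eq: "KH i j \<sigma> = KH i' j' \<sigma>' \<longleftrightarrow> i = i' \<and> j = j' \<and> (\<sigma>' = \<sigma> \<or> \<sigma>' = \<sigma> \<circ> ?t i j)"
    if "(i, j) \<in> R" "bij \<sigma>" "(i', j') \<in> R" "bij \<sigma>'" for i j \<sigma> i' j' \<sigma>'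
  proof -
    have hv_eq: "hv \<sigma>' = hv \<tau> \<longleftrightarrow> \<sigma>' = \<tau>" for \<tau>
      using hv_inj[of \<sigma>' \<tau>] H.inj_\<Delta> by (simp add: hv inj_eq)
    show ?thesis
      unfolding KH_def H.K_eq_iff[OF hI(1)[OF that(1,2)] hI(1)[OF that(3,4)] hI(2)[OF that(1,2)] hI(2)[OF that(3,4)]]
        hv_reflect[OF hI(3)[OF that(1,2)]] hv_eq by simp
  qed
  have KS_eq: "S.K (i, j, b) (sv s \<sigma>) = S.K (i', j', b') (sv s' \<sigma>') \<longleftrightarrow>
      i = i' \<and> j = j' \<and> b = b' \<and> (s' = s \<and> \<sigma>' = \<sigma> \<or> s' = swap_signs i j b s \<and> \<sigma>' = \<sigma> \<circ> ?t i j)"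
    if "(i, j) \<in> R" "bij \<sigma>" "(i', j') \<in> R" "bij \<sigma>'" for i j b s \<sigma> i' j' b' s' \<sigma>'
    unfolding S.K_eq_iff[OF sI(1)[OF that(1,2)] sI(1)[OF that(3,4)] sI(2)[OF that(1,2)] sI(2)[OF that(3,4)]]
      sv_reflect[OF hI(3)[OF that(1,2)]] sv_inj by simp

  have same_edges: "eE x = eE y \<longleftrightarrow> eS x = eS y" if "x \<in> T" "y \<in> T" for x y
  proof -
    obtain i j b s \<sigma> where x: "x = (i, j, b, s, \<sigma>)" "(i, j) \<in> R" "bij \<sigma>" using \<open>x \<in> T\<close> by (auto simp: T_def)
    obtain i' j' b' s' \<sigma>' where y: "y = (i', j', b', s', \<sigma>')" "(i', j') \<in> R" "bij \<sigma>'" using \<open>y \<in> T\<close> by (auto simp: T_def)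
    have ij: "i \<noteq> j" using R(1) x(2) by blast
    have ne: "\<sigma> \<circ> ?t i j \<noteq> \<sigma>" by (rule t_ne[OF ij x(3)])
    \<comment> \<open>With the same starting permutation the end points can be told apart, so the
      signs at the start are visible and those at the other end determine the bit.\<close>
    have P_eq: "P (i, j, b, s, \<sigma>) = P (i, j, b', s', \<sigma>) \<longleftrightarrow> s' = s \<and> b' = b"
      unfolding P_def using ne swap_signs_inj[of i j b s b'] by (auto simp: doubleton_eq_iff hv_inj)
    \<comment> \<open>The same edge read from its other end: the start moves by the reflection, and
      the bit is unchanged because \<open>swap_signs\<close> is an involution.\<close>
    have P_eq': "P (i, j, b, s, \<sigma>) = P (i, j, b', s', \<sigma> \<circ> ?t i j) \<longleftrightarrow> s' = swap_signs i j b s \<and> b' = b"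
    proof -
      have "P (i, j, b, s, \<sigma>) = P (i, j, b', s', \<sigma> \<circ> ?t i j) \<longleftrightarrow>
          s = swap_signs i j b' s' \<and> swap_signs i j b s = s'"
        unfolding P_def prod.case tt using ne by (auto simp: doubleton_eq_iff hv_inj)
      also have "\<dots> \<longleftrightarrow> s' = swap_signs i j b s \<and> b' = b"
        using swap_signs_involutive[OF ij] swap_signs_inj[of i j] by metis
      finally show ?thesis .
    qed
    have "eE x = eE y \<longleftrightarrow> i = i' \<and> j = j' \<and> (\<sigma>' = \<sigma> \<or> \<sigma>' = \<sigma> \<circ> ?t i j) \<and>
        P (i, j, b, s, \<sigma>) = P (i', j', b', s', \<sigma>')"
      unfolding eE_def x(1) y(1) prod.case prod.inject KH_eq[OF x(2,3) y(2,3)] by blast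
    also have "\<dots> \<longleftrightarrow> i = i' \<and> j = j' \<and> b = b' \<and> (s' = s \<and> \<sigma>' = \<sigma> \<or> s' = swap_signs i j b s \<and> \<sigma>' = \<sigma> \<circ> ?t i j)"
      using P_eq P_eq' by metis
    also have "\<dots> \<longleftrightarrow> eS x = eS y"
      unfolding eS_def x(1) y(1) prod.case KS_eq[OF x(2,3) y(2,3)] ..
    finally show ?thesis .
  qed

  have edges_\<eta>: "edges (eta_graph l \<mu>) = eE ` T"
  proof
    show "eE ` T \<subseteq> edges (eta_graph l \<mu>)"
    proof
      fix e assume "e \<in> eE ` T"
      then obtain i j b s \<sigma> where e: "e = eE (i, j, b, s, \<sigma>)" "(i, j) \<in> R" "bij \<sigma>" by (auto simp: T_def)
      have ij: "i \<noteq> j" using R(1) e(2) by blast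
      have "KH i j \<sigma> \<in> edges \<mu>" using edges_\<mu> e(2,3) by blast
      then show "e \<in> edges (eta_graph l \<mu>)"
        unfolding e(1) eE_def P_def prod.case eta_graph_def axial_graph.select_convs
        using ends_\<mu>[OF e(2,3)] compatible_swap_signs[OF ij] ij e(3) by blast
    qed
    show "edges (eta_graph l \<mu>) \<subseteq> eE ` T"
    proof
      fix x assume "x \<in> edges (eta_graph l \<mu>)"
      then obtain e s s' \<sigma> i j where x: "x = (e, {(s, herm_vertex l \<sigma>), (s', herm_vertex l (\<sigma> \<circ> ?t i j))})"
        and e: "e \<in> edges \<mu>" and \<sigma>: "bij \<sigma>" and ij: "i \<noteq> j"
        and ends: "ends \<mu> e = {herm_vertex l \<sigma>, herm_vertex l (\<sigma> \<circ> ?t i j)}"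
        and c: "compatible_signs i j s s'"
        unfolding eta_graph_def axial_graph.select_convs by blast
      obtain i0 j0 \<sigma>0 where e0: "e = KH i0 j0 \<sigma>0" "(i0, j0) \<in> R" "bij \<sigma>0" using e edges_\<mu> by blast
      \<comment> \<open>The edges of \<eta> are described with arbitrary \<open>i\<close>,
        \<open>j\<close> and either end of \<open>e\<close>. Comparing end points shows that the
        transposition is that of the oriented edge, and that \<sigma> may serve as its starting
        permutation.\<close>
      have "{herm_vertex l \<sigma>, herm_vertex l (\<sigma> \<circ> ?t i j)} = {herm_vertex l \<sigma>0, herm_vertex l (\<sigma>0 \<circ> ?t i0 j0)}"
        using ends ends_\<mu>[OF e0(2,3)] e0(1) by simp
      then have "\<sigma> = \<sigma>0 \<and> \<sigma> \<circ> ?t i j = \<sigma>0 \<circ> ?t i0 j0 \<or> \<sigma> = \<sigma>0 \<circ> ?t i0 j0 \<and> \<sigma> \<circ> ?t i j = \<sigma>0"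
        by (simp add: doubleton_eq_iff hv_inj)
      then have both: "\<sigma> \<circ> ?t i j = \<sigma> \<circ> ?t i0 j0" "\<sigma> = \<sigma>0 \<or> \<sigma> = \<sigma>0 \<circ> ?t i0 j0"
        using tt[of \<sigma>0 i0 j0] by auto
      then have t: "?t i j = ?t i0 j0" using comp_bij_cancel[OF \<sigma>] by blast
      have e\<sigma>: "e = KH i0 j0 \<sigma>" unfolding e0(1) using KH_eq[OF e0(2,3) e0(2) \<sigma>] both(2) by blast
      have "\<exists>b. s' = swap_signs i0 j0 b s"
        using transpose_eq_transposeD[OF t ij] compatible_signs_imp_swap[OF ij c] swap_signs_commute[of i j] by metis
      then obtain b where "s' = swap_signs i0 j0 b s" by blast
      then have "x = eE (i0, j0, b, s, \<sigma>)" by (simp add: x eE_def P_def e\<sigma> t)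
      moreover have "(i0, j0, b, s, \<sigma>) \<in> T" using e0(2) \<sigma> by (simp add: T_def)
      ultimately show "x \<in> eE ` T" by blast
    qed
  qed
  have edges_S: "edges (gkm_graph skew_act (skew_isospectral E l)) = eS ` T"
  proof -
    have "invariant_spheres skew_act (skew_isospectral E l) = eS ` T"
      unfolding S.invariant_spheres_eq sv_spec T_def eS_def by (auto simp: image_iff) blast+
    then show ?thesis by (simp add: gkm_graph_def)
  qed

  have axial_\<eta>: "axial (eta_graph l \<mu>) (eE (i, j, b, s, \<sigma>)) = {root_weight (i, j, b), - root_weight (i, j, b)}"
    if "(i, j) \<in> R" "bij \<sigma>" for i j b s \<sigma>
  proof -
    have ij: "i \<noteq> j" using R(1) that(1) by blast
    let ?w = "{root_weight (i, j, b), - root_weight (i, j, b)}"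
    let ?A = "{w. \<exists>s1 s1' \<sigma>1 i1 j1. bij \<sigma>1 \<and> i1 \<noteq> j1 \<and> compatible_signs i1 j1 s1 s1' \<and>
        P (i, j, b, s, \<sigma>) = {(s1, herm_vertex l \<sigma>1), (s1', herm_vertex l (\<sigma>1 \<circ> ?t i1 j1))} \<and>
        w \<in> {skew_weight i1 j1 s1 s1', - skew_weight i1 j1 s1 s1'}}"
    have "axial (eta_graph l \<mu>) (eE (i, j, b, s, \<sigma>)) = ?A"
      by (simp add: eta_graph_def eE_def)
    also have "?A = ?w"
    proof
      have "P (i, j, b, s, \<sigma>) = {(s, herm_vertex l \<sigma>), (swap_signs i j b s, herm_vertex l (\<sigma> \<circ> ?t i j))}"
        by (simp add: P_def)
      then show "?w \<subseteq> ?A"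
        unfolding skew_weight_swap_signs[OF ij, symmetric, of b s]
        using that(2) ij compatible_swap_signs[OF ij, of s b] by blast
      \<comment> \<open>The axial function of \<eta> collects the weights of all descriptions of the
        end points. A description may exchange the ends or the indices \<open>i\<close> and
        \<open>j\<close>; each changes the weight at most by a sign.\<close>
      show "?A \<subseteq> ?w"
      proof
        fix w assume "w \<in> ?A"
        then obtain s1 s1' \<sigma>1 i1 j1 where 1: "bij \<sigma>1" "i1 \<noteq> j1"
          "P (i, j, b, s, \<sigma>) = {(s1, herm_vertex l \<sigma>1), (s1', herm_vertex l (\<sigma>1 \<circ> ?t i1 j1))}"
          "w \<in> {skew_weight i1 j1 s1 s1', - skew_weight i1 j1 s1 s1'}" by blast
        from 1(3) have cases: "s1 = s \<and> \<sigma>1 = \<sigma> \<and> s1' = swap_signs i j b s \<and> \<sigma>1 \<circ> ?t i1 j1 = \<sigma> \<circ> ?t i j \<or>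
            s1 = swap_signs i j b s \<and> \<sigma>1 = \<sigma> \<circ> ?t i j \<and> s1' = s \<and> \<sigma>1 \<circ> ?t i1 j1 = \<sigma>"
          unfolding P_def by (auto simp: doubleton_eq_iff hv_inj)
        then have sw: "s1' = swap_signs i j b s1" using swap_signs_involutive[OF ij] by metis
        have "\<sigma>1 \<circ> ?t i1 j1 = \<sigma>1 \<circ> ?t i j" using cases tt[of \<sigma> i j] by auto
        then have "?t i1 j1 = ?t i j" using comp_bij_cancel[OF 1(1)] by blast
        then have "i1 = i \<and> j1 = j \<or> i1 = j \<and> j1 = i" by (rule transpose_eq_transposeD[OF _ 1(2)])
        then show "w \<in> ?w"
        proof
          assume "i1 = i \<and> j1 = j"
          then show ?thesis using 1(4) skew_weight_swap_signs[OF ij] by (simp add: sw)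
        next
          assume sw': "i1 = j \<and> j1 = i"
          then have "skew_weight i1 j1 s1 s1' = root_weight (j, i, b)"
            using skew_weight_swap_signs[OF ij[symmetric]] by (simp add: sw swap_signs_commute[of i j])
          then show ?thesis using 1(4) root_weight_commute[of j i b] by simp
        qed
      qed
    qed
    finally show ?thesis .
  qed

  \<comment> \<open>A vertex of \<eta> carries the diagonal matrix and not the permutation, which is
    recovered by choice; distinct eigenvalues make the choice unique.\<close>
  define f where "f = (\<lambda>(s, A). skew_vertex l s (SOME \<sigma>. bij \<sigma> \<and> A = herm_vertex l \<sigma>))"
  have f: "f (s, herm_vertex l \<sigma>) = skew_vertex l s \<sigma>" if "bij \<sigma>" for s \<sigma>
  proof -
    have "(SOME \<sigma>'. bij \<sigma>' \<and> herm_vertex l \<sigma> = herm_vertex l \<sigma>') = \<sigma>"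
      unfolding hv_inj by (rule some_equality) (use that in auto)
    then show ?thesis by (simp add: f_def)
  qed
  have verts_\<mu>: "verts \<mu> = {herm_vertex l \<sigma> | \<sigma>. bij \<sigma>}"
    unfolding assms(4) gkm_graph_def by (auto simp: H.fixed_points_eq hv_spec hv)
  obtain g where g: "bij_betw g (eE ` T) (eS ` T)" "\<And>x. x \<in> T \<Longrightarrow> g (eE x) = eS x"
    using bij_betw_images[of T eE eS, OF same_edges] by metis
  have "axial_graph_iso f g (eta_graph l \<mu>) (gkm_graph skew_act (skew_isospectral E l))"
    unfolding axial_graph_iso_def edges_\<eta> edges_S
  proof (intro conjI ballI g(1))
    have "inj_on f (UNIV \<times> verts \<mu>)"
      unfolding verts_\<mu> by (rule inj_onI) (auto simp: f sv hv_inj S.inj_\<Delta>[THEN inj_eq] sv_inj)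
    moreover have "f ` (UNIV \<times> verts \<mu>) = fixed_points skew_act (skew_isospectral E l)"
    proof -
      have "f ` (UNIV \<times> verts \<mu>) = {skew_vertex l s \<sigma> | s \<sigma>. bij \<sigma>}"
        unfolding verts_\<mu> using f by (auto simp: image_iff) (metis f)
      also have "\<dots> = fixed_points skew_act (skew_isospectral E l)"
        by (auto simp: S.fixed_points_eq sv_spec sv)
      finally show ?thesis .
    qed
    ultimately show "bij_betw f (verts (eta_graph l \<mu>)) (verts (gkm_graph skew_act (skew_isospectral E l)))"
      by (simp add: bij_betw_def eta_graph_def gkm_graph_def)
  next
    fix e assume "e \<in> eE ` T"
    then obtain i j b s \<sigma> where e: "e = eE (i, j, b, s, \<sigma>)" "(i, j) \<in> R" "bij \<sigma>" by (auto simp: T_def)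
    have ge: "g e = S.K (i, j, b) (sv s \<sigma>)"
      using g(2)[of "(i, j, b, s, \<sigma>)"] e by (simp add: T_def eS_def)
    have ij: "i \<noteq> j" using R(1) e(2) by blast
    have "ends (eta_graph l \<mu>) e = {(s, herm_vertex l \<sigma>), (swap_signs i j b s, herm_vertex l (\<sigma> \<circ> ?t i j))}"
      by (simp add: e(1) eta_graph_def eE_def P_def)
    then have "f ` ends (eta_graph l \<mu>) e = {skew_vertex l s \<sigma>, skew_vertex l (swap_signs i j b s) (\<sigma> \<circ> ?t i j)}"
      using f[OF e(3)] f[OF bij_t[OF e(3)]] by simp
    then show "ends (gkm_graph skew_act (skew_isospectral E l)) (g e) = f ` ends (eta_graph l \<mu>) e"
      using S.K_fixed_points[OF sI[OF e(2,3)]] sv_reflect[OF ij] by (simp add: ge gkm_graph_def sv)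
    show "axial (gkm_graph skew_act (skew_isospectral E l)) (g e) = axial (eta_graph l \<mu>) e"
      unfolding ge unfolding e(1) axial_\<eta>[OF e(2,3)] by (rule S.axial_K[OF sI[OF e(2,3)]])
  qed
  then show ?thesis
    using H.gkm_manifold S.gkm_manifold verts_\<mu> f by blast
qed

end
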